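(* Let $\mathfrak g=\mathfrak{sl}(n+1,\mathbb C)$ for some $n\ge 2$ and let $k\ge l\ge 0$ be integers. Let $\mu=\sum_{i=1}^{n+1}a_i\varepsilon_i\in P(\mathfrak g)$ with $a_i\in\mathbb N_0$ for all $i$ and $\sum_{i=1}^{n+1}a_i=k+l$. If $a_i\le k$ for all $i$, then $$\begin{aligned} m_{\pi_{k\varepsilon_1+l\varepsilon_2}}(\mu)=&\sum_{\mathbf q\in\mathcal Q_{n+1}(l)}\ \prod_{j=1}^{l}\binom{n+1-\sum_{t=0}^{j-1}\ell_t(\mu)-\sum_{i=j+1}^{l}s_i^{\mathbf q}}{s_j^{\mathbf q}}\\ &-\sum_{\mathbf q'\in\mathcal Q_{n+1}(l-1)}\ \prod_{j=1}^{l-1}\binom{n+1-\sum_{t=0}^{j-1}\ell_t(\mu)-\sum_{i=j+1}^{l-1}s_i^{\mathbf q'}}{s_j^{\mathbf q'}}, \end{aligned}$$ and $m_{\pi_{k\varepsilon_1+l\varepsilon_2}}(\mu)=0$ otherwise. Here $\ell_t(\mu)=\#\{i:1\le i\le n+1,\ a_i=t\}$, $$\mathcal Q_{n+1}(N)=\{\mathbf q=(q_1,\dots,q_{n+1})\in\mathbb Z^{n+1}:q_1\ge q_2\ge\dots\ge q_{n+1}\ge 0,\ \textstyle\sum_{i=1}^{n+1}q_i=N\},$$ and $s_j^{\mathbf q}=\#\{i:1\le i\le n+1,\ q_i=j\}$ for $\mathbf q\in\mathcal Q_{n+1}(N)$ and $1\le j\le N$.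
   Context: Let $\mathfrak h$ be the Cartan subalgebra of diagonal trace-zero matrices in $\mathfrak{sl}(n+1,\mathbb C)$, and $\varepsilon_i(\mathrm{diag}(\theta_1,\dots,\theta_{n+1}))=\theta_i$, so that $\mathfrak h^*=\bigoplus_{i=1}^{n+1}\mathbb C\varepsilon_i/\langle\sum_{i=1}^{n+1}\varepsilon_i=0\rangle$ and the weight lattice is $P(\mathfrak g)=\bigoplus_{i=1}^{n+1}\mathbb Z\varepsilon_i/\langle\sum_{i=1}^{n+1}\varepsilon_i=0\rangle$. Positive roots are $\varepsilon_i-\varepsilon_j$ for $1\le i<j\le n+1$. $\pi_\lambda$ is the irreducible representation of $\mathfrak g$ with highest weight $\lambda$ and $m_\pi(\mu)$ is the multiplicity of the weight $\mu$ in $\pi$ (the dimension of the $\mu$-weight space). $\mathbb N_0$ is the set of non-negative integers. Conventions: $\binom ba=0$ if $a<0$ or $b<a$; empty sums are $0$ and empty products are $1$; $\mathcal Q_{n+1}(-1)=\emptyset$. *)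

theory Defs
  imports Complex_Main "Jordan_Normal_Form.Matrix"
begin

section \<open>The Lie algebra of trace-zero matrices\<close>

definition sl :: "nat \<Rightarrow> complex mat set" where
  "sl m = {A \<in> carrier_mat m m. (\<Sum>i<m. A $$ (i, i)) = 0}"

definition lie_bracket :: "complex mat \<Rightarrow> complex mat \<Rightarrow> complex mat" where
  "lie_bracket A B = A * B - B * A"

definition cartan :: "nat \<Rightarrow> complex mat set" where
  "cartan m = {H \<in> sl m. diagonal_mat H}"

text \<open>
  An element of the dual of the Cartan subalgebra is represented by a function on matrices of
  which only the values on \<^term>\<open>cartan m\<close> matter; in particular the relation that the sum of
  all \<open>epsilon i\<close> is zero holds there.  The index of \<open>epsilon\<close> runs over \<^term>\<open>{1..m}\<close>,
  whereas matrix entries are indexed from \<open>0\<close>.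
\<close>

definition epsilon :: "nat \<Rightarrow> complex mat \<Rightarrow> complex" where
  "epsilon i H = H $$ (i - 1, i - 1)"

definition root_space :: "nat \<Rightarrow> (complex mat \<Rightarrow> complex) \<Rightarrow> complex mat set" where
  "root_space m \<alpha> = {X \<in> sl m. \<forall>H\<in>cartan m. lie_bracket H X = \<alpha> H \<cdot>\<^sub>m X}"


section \<open>Representations\<close>

text \<open>
  The representation space is a complex subspace \<open>V\<close> of an arbitrary complex vector space, and
  only the action of \<^term>\<open>sl m\<close> on \<open>V\<close> is constrained.
\<close>

locale sl_representation = vector_space scale
  for scale :: "complex \<Rightarrow> 'v::ab_group_add \<Rightarrow> 'v" +
  fixes m :: nat and V :: "'v set" and \<rho> :: "complex mat \<Rightarrow> 'v \<Rightarrow> 'v"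
  assumes subspace_V: "subspace V"
    and closed: "A \<in> sl m \<Longrightarrow> v \<in> V \<Longrightarrow> \<rho> A v \<in> V"
    and add_vec: "A \<in> sl m \<Longrightarrow> v \<in> V \<Longrightarrow> w \<in> V \<Longrightarrow> \<rho> A (v + w) = \<rho> A v + \<rho> A w"
    and scale_vec: "A \<in> sl m \<Longrightarrow> v \<in> V \<Longrightarrow> \<rho> A (scale c v) = scale c (\<rho> A v)"
    and add_mat: "A \<in> sl m \<Longrightarrow> B \<in> sl m \<Longrightarrow> v \<in> V \<Longrightarrow> \<rho> (A + B) v = \<rho> A v + \<rho> B v"
    and scale_mat: "A \<in> sl m \<Longrightarrow> v \<in> V \<Longrightarrow> \<rho> (c \<cdot>\<^sub>m A) v = scale c (\<rho> A v)"
    and bracket: "A \<in> sl m \<Longrightarrow> B \<in> sl m \<Longrightarrow> v \<in> V \<Longrightarrow>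
      \<rho> (lie_bracket A B) v = \<rho> A (\<rho> B v) - \<rho> B (\<rho> A v)"

locale irreducible_sl_representation = sl_representation +
  assumes nonzero: "V \<noteq> {0}"
    and irreducible: "subspace W \<Longrightarrow> W \<subseteq> V \<Longrightarrow> (\<And>A w. A \<in> sl m \<Longrightarrow> w \<in> W \<Longrightarrow> \<rho> A w \<in> W) \<Longrightarrow>
      W = {0} \<or> W = V"

definition weight_space ::
  "(complex \<Rightarrow> 'v::ab_group_add \<Rightarrow> 'v) \<Rightarrow> nat \<Rightarrow> 'v set \<Rightarrow> (complex mat \<Rightarrow> 'v \<Rightarrow> 'v) \<Rightarrow>
    (complex mat \<Rightarrow> complex) \<Rightarrow> 'v set" where
  "weight_space scale m V \<rho> \<mu> = {v \<in> V. \<forall>H\<in>cartan m. \<rho> H v = scale (\<mu> H) v}"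

definition weight_multiplicity ::
  "(complex \<Rightarrow> 'v::ab_group_add \<Rightarrow> 'v) \<Rightarrow> nat \<Rightarrow> 'v set \<Rightarrow> (complex mat \<Rightarrow> 'v \<Rightarrow> 'v) \<Rightarrow>
    (complex mat \<Rightarrow> complex) \<Rightarrow> nat" where
  "weight_multiplicity scale m V \<rho> \<mu> = vector_space.dim scale (weight_space scale m V \<rho> \<mu>)"

text \<open>
  The positive roots are \<open>epsilon i - epsilon j\<close> for \<open>i < j\<close>; a highest weight vector is a nonzero
  weight vector annihilated by all positive root spaces.
\<close>

definition has_highest_weight ::
  "(complex \<Rightarrow> 'v::ab_group_add \<Rightarrow> 'v) \<Rightarrow> nat \<Rightarrow> 'v set \<Rightarrow> (complex mat \<Rightarrow> 'v \<Rightarrow> 'v) \<Rightarrow>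
    (complex mat \<Rightarrow> complex) \<Rightarrow> bool" where
  "has_highest_weight scale m V \<rho> \<Lambda> \<longleftrightarrow>
    (\<exists>v\<in>weight_space scale m V \<rho> \<Lambda>. v \<noteq> 0 \<and>
      (\<forall>i j. 1 \<le> i \<and> i < j \<and> j \<le> m \<longrightarrow>
        (\<forall>X\<in>root_space m (\<lambda>H. epsilon i H - epsilon j H). \<rho> X v = 0)))"


section \<open>Combinatorial data\<close>

text \<open>
  Unlike \<^const>\<open>gbinomial\<close>, and unlike \<^const>\<open>binomial\<close> after truncation to natural
  numbers, this coefficient vanishes for a negative upper argument even if the lower one is \<open>0\<close>.
\<close>

definition int_binomial :: "int \<Rightarrow> int \<Rightarrow> int" where
  "int_binomial b a = (if a < 0 \<or> b < a then 0 else int (nat b choose nat a))"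

text \<open>
  The length-\<open>m\<close> integer tuples are extensional functions on \<^term>\<open>{1..m}\<close>, so that each tuple
  is counted once.  For negative \<open>N\<close> the set is empty.
\<close>

definition partitions :: "nat \<Rightarrow> int \<Rightarrow> (nat \<Rightarrow> int) set" where
  "partitions m N = {q \<in> extensional {1..m}.
     (\<forall>i\<in>{1..m}. \<forall>j\<in>{1..m}. i \<le> j \<longrightarrow> q i \<ge> q j) \<and> (\<forall>i\<in>{1..m}. q i \<ge> 0) \<and>
     (\<Sum>i\<in>{1..m}. q i) = N}"

definition part_count :: "nat \<Rightarrow> (nat \<Rightarrow> int) \<Rightarrow> int \<Rightarrow> int" where
  "part_count m q j = int (card {i \<in> {1..m}. q i = j})"

definition level_count :: "nat \<Rightarrow> (nat \<Rightarrow> nat) \<Rightarrow> int \<Rightarrow> int" where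
  "level_count m a t = int (card {i \<in> {1..m}. int (a i) = t})"

end

theory Submission
  imports Defs "HOL-Library.Function_Algebras" "HOL-Library.Product_Plus"
begin

text \<open>
  The multiplicity is a two-row Kostka number: with \<open>N\<^sub>L\<close> the number of integer vectors
  \<open>0 \<le> c \<le> a\<close> whose entries have sum \<open>L\<close>, it equals \<open>N\<^sub>l - N\<^sub>(l - 1)\<close>, and the
  two sums over partitions in the formula are these two numbers.

  An irreducible representation is determined by its highest weight as far as weight multiplicities are
  concerned (\<open>weight_multiplicity_unique\<close>), so it is enough to find one model of the
  representation and to compute there. The model consists of the polynomials in two rows of variables
  \<open>x\<^sub>i\<close>, \<open>y\<^sub>i\<close>, with \<open>i\<close> counted from \<open>0\<close> as for matrix entries, that
  have degree \<open>k\<close> in the \<open>x\<^sub>i\<close>, degree \<open>l\<close> in the \<open>y\<^sub>i\<close>, and are killed by the polarization operator \<open>D = \<Sum>i. x\<^sub>i \<partial>/\<partial>y\<^sub>i\<close>.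

  The model is irreducible (\<open>two_row_module_irreducible\<close>) because, up to scalars, it has only one
  vector killed by all raising operators, the product of a power of \<open>x\<^sub>0\<close> and a power of the
  determinant \<open>x\<^sub>0 y\<^sub>1 - x\<^sub>1 y\<^sub>0\<close>. Every nonzero submodule contains such a vector, hence
  this one. For the Fischer inner product, in which multiplication by a variable is adjoint to
  differentiation, the orthogonal complement of a submodule is again a submodule; a proper nonzero
  submodule and its complement cannot both contain the same nonzero vector.

  Monomials of weight \<open>a\<close> and degree \<open>L\<close> in the \<open>y\<^sub>i\<close> correspond to the vectors counted
  by \<open>N\<^sub>L\<close>. For \<open>l \<le> k\<close> the operator \<open>D\<close> maps the polynomials of degrees \<open>(k, l)\<close> onto
  those of degrees \<open>(k + 1, l - 1)\<close>, or equivalently its adjoint \<open>D'\<close> is injective, since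
  \<open>D D' - D' D\<close> acts on the latter as the positive number \<open>k - l + 2\<close>. The kernel of \<open>D\<close> in weight
  \<open>a\<close> thus has dimension \<open>N\<^sub>l - N\<^sub>(l - 1)\<close> (\<open>two_row_multiplicity\<close>).

  The counting of vectors (\<open>card_subvectors\<close>) groups them by the partition obtained by sorting, and
  places the entries from the largest to the smallest: an entry \<open>j\<close> fits where \<open>a i \<ge> j\<close>, and
  all places of larger entries are among these, so each binomial coefficient is independent of the
  choices before. If some \<open>a i\<close> exceeds \<open>k\<close>, lowering the \<open>i\<close>-th entry by one is a bijection
  that gives \<open>N\<^sub>l = N\<^sub>(l - 1)\<close> (\<open>card_subvectors_large_entry\<close>).
\<close>

section \<open>Matrix units and the grading element\<close>

definition unit_mat :: "nat \<Rightarrow> nat \<Rightarrow> nat \<Rightarrow> complex mat" where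
  "unit_mat m i j = mat m m (\<lambda>(p, q). if p = i \<and> q = j then 1 else 0)"

text \<open>
  Half the sum of the positive coroots: bracketing with it multiplies the matrix unit at position
  \<open>(i, j)\<close> by the integer \<open>j - i\<close>, so that a single element of the Cartan subalgebra suffices to
  tell raising, diagonal and lowering matrices apart.
\<close>
definition grading_mat :: "nat \<Rightarrow> complex mat" where
  "grading_mat m = mat m m (\<lambda>(p, q). if p = q then (of_nat m - 1) / 2 - of_nat p else 0)"

lemma unit_mat_in_sl: "i \<noteq> j \<Longrightarrow> unit_mat m i j \<in> sl m"
  by (auto simp: sl_def unit_mat_def intro!: sum.neutral)

lemma sl_carrier: "A \<in> sl m \<Longrightarrow> A \<in> carrier_mat m m"
  by (simp add: sl_def)

lemma cartan_in_sl: "H \<in> cartan m \<Longrightarrow> H \<in> sl m"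
  by (simp add: cartan_def)

lemma grading_mat_in_cartan: "grading_mat m \<in> cartan m"
proof -
  have "(\<Sum>i<m. of_nat i) = (of_nat m * ((of_nat m - 1) / 2) :: complex)"
    by (induction m) (auto simp: field_simps)
  then have "(\<Sum>i<m. (of_nat m - 1) / 2 - of_nat i :: complex) = 0"
    by (simp add: sum_subtractf)
  then show ?thesis
    by (auto simp: cartan_def sl_def grading_mat_def diagonal_mat_def)
qed

lemma mult_mat_entry:
  assumes "A \<in> carrier_mat m m" "B \<in> carrier_mat m m" "p < m" "q < m"
  shows "(A * B) $$ (p, q) = (\<Sum>r<m. A $$ (p, r) * B $$ (r, q))"
  using assms by (auto simp: scalar_prod_def lessThan_atLeast0 intro!: sum.cong)

lemma lie_bracket_carrier:
  assumes "A \<in> carrier_mat m m" "B \<in> carrier_mat m m"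
  shows "lie_bracket A B \<in> carrier_mat m m"
  using assms by (simp add: lie_bracket_def minus_carrier_mat mult_carrier_mat)

lemma lie_bracket_entry:
  assumes "A \<in> carrier_mat m m" "B \<in> carrier_mat m m" "p < m" "q < m"
  shows "lie_bracket A B $$ (p, q) =
    (\<Sum>r<m. A $$ (p, r) * B $$ (r, q)) - (\<Sum>r<m. B $$ (p, r) * A $$ (r, q))"
proof -
  have "lie_bracket A B $$ (p, q) = (A * B) $$ (p, q) - (B * A) $$ (p, q)"
    unfolding lie_bracket_def using assms by (subst index_minus_mat) auto
  then show ?thesis
    using assms by (simp add: mult_mat_entry del: index_mult_mat)
qed

lemma lie_bracket_in_sl:
  assumes "A \<in> sl m" "B \<in> sl m"
  shows "lie_bracket A B \<in> sl m"
proof -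
  have c: "A \<in> carrier_mat m m" "B \<in> carrier_mat m m"
    using assms by (auto simp: sl_def)
  have "(\<Sum>i<m. lie_bracket A B $$ (i, i)) =
      (\<Sum>i<m. (\<Sum>r<m. A $$ (i, r) * B $$ (r, i)) - (\<Sum>r<m. B $$ (i, r) * A $$ (r, i)))"
    using c by (intro sum.cong) (auto simp: lie_bracket_entry)
  also have "\<dots> = (\<Sum>i<m. \<Sum>r<m. A $$ (i, r) * B $$ (r, i)) - (\<Sum>i<m. \<Sum>r<m. B $$ (i, r) * A $$ (r, i))"
    by (simp add: sum_subtractf)
  also have "(\<Sum>i<m. \<Sum>r<m. B $$ (i, r) * A $$ (r, i)) = (\<Sum>r<m. \<Sum>i<m. A $$ (r, i) * B $$ (i, r))"
    by (subst sum.swap) (simp add: mult.commute)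
  finally show ?thesis
    using lie_bracket_carrier[OF c] by (simp add: sl_def)
qed

lemma lie_bracket_diagonal_entry:
  assumes H: "H \<in> cartan m" and X: "X \<in> carrier_mat m m" and pq: "p < m" "q < m"
  shows "lie_bracket H X $$ (p, q) = (H $$ (p, p) - H $$ (q, q)) * X $$ (p, q)"
proof -
  have c: "H \<in> carrier_mat m m" and d: "\<And>i j. i < m \<Longrightarrow> j < m \<Longrightarrow> i \<noteq> j \<Longrightarrow> H $$ (i, j) = 0"
    using H by (auto simp: cartan_def sl_def diagonal_mat_def)
  have "(\<Sum>r<m. H $$ (p, r) * X $$ (r, q)) = (\<Sum>r\<in>{p}. H $$ (p, r) * X $$ (r, q))"
    using d pq by (intro sum.mono_neutral_right) auto
  moreover have "(\<Sum>r<m. X $$ (p, r) * H $$ (r, q)) = (\<Sum>r\<in>{q}. X $$ (p, r) * H $$ (r, q))"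
    using d pq by (intro sum.mono_neutral_right) auto
  ultimately show ?thesis
    by (simp add: lie_bracket_entry[OF c X pq] algebra_simps)
qed

lemma lie_bracket_cartan_unit:
  assumes H: "H \<in> cartan m" and "i < m" "j < m"
  shows "lie_bracket H (unit_mat m i j) = (H $$ (i, i) - H $$ (j, j)) \<cdot>\<^sub>m unit_mat m i j"
proof (rule eq_matI)
  have u: "unit_mat m i j \<in> carrier_mat m m"
    by (simp add: unit_mat_def)
  have c: "lie_bracket H (unit_mat m i j) \<in> carrier_mat m m"
    using lie_bracket_carrier[OF sl_carrier[OF cartan_in_sl[OF H]] u] .
  let ?R = "(H $$ (i, i) - H $$ (j, j)) \<cdot>\<^sub>m unit_mat m i j"
  show "dim_row (lie_bracket H (unit_mat m i j)) = dim_row ?R"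
    "dim_col (lie_bracket H (unit_mat m i j)) = dim_col ?R"
    using c u by auto
  fix p q assume "p < dim_row ?R" "q < dim_col ?R"
  then have pq: "p < m" "q < m" using u by auto
  show "lie_bracket H (unit_mat m i j) $$ (p, q) = ?R $$ (p, q)"
    unfolding lie_bracket_diagonal_entry[OF H u pq] using pq by (auto simp: unit_mat_def)
qed

lemma lie_bracket_grading_unit:
  assumes "i < m" "j < m"
  shows "lie_bracket (grading_mat m) (unit_mat m i j) = (of_nat j - of_nat i) \<cdot>\<^sub>m unit_mat m i j"
  using lie_bracket_cartan_unit[OF grading_mat_in_cartan assms] assms by (simp add: grading_mat_def)

lemma unit_mat_in_root_space:
  assumes "i < m" "j < m" "i \<noteq> j"
  shows "unit_mat m i j \<in> root_space m (\<lambda>H. epsilon (Suc i) H - epsilon (Suc j) H)"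
  using assms unit_mat_in_sl[OF assms(3)]
  by (simp add: root_space_def epsilon_def lie_bracket_cartan_unit)

text \<open>
  Comparing eigenvalues of the bracket with \<^const>\<open>grading_mat\<close>: a nonzero entry at \<open>(p, q)\<close>
  forces \<open>q - p = j - i > 0\<close>.
\<close>
lemma root_space_strictly_upper:
  assumes X: "X \<in> root_space m (\<lambda>H. epsilon i H - epsilon j H)"
    and ij: "1 \<le> i" "i < j" "j \<le> m" and pq: "p < m" "q < m" "q \<le> p"
  shows "X $$ (p, q) = 0"
proof -
  let ?g = "grading_mat m"
  have c: "X \<in> carrier_mat m m" and
    b: "lie_bracket ?g X = (epsilon i ?g - epsilon j ?g) \<cdot>\<^sub>m X"
    using X grading_mat_in_cartan by (auto simp: root_space_def sl_def)
  have "(?g $$ (p, p) - ?g $$ (q, q)) * X $$ (p, q) = (epsilon i ?g - epsilon j ?g) * X $$ (p, q)"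
    using lie_bracket_diagonal_entry[OF grading_mat_in_cartan c pq(1,2)] b c pq by auto
  then have "(of_nat q - of_nat p) * X $$ (p, q) = (of_nat (j - i) :: complex) * X $$ (p, q)"
    using ij pq by (simp add: grading_mat_def epsilon_def of_nat_diff algebra_simps)
  moreover have "(of_nat q - of_nat p :: complex) = - of_nat (p - q)"
    using pq by (simp add: of_nat_diff)
  ultimately have "of_nat (j - i) * X $$ (p, q) = - (of_nat (p - q) * X $$ (p, q))"
    by simp
  then have "(of_nat (j - i) + of_nat (p - q)) * X $$ (p, q) = 0"
    by (simp add: distrib_right)
  moreover have "(of_nat (j - i) + of_nat (p - q) :: complex) \<noteq> 0"
    using ij by (metis of_nat_add of_nat_eq_0_iff add_is_0 zero_less_diff less_numeral_extra(3))
  ultimately show ?thesis by simp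
qed

section \<open>The submodule generated by a highest weight vector\<close>

context sl_representation
begin

definition highest_weight_vector :: "(complex mat \<Rightarrow> complex) \<Rightarrow> 'v \<Rightarrow> bool" where
  "highest_weight_vector \<Lambda> u \<longleftrightarrow> u \<in> weight_space scale m V \<rho> \<Lambda> \<and>
     (\<forall>i j. i < j \<and> j < m \<longrightarrow> \<rho> (unit_mat m i j) u = 0)"

text \<open>
  The number counts by how much the eigenvalue of \<^const>\<open>grading_mat\<close> has dropped below that of
  the vector \<open>u0\<close> from which the word starts.
\<close>
inductive lowering_word :: "'v \<Rightarrow> nat \<Rightarrow> 'v \<Rightarrow> bool" for u0 where
  start: "lowering_word u0 0 u0"
| lower: "lowering_word u0 d u \<Longrightarrow> j < i \<Longrightarrow> i < m \<Longrightarrow> lowering_word u0 (d + (i - j)) (\<rho> (unit_mat m i j) u)"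

text \<open>
  A trace-zero matrix is a diagonal one plus finitely many multiples of matrix units, and the
  action is additive in the matrix.
\<close>
lemma action_in_subspaceI:
  assumes U: "subspace U" and v: "v \<in> V" and A: "A \<in> sl m"
    and diag: "\<And>H. H \<in> cartan m \<Longrightarrow> \<rho> H v \<in> U"
    and off: "\<And>i j. i < m \<Longrightarrow> j < m \<Longrightarrow> i \<noteq> j \<Longrightarrow> \<rho> (unit_mat m i j) v \<in> U"
  shows "\<rho> A v \<in> U"
proof -
  define part where "part S = mat m m (\<lambda>(i, j). if i = j \<or> (i, j) \<in> S then A $$ (i, j) else 0)" for S
  define off_diag where "off_diag = {(i, j). i < m \<and> j < m \<and> i \<noteq> j}"
  have part_sl: "part S \<in> sl m" for S
    using A by (simp add: part_def sl_def)
  have "finite off_diag"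
    by (rule finite_subset[of _ "{..<m} \<times> {..<m}"]) (auto simp: off_diag_def)
  moreover have "\<rho> (part S) v \<in> U" if "finite S" "S \<subseteq> off_diag" for S
    using that
  proof (induction S rule: finite_induct)
    case empty
    have "part {} \<in> cartan m"
      using part_sl[of "{}"] by (auto simp: cartan_def diagonal_mat_def part_def)
    then show ?case by (rule diag)
  next
    case (insert x S)
    obtain i j where x: "x = (i, j)" by fastforce
    have ij: "i < m" "j < m" "i \<noteq> j"
      using insert.prems by (auto simp: x off_diag_def)
    have "part (insert x S) = part S + A $$ (i, j) \<cdot>\<^sub>m unit_mat m i j"
      using ij insert.hyps by (intro eq_matI) (auto simp: part_def unit_mat_def x)
    moreover have "A $$ (i, j) \<cdot>\<^sub>m unit_mat m i j \<in> sl m"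
      using unit_mat_in_sl[OF ij(3), of m] by (auto simp: sl_def simp flip: sum_distrib_left)
    ultimately have "\<rho> (part (insert x S)) v = \<rho> (part S) v + scale (A $$ (i, j)) (\<rho> (unit_mat m i j) v)"
      using add_mat part_sl scale_mat unit_mat_in_sl[OF ij(3)] v by metis
    then show ?case
      using insert.IH insert.prems off[OF ij] U by (auto simp: subspace_def)
  qed
  moreover have "part off_diag = A"
    using sl_carrier[OF A] by (intro eq_matI) (auto simp: part_def off_diag_def)
  ultimately show ?thesis by fastforce
qed

lemma lowering_word_in_V:
  assumes "u0 \<in> V" "lowering_word u0 d u"
  shows "u \<in> V"
  using assms(2,1) by (induction) (auto intro!: closed unit_mat_in_sl)

lemma action_linear_span:
  assumes S: "S \<subseteq> V" and A: "A \<in> sl m" and U: "subspace U" and im: "\<And>s. s \<in> S \<Longrightarrow> \<rho> A s \<in> U"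
    and x: "x \<in> span S"
  shows "\<rho> A x \<in> U"
proof -
  have "x \<in> V \<and> \<rho> A x \<in> U"
    using x
  proof (induction rule: span_induct_alt)
    case base
    have "0 \<in> V" using subspace_V by (rule subspace_0)
    then show ?case using scale_vec[OF A, of 0 0] U by (simp add: subspace_0)
  next
    case (step c s y)
    then have "scale c s \<in> V" using S subspace_V by (blast intro: subspace_scale)
    with step show ?case
      using S U subspace_V add_vec[OF A] scale_vec[OF A] im
      by (auto simp: subset_iff intro!: subspace_add subspace_scale)
  qed
  then show ?thesis ..
qed

text \<open>
  Applying \<open>A\<close> to a word \<open>f u\<close> gives \<open>f (A u) + [A, f] u\<close>, and both terms are covered by the
  induction hypothesis for the shorter word \<open>u\<close>, the second one because it holds for all trace-zero
  matrices, in particular for \<open>[A, f]\<close>.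
\<close>
lemma lowering_words_closed:
  assumes u0: "highest_weight_vector \<Lambda> u0" and w: "lowering_word u0 d u" and A: "A \<in> sl m"
  shows "\<rho> A u \<in> span {u. \<exists>d. lowering_word u0 d u}" (is "_ \<in> span ?W")
  using w A
proof (induction arbitrary: A)
  case start
  have H: "\<rho> H u0 = scale (\<Lambda> H) u0" if "H \<in> cartan m" for H
    using u0 that by (auto simp: highest_weight_vector_def weight_space_def)
  have V: "u0 \<in> V" using u0 by (auto simp: highest_weight_vector_def weight_space_def)
  have up: "\<rho> (unit_mat m i j) u0 = 0" if "i < j" "j < m" for i j
    using u0 that by (auto simp: highest_weight_vector_def)
  have base: "u0 \<in> span ?W"
    using lowering_word.start by (blast intro: span_base)
  show ?case
  proof (rule action_in_subspaceI[OF subspace_span V start(1)])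
    fix i j assume ij: "i < m" "j < m" "i \<noteq> j"
    show "\<rho> (unit_mat m i j) u0 \<in> span ?W"
    proof (cases "i < j")
      case True
      then show ?thesis using up ij by (simp add: span_zero)
    next
      case False
      then have "lowering_word u0 (0 + (i - j)) (\<rho> (unit_mat m i j) u0)"
        using ij by (intro lowering_word.intros) auto
      then show ?thesis by (blast intro: span_base)
    qed
  qed (simp add: H base span_scale)
next
  case (lower d u j i)
  have V: "u0 \<in> V" using u0 by (auto simp: highest_weight_vector_def weight_space_def)
  have WV: "?W \<subseteq> V" using lowering_word_in_V[OF V] by auto
  have e: "unit_mat m i j \<in> sl m"
    using lower by (intro unit_mat_in_sl) simp
  have u: "u \<in> V" using lowering_word_in_V[OF V lower(1)] .
  have "\<rho> (unit_mat m i j) (\<rho> A u) \<in> span ?W"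
  proof (rule action_linear_span[OF WV e subspace_span _ lower.IH[OF lower.prems]])
    fix s assume "s \<in> ?W"
    then obtain d' where "lowering_word u0 d' s" by auto
    then have "lowering_word u0 (d' + (i - j)) (\<rho> (unit_mat m i j) s)"
      using lower by (intro lowering_word.intros) auto
    then show "\<rho> (unit_mat m i j) s \<in> span ?W" by (blast intro: span_base)
  qed
  moreover have "\<rho> (lie_bracket A (unit_mat m i j)) u \<in> span ?W"
    using lower.IH lie_bracket_in_sl[OF lower.prems e] by blast
  moreover have "\<rho> A (\<rho> (unit_mat m i j) u) =
      \<rho> (unit_mat m i j) (\<rho> A u) + \<rho> (lie_bracket A (unit_mat m i j)) u"
    using bracket[OF lower.prems e u] by simp
  ultimately show ?case by (simp add: span_add)
qed

lemma lowering_word_eigenvector: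
  assumes u0: "highest_weight_vector \<Lambda> u0" and w: "lowering_word u0 d u"
  shows "\<rho> (grading_mat m) u = scale (\<Lambda> (grading_mat m) - of_nat d) u"
  using w
proof induction
  case start
  then show ?case
    using u0 grading_mat_in_cartan by (auto simp: highest_weight_vector_def weight_space_def)
next
  case (lower d u j i)
  let ?g = "grading_mat m" and ?e = "unit_mat m i j"
  have u: "u \<in> V"
    using lowering_word_in_V[OF _ lower(1)] u0 by (auto simp: highest_weight_vector_def weight_space_def)
  have e: "?e \<in> sl m" using lower by (intro unit_mat_in_sl) simp
  have g: "?g \<in> sl m" by (simp add: grading_mat_in_cartan cartan_in_sl)
  have "\<rho> ?g (\<rho> ?e u) = \<rho> ?e (\<rho> ?g u) + \<rho> (lie_bracket ?g ?e) u"
    using bracket[OF g e u] by simp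
  also have "\<rho> (lie_bracket ?g ?e) u = scale (of_nat j - of_nat i) (\<rho> ?e u)"
    using lower by (simp add: lie_bracket_grading_unit scale_mat[OF e u])
  also have "\<rho> ?e (\<rho> ?g u) = scale (\<Lambda> ?g - of_nat d) (\<rho> ?e u)"
    by (simp add: lower.IH scale_vec[OF e u])
  finally show ?case
    using lower by (simp add: of_nat_diff scale_left_distrib[symmetric] algebra_simps
        del: scale_left_distrib)
qed

text \<open>
  Eigenvectors for different eigenvalues are independent. If \<open>y = r b + z\<close> with \<open>b\<close> an eigenvector
  for \<open>e\<close>, then \<open>H y - e y = (\<kappa> - e) y\<close> no longer involves \<open>b\<close>, which removes \<open>b\<close> from the span.
\<close>
lemma eigenvector_in_span_other_eigenvectors:
  assumes H: "H \<in> sl m"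
    and S: "\<And>s. s \<in> S \<Longrightarrow> s \<in> V \<and> (\<exists>e. e \<noteq> \<kappa> \<and> \<rho> H s = scale e s)"
    and y: "y \<in> span S" and eig: "\<rho> H y = scale \<kappa> y"
  shows "y = 0"
proof -
  have "y = 0" if "finite t" "t \<subseteq> S" "y \<in> span t" "\<rho> H y = scale \<kappa> y" for t y
    using that
  proof (induction t arbitrary: y rule: finite_induct)
    case empty
    then show ?case by simp
  next
    case (insert b t)
    have tV: "t \<subseteq> V" and bV: "b \<in> V"
      using insert.prems S by auto
    obtain e where e: "e \<noteq> \<kappa>" "\<rho> H b = scale e b"
      using S insert.prems by blast
    obtain r where r: "y - scale r b \<in> span t"
      using insert.prems(2) by (auto simp: span_breakdown_eq)
    define z where "z = y - scale r b"
    have zt: "z \<in> span t" and yz: "y = scale r b + z"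
      using r by (auto simp: z_def)
    have zV: "z \<in> V"
      using zt span_minimal[OF tV subspace_V] by blast
    have Hz: "\<rho> H z \<in> span t"
    proof (rule action_linear_span[OF tV H subspace_span _ zt])
      fix s assume s: "s \<in> t"
      then obtain f where "\<rho> H s = scale f s" using S insert.prems by blast
      then show "\<rho> H s \<in> span t" using s by (simp add: span_scale span_base)
    qed
    have "scale \<kappa> y = scale r (scale e b) + \<rho> H z"
      using insert.prems(3) add_vec[OF H subspace_scale[OF subspace_V bV, of r] zV] scale_vec[OF H bV, of r] e
      by (simp add: yz)
    moreover have "scale e y = scale r (scale e b) + scale e z"
      by (simp add: yz scale_right_distrib mult.commute)
    ultimately have "scale (\<kappa> - e) y = \<rho> H z - scale e z"
      unfolding scale_left_diff_distrib by simp
    also have "\<dots> \<in> span t"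
      using Hz zt by (simp add: span_diff span_scale)
    finally have "scale (inverse (\<kappa> - e)) (scale (\<kappa> - e) y) \<in> span t"
      by (rule span_scale)
    then have "y \<in> span t"
      using e by simp
    then show ?case
      using insert.IH insert.prems by blast
  qed
  moreover obtain t where "finite t" "t \<subseteq> S" "y \<in> span t"
    using y unfolding span_explicit by (auto intro: span_sum span_scale span_base)
  ultimately show ?thesis using eig by blast
qed

definition cyclic_span :: "'v \<Rightarrow> 'v set" where
  "cyclic_span u0 = span {u. \<exists>d. lowering_word u0 d u}"

lemma cyclic_span_subrepresentation:
  assumes u0: "highest_weight_vector \<Lambda> u0"
  shows "subspace (cyclic_span u0)" "cyclic_span u0 \<subseteq> V" "u0 \<in> cyclic_span u0"
    and "A \<in> sl m \<Longrightarrow> u \<in> cyclic_span u0 \<Longrightarrow> \<rho> A u \<in> cyclic_span u0"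
proof -
  have V: "u0 \<in> V" using u0 by (auto simp: highest_weight_vector_def weight_space_def)
  show "subspace (cyclic_span u0)" by (simp add: cyclic_span_def)
  have WV: "{u. \<exists>d. lowering_word u0 d u} \<subseteq> V"
    using lowering_word_in_V[OF V] by auto
  then show "cyclic_span u0 \<subseteq> V"
    unfolding cyclic_span_def using subspace_V by (rule span_minimal)
  show "u0 \<in> cyclic_span u0"
    unfolding cyclic_span_def using lowering_word.start by (blast intro: span_base)
  show "\<rho> A u \<in> cyclic_span u0" if "A \<in> sl m" "u \<in> cyclic_span u0"
    unfolding cyclic_span_def
    by (rule action_linear_span[OF WV that(1) subspace_span _ that(2)[unfolded cyclic_span_def]])
       (auto intro: lowering_words_closed[OF u0 _ that(1)])
qed

text \<open>
  All words other than \<open>u0\<close> itself belong to strictly smaller eigenvalues of \<^const>\<open>grading_mat\<close>,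
  so the highest eigenvalue has multiplicity one in the cyclic span.
\<close>
lemma eigenvector_in_cyclic_span:
  assumes u0: "highest_weight_vector \<Lambda> u0" and u: "u \<in> cyclic_span u0"
    and eig: "\<rho> (grading_mat m) u = scale (\<Lambda> (grading_mat m)) u"
  shows "\<exists>c. u = scale c u0"
proof -
  let ?low = "{u. \<exists>d>0. lowering_word u0 d u}" and ?g = "grading_mat m"
  have V: "u0 \<in> V" using u0 by (auto simp: highest_weight_vector_def weight_space_def)
  have g: "?g \<in> sl m" by (simp add: grading_mat_in_cartan cartan_in_sl)
  have "lowering_word u0 d w \<Longrightarrow> d > 0 \<or> w = u0" for d w
    by (induction rule: lowering_word.induct) auto
  then have "{u. \<exists>d. lowering_word u0 d u} \<subseteq> insert u0 ?low"
    by blast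
  then have "u \<in> span (insert u0 ?low)"
    using u span_mono unfolding cyclic_span_def by blast
  then obtain c where c: "u - scale c u0 \<in> span ?low"
    by (auto simp: span_breakdown_eq)
  have uV: "u \<in> V"
    using cyclic_span_subrepresentation(2)[OF u0] u by blast
  have "scale (-c) u0 \<in> V" using V subspace_V by (simp only: subspace_scale)
  then have "\<rho> ?g (u + scale (-c) u0) = \<rho> ?g u + scale (-c) (\<rho> ?g u0)"
    by (simp only: add_vec[OF g uV] scale_vec[OF g V])
  also have "\<dots> = scale (\<Lambda> ?g) (u + scale (-c) u0)"
    using eig lowering_word_eigenvector[OF u0 lowering_word.start]
    by (simp add: scale_right_distrib scale_right_diff_distrib mult.commute)
  finally have eig': "\<rho> ?g (u - scale c u0) = scale (\<Lambda> ?g) (u - scale c u0)"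
    by simp
  have "u - scale c u0 = 0"
  proof (rule eigenvector_in_span_other_eigenvectors[OF g _ c eig'])
    fix s assume "s \<in> ?low"
    then obtain d where d: "d > 0" "lowering_word u0 d s" by auto
    then show "s \<in> V \<and> (\<exists>e. e \<noteq> \<Lambda> ?g \<and> \<rho> ?g s = scale e s)"
      using lowering_word_in_V[OF V d(2)] lowering_word_eigenvector[OF u0 d(2)]
      by (intro conjI exI[of _ "\<Lambda> ?g - of_nat d"]) auto
  qed
  then show ?thesis by auto
qed

lemma weight_space_subspace: "subspace (weight_space scale m V \<rho> \<mu>)"
proof -
  have "\<rho> H 0 = 0" if "H \<in> cartan m" for H
    using scale_vec[OF cartan_in_sl[OF that] subspace_0[OF subspace_V], of 0] by simp
  then show ?thesis
    using subspace_V
    by (auto simp: subspace_def weight_space_def cartan_in_sl add_vec scale_vec scale_right_distrib mult.commute)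
qed

end

lemma has_highest_weight_obtain:
  assumes "sl_representation scale m V \<rho>" "has_highest_weight scale m V \<rho> \<Lambda>"
  obtains u where "u \<noteq> 0" "sl_representation.highest_weight_vector scale m V \<rho> \<Lambda> u"
proof -
  obtain u where u: "u \<in> weight_space scale m V \<rho> \<Lambda>" "u \<noteq> 0"
    "\<And>i j X. 1 \<le> i \<Longrightarrow> i < j \<Longrightarrow> j \<le> m \<Longrightarrow> X \<in> root_space m (\<lambda>H. epsilon i H - epsilon j H) \<Longrightarrow> \<rho> X u = 0"
    using assms(2) unfolding has_highest_weight_def by blast
  have "\<rho> (unit_mat m i j) u = 0" if "i < j" "j < m" for i j
    using u(3)[of "Suc i" "Suc j"] unit_mat_in_root_space[of i m j] that by auto
  with u(1,2) that show ?thesis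
    by (simp add: sl_representation.highest_weight_vector_def[OF assms(1)])
qed

section \<open>Uniqueness of the irreducible representation with a given highest weight\<close>

lemma dim_image_inj_on:
  assumes "vector_space s1" "vector_space s2" and lin: "Vector_Spaces.linear s1 s2 f"
    and S: "module.subspace s1 S" and inj: "inj_on f S"
  shows "vector_space.dim s2 (f ` S) = vector_space.dim s1 S"
proof -
  interpret vector_space_pair s1 s2
    using assms(1,2) by (simp add: vector_space_pair_def)
  obtain B where B: "B \<subseteq> S" "vs1.independent B" "S \<subseteq> vs1.span B" "card B = vs1.dim S"
    by (rule vs1.basis_exists)
  have "vs1.span B = S"
    using B S by (simp add: subset_antisym vs1.span_minimal)
  then have i: "vs2.independent (f ` B)" and sp: "f ` S = vs2.span (f ` B)"
    using linear_independent_injective_image[OF lin B(2)] inj linear_span_image[OF lin] by auto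
  have "vs2.dim (f ` S) = card (f ` B)"
    using i by (simp add: sp vs2.dim_eq_card_independent)
  then show ?thesis
    using B inj by (simp add: card_image inj_on_subset)
qed

text \<open>
  In the product representation the pair of highest weight vectors generates a submodule \<open>U\<close>. By
  irreducibility both projections of \<open>U\<close> are onto, and the kernel of each projection is trivial: else it
  would contain all vectors \<open>(v, 0)\<close>, among them \<open>(v1, 0)\<close>, which has the highest eigenvalue but is
  no multiple of \<open>(v1, v2)\<close>. So \<open>U\<close> is the graph of an isomorphism, and its weight spaces project
  bijectively onto those of both factors.
\<close>
theorem weight_multiplicity_unique:
  assumes "irreducible_sl_representation s1 m V1 \<rho>1" "irreducible_sl_representation s2 m V2 \<rho>2"
    and "has_highest_weight s1 m V1 \<rho>1 \<Lambda>" "has_highest_weight s2 m V2 \<rho>2 \<Lambda>"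
  shows "weight_multiplicity s1 m V1 \<rho>1 \<mu> = weight_multiplicity s2 m V2 \<rho>2 \<mu>"
proof -
  interpret r1: irreducible_sl_representation s1 m V1 \<rho>1 by fact
  interpret r2: irreducible_sl_representation s2 m V2 \<rho>2 by fact
  define sp where "sp = (\<lambda>c (v, w). (s1 c v, s2 c w))"
  define \<rho>p where "\<rho>p = (\<lambda>A (v, w). (\<rho>1 A v, \<rho>2 A w))"
  have vp: "vector_space sp"
    by unfold_locales (auto simp: sp_def r1.scale_right_distrib r2.scale_right_distrib
        r1.scale_left_distrib r2.scale_left_distrib)
  interpret vp: vector_space sp by fact
  have sub_prod: "vp.subspace (V1 \<times> V2)"
    using r1.subspace_V r2.subspace_V unfolding vp.subspace_def
    by (auto simp: r1.subspace_def r2.subspace_def sp_def zero_prod_def)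
  interpret p: sl_representation sp m "V1 \<times> V2" \<rho>p
    by unfold_locales (use sub_prod in \<open>auto simp: sp_def \<rho>p_def r1.closed r2.closed r1.add_vec r2.add_vec
        r1.scale_vec r2.scale_vec r1.add_mat r2.add_mat r1.scale_mat r2.scale_mat r1.bracket r2.bracket\<close>)
  obtain v1 where v1: "v1 \<noteq> 0" "r1.highest_weight_vector \<Lambda> v1"
    using has_highest_weight_obtain[OF r1.sl_representation_axioms assms(3)] .
  obtain v2 where v2: "v2 \<noteq> 0" "r2.highest_weight_vector \<Lambda> v2"
    using has_highest_weight_obtain[OF r2.sl_representation_axioms assms(4)] .
  have u0: "p.highest_weight_vector \<Lambda> (v1, v2)"
    using v1(2) v2(2)
    unfolding p.highest_weight_vector_def r1.highest_weight_vector_def r2.highest_weight_vector_def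
    by (auto simp: weight_space_def \<rho>p_def sp_def zero_prod_def)
  define U where "U = p.cyclic_span (v1, v2)"
  note U = p.cyclic_span_subrepresentation[OF u0, folded U_def]
  have g: "grading_mat m \<in> cartan m" by (rule grading_mat_in_cartan)
  have v1V: "v1 \<in> V1" "\<rho>1 (grading_mat m) v1 = s1 (\<Lambda> (grading_mat m)) v1"
    and v2V: "v2 \<in> V2" "\<rho>2 (grading_mat m) v2 = s2 (\<Lambda> (grading_mat m)) v2"
    using v1(2) v2(2) g
    by (auto simp: r1.highest_weight_vector_def r2.highest_weight_vector_def weight_space_def)
  have zero1: "\<rho>1 A 0 = 0" if "A \<in> sl m" for A
    using r1.scale_vec[OF that v1V(1), of 0] by simp
  have zero2: "\<rho>2 A 0 = 0" if "A \<in> sl m" for A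
    using r2.scale_vec[OF that v2V(1), of 0] by simp
  have not1: "(v1, 0) \<notin> U"
  proof
    assume "(v1, 0) \<in> U"
    then obtain c where "(v1, 0) = sp c (v1, v2)"
      using p.eigenvector_in_cyclic_span[OF u0, of "(v1, 0)"] v1V(2) zero2[OF cartan_in_sl[OF g]]
      by (auto simp: U_def \<rho>p_def sp_def)
    then show False using v1 v2 by (auto simp: sp_def)
  qed
  have not2: "(0, v2) \<notin> U"
  proof
    assume "(0, v2) \<in> U"
    then obtain c where "(0, v2) = sp c (v1, v2)"
      using p.eigenvector_in_cyclic_span[OF u0, of "(0, v2)"] v2V(2) zero1[OF cartan_in_sl[OF g]]
      by (auto simp: U_def \<rho>p_def sp_def)
    then show False using v1 v2 by (auto simp: sp_def)
  qed
  have ker1: "{v. (v, 0) \<in> U} = {0}"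
  proof -
    have "{v. (v, 0) \<in> U} = {0} \<or> {v. (v, 0) \<in> U} = V1"
    proof (rule r1.irreducible)
      show "r1.subspace {v. (v, 0) \<in> U}"
        unfolding r1.subspace_def
      proof (intro conjI ballI allI)
        show "0 \<in> {v. (v, 0) \<in> U}"
          using vp.subspace_0[OF U(1)] by (simp add: zero_prod_def)
        fix x assume x: "x \<in> {v. (v, 0) \<in> U}"
        show "x + y \<in> {v. (v, 0) \<in> U}" if "y \<in> {v. (v, 0) \<in> U}" for y
          using vp.subspace_add[OF U(1), of "(x, 0)" "(y, 0)"] x that by simp
        show "s1 c x \<in> {v. (v, 0) \<in> U}" for c
          using vp.subspace_scale[OF U(1), of "(x, 0)" c] x by (simp add: sp_def)
      qed
      show "{v. (v, 0) \<in> U} \<subseteq> V1" using U(2) by auto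
      show "\<rho>1 A w \<in> {v. (v, 0) \<in> U}" if "A \<in> sl m" "w \<in> {v. (v, 0) \<in> U}" for A w
        using U(4)[OF that(1), of "(w, 0)"] that zero2 by (simp add: \<rho>p_def)
    qed
    then show ?thesis using not1 v1V by blast
  qed
  have ker2: "{v. (0, v) \<in> U} = {0}"
  proof -
    have "{v. (0, v) \<in> U} = {0} \<or> {v. (0, v) \<in> U} = V2"
    proof (rule r2.irreducible)
      show "r2.subspace {v. (0, v) \<in> U}"
        unfolding r2.subspace_def
      proof (intro conjI ballI allI)
        show "0 \<in> {v. (0, v) \<in> U}"
          using vp.subspace_0[OF U(1)] by (simp add: zero_prod_def)
        fix x assume x: "x \<in> {v. (0, v) \<in> U}"
        show "x + y \<in> {v. (0, v) \<in> U}" if "y \<in> {v. (0, v) \<in> U}" for y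
          using vp.subspace_add[OF U(1), of "(0, x)" "(0, y)"] x that by simp
        show "s2 c x \<in> {v. (0, v) \<in> U}" for c
          using vp.subspace_scale[OF U(1), of "(0, x)" c] x by (simp add: sp_def)
      qed
      show "{v. (0, v) \<in> U} \<subseteq> V2" using U(2) by auto
      show "\<rho>2 A w \<in> {v. (0, v) \<in> U}" if "A \<in> sl m" "w \<in> {v. (0, v) \<in> U}" for A w
        using U(4)[OF that(1), of "(0, w)"] that zero1 by (simp add: \<rho>p_def)
    qed
    then show ?thesis using not2 v2V by blast
  qed
  have lin1: "Vector_Spaces.linear sp s1 fst" and lin2: "Vector_Spaces.linear sp s2 snd"
    using vp r1.vector_space_axioms r2.vector_space_axioms
    by (auto simp: Vector_Spaces.linear_iff sp_def)
  have fst_U: "fst ` U = V1"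
  proof -
    have "fst ` U = {0} \<or> fst ` U = V1"
    proof (rule r1.irreducible)
      show "r1.subspace (fst ` U)"
        using vector_space_pair.linear_subspace_image[OF _ lin1 U(1)] vp r1.vector_space_axioms
        by (simp add: vector_space_pair_def)
      show "fst ` U \<subseteq> V1" using U(2) by auto
      show "\<rho>1 A w \<in> fst ` U" if "A \<in> sl m" "w \<in> fst ` U" for A w
        using U(4)[OF that(1)] that(2) by (force simp: \<rho>p_def)
    qed
    moreover have "v1 \<in> fst ` U" using U(3) by force
    ultimately show ?thesis using v1 by auto
  qed
  have snd_U: "snd ` U = V2"
  proof -
    have "snd ` U = {0} \<or> snd ` U = V2"
    proof (rule r2.irreducible)
      show "r2.subspace (snd ` U)"
        using vector_space_pair.linear_subspace_image[OF _ lin2 U(1)] vp r2.vector_space_axioms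
        by (simp add: vector_space_pair_def)
      show "snd ` U \<subseteq> V2" using U(2) by auto
      show "\<rho>2 A w \<in> snd ` U" if "A \<in> sl m" "w \<in> snd ` U" for A w
        using U(4)[OF that(1)] that(2) by (force simp: \<rho>p_def)
    qed
    moreover have "v2 \<in> snd ` U" using U(3) by force
    ultimately show ?thesis using v2 by auto
  qed
  have inj1: "inj_on fst U" and inj2: "inj_on snd U"
  proof -
    have d: "x - y \<in> U" if "x \<in> U" "y \<in> U" for x y
      using vp.subspace_diff[OF U(1) that] .
    show "inj_on fst U"
    proof (rule inj_onI)
      fix x y assume xy: "x \<in> U" "y \<in> U" "fst x = fst y"
      then have "(0, snd x - snd y) \<in> U"
        using d[OF xy(1,2)] by (simp add: minus_prod_def)
      then have "snd x - snd y = 0" using ker2 by blast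
      then show "x = y" using xy(3) by (simp add: prod_eq_iff)
    qed
    show "inj_on snd U"
    proof (rule inj_onI)
      fix x y assume xy: "x \<in> U" "y \<in> U" "snd x = snd y"
      then have "(fst x - fst y, 0) \<in> U"
        using d[OF xy(1,2)] by (simp add: minus_prod_def)
      then have "fst x - fst y = 0" using ker1 by blast
      then show "x = y" using xy(3) by (simp add: prod_eq_iff)
    qed
  qed
  let ?Wp = "U \<inter> weight_space sp m (V1 \<times> V2) \<rho>p \<mu>"
  let ?W1 = "weight_space s1 m V1 \<rho>1 \<mu>" and ?W2 = "weight_space s2 m V2 \<rho>2 \<mu>"
  have sub: "vp.subspace ?Wp"
    using U(1) p.weight_space_subspace by (rule vp.subspace_inter)
  have eq: "x \<in> weight_space sp m (V1 \<times> V2) \<rho>p \<mu>" if "x \<in> U" "fst x \<in> ?W1 \<or> snd x \<in> ?W2" for x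
  proof -
    have "\<rho>p H x = sp (\<mu> H) x" if H: "H \<in> cartan m" for H
    proof -
      have "\<rho>p H x \<in> U" "sp (\<mu> H) x \<in> U"
        using \<open>x \<in> U\<close> U(4)[OF cartan_in_sl[OF H]] vp.subspace_scale[OF U(1)] by auto
      moreover have "fst (\<rho>p H x) = fst (sp (\<mu> H) x) \<or> snd (\<rho>p H x) = snd (sp (\<mu> H) x)"
        using \<open>fst x \<in> ?W1 \<or> snd x \<in> ?W2\<close> H
        by (auto simp: weight_space_def \<rho>p_def sp_def split: prod.splits)
      ultimately show ?thesis
        using inj1 inj2 by (auto dest: inj_onD)
    qed
    then show ?thesis using \<open>x \<in> U\<close> U(2) by (auto simp: weight_space_def)
  qed
  have "fst ` ?Wp = ?W1"
  proof
    show "fst ` ?Wp \<subseteq> ?W1"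
      by (auto simp: weight_space_def \<rho>p_def sp_def)
    show "?W1 \<subseteq> fst ` ?Wp"
    proof
      fix v assume v: "v \<in> ?W1"
      then have "v \<in> fst ` U" by (simp add: fst_U weight_space_def)
      then obtain x where "x \<in> U" "v = fst x" by auto
      then show "v \<in> fst ` ?Wp" using eq[of x] v by blast
    qed
  qed
  moreover have "snd ` ?Wp = ?W2"
  proof
    show "snd ` ?Wp \<subseteq> ?W2"
      by (auto simp: weight_space_def \<rho>p_def sp_def)
    show "?W2 \<subseteq> snd ` ?Wp"
    proof
      fix v assume v: "v \<in> ?W2"
      then have "v \<in> snd ` U" by (simp add: snd_U weight_space_def)
      then obtain x where "x \<in> U" "v = snd x" by auto
      then show "v \<in> snd ` ?Wp" using eq[of x] v by blast
    qed
  qed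
  moreover have "r1.dim (fst ` ?Wp) = vp.dim ?Wp"
    using inj1 by (intro dim_image_inj_on[OF vp r1.vector_space_axioms lin1 sub]) (auto intro: inj_on_subset)
  moreover have "r2.dim (snd ` ?Wp) = vp.dim ?Wp"
    using inj2 by (intro dim_image_inj_on[OF vp r2.vector_space_axioms lin2 sub]) (auto intro: inj_on_subset)
  ultimately show ?thesis by (simp add: weight_multiplicity_def)
qed

section \<open>Inner products on functions of finite support\<close>

definition fscale :: "complex \<Rightarrow> ('a \<Rightarrow> complex) \<Rightarrow> 'a \<Rightarrow> complex" where
  "fscale c f = (\<lambda>x. c * f x)"

lemma fscale_apply: "fscale c f x = c * f x"
  by (simp only: fscale_def)

interpretation fn: vector_space fscale
  by unfold_locales (auto simp: fun_eq_iff fscale_apply algebra_simps)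

definition fun_on :: "'a set \<Rightarrow> ('a \<Rightarrow> complex) set" where
  "fun_on X = {f. \<forall>x. x \<notin> X \<longrightarrow> f x = 0}"

definition weighted_inner :: "'a set \<Rightarrow> ('a \<Rightarrow> real) \<Rightarrow> ('a \<Rightarrow> complex) \<Rightarrow> ('a \<Rightarrow> complex) \<Rightarrow> complex" where
  "weighted_inner X w f g = (\<Sum>x\<in>X. f x * cnj (g x) / of_real (w x))"

lemma fun_on_subspace: "fn.subspace (fun_on X)"
  by (auto simp: fn.subspace_def fun_on_def fscale_apply)

lemma fun_on_basis:
  assumes "finite X"
  shows "fn.independent ((\<lambda>x y. if y = x then 1 else 0) ` X) \<and>
    fn.span ((\<lambda>x y. if y = x then 1 else 0) ` X) = fun_on X"
  using assms
proof (induction X rule: finite_induct)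
  case empty
  have "fun_on {} = {0 :: 'a \<Rightarrow> complex}"
    by (auto simp: fun_on_def fun_eq_iff)
  then show ?case by (simp add: fn.independent_empty)
next
  case (insert x X)
  let ?\<delta> = "\<lambda>x y. if y = x then 1 else (0::complex)"
  have "?\<delta> x \<notin> fun_on X" using insert.hyps by (auto simp: fun_on_def)
  then have i: "fn.independent (?\<delta> ` insert x X)"
    using insert.IH by (simp add: fn.independent_insertI)
  have "fun_on (insert x X) \<subseteq> fn.span (?\<delta> ` insert x X)"
  proof
    fix f assume "f \<in> fun_on (insert x X)"
    then have "f - fscale (f x) (?\<delta> x) \<in> fun_on X"
      using insert.hyps by (auto simp: fun_on_def fscale_apply)
    then show "f \<in> fn.span (?\<delta> ` insert x X)"
      using insert.IH by (auto simp: fn.span_breakdown_eq)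
  qed
  moreover have "fn.span (?\<delta> ` insert x X) \<subseteq> fun_on (insert x X)"
    by (rule fn.span_minimal[OF _ fun_on_subspace]) (auto simp: fun_on_def)
  ultimately show ?case using i by blast
qed

lemma dim_fun_on:
  assumes "finite X"
  shows "fn.dim (fun_on X) = card X"
proof -
  have inj: "inj_on (\<lambda>x y. if y = x then 1 else (0::complex)) X"
    by (rule inj_onI) (metis zero_neq_one)
  show ?thesis
    using fun_on_basis[OF assms] card_image[OF inj]
    by (metis fn.dim_span fn.dim_eq_card_independent)
qed

lemma subspace_finite_basis:
  assumes X: "finite X" and S: "fn.subspace S" "S \<subseteq> fun_on X"
  obtains B where "finite B" "fn.independent B" "fn.span B = S" "card B = fn.dim S"
proof -
  obtain B where B: "B \<subseteq> S" "fn.independent B" "S \<subseteq> fn.span B" "card B = fn.dim S"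
    by (rule fn.basis_exists)
  have "finite B"
    using fn.independent_span_bound[of "(\<lambda>x y. if y = x then 1 else 0) ` X" B] B S fun_on_basis[OF X] X
    by auto
  moreover have "fn.span B = S"
    using B S by (simp add: subset_antisym fn.span_minimal)
  ultimately show ?thesis using that B by blast
qed

lemma weighted_inner_cnj: "weighted_inner X w f g = cnj (weighted_inner X w g f)"
  by (simp add: weighted_inner_def mult.commute)

lemma weighted_inner_left:
  "weighted_inner X w (f + g) h = weighted_inner X w f h + weighted_inner X w g h"
  "weighted_inner X w (f - g) h = weighted_inner X w f h - weighted_inner X w g h"
  "weighted_inner X w (fscale c f) h = c * weighted_inner X w f h"
  "weighted_inner X w 0 h = 0"
  by (auto simp: weighted_inner_def sum.distrib sum_subtractf sum_distrib_left fscale_apply algebra_simps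
      add_divide_distrib diff_divide_distrib)

lemma weighted_inner_right:
  "weighted_inner X w h (f + g) = weighted_inner X w h f + weighted_inner X w h g"
  "weighted_inner X w h (fscale c f) = cnj c * weighted_inner X w h f"
  "weighted_inner X w h 0 = 0"
  by (auto simp: weighted_inner_def sum.distrib sum_subtractf sum_distrib_left fscale_apply algebra_simps
      add_divide_distrib diff_divide_distrib)

lemma weighted_inner_self:
  assumes "\<And>x. x \<in> X \<Longrightarrow> w x > 0"
  shows "\<exists>r\<ge>0. weighted_inner X w f f = of_real r"
proof (intro exI conjI)
  show "weighted_inner X w f f = of_real (\<Sum>x\<in>X. (cmod (f x))\<^sup>2 / w x)"
    by (simp add: weighted_inner_def flip: complex_norm_square)
  show "(\<Sum>x\<in>X. (cmod (f x))\<^sup>2 / w x) \<ge> 0"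
    using assms by (intro sum_nonneg) (auto simp: less_imp_le)
qed

lemma weighted_inner_definite:
  assumes X: "finite X" and w: "\<And>x. x \<in> X \<Longrightarrow> w x > 0" and f: "f \<in> fun_on X" "weighted_inner X w f f = 0"
  shows "f = 0"
proof -
  have "weighted_inner X w f f = of_real (\<Sum>x\<in>X. (cmod (f x))\<^sup>2 / w x)"
    by (simp add: weighted_inner_def flip: complex_norm_square)
  then have "(\<Sum>x\<in>X. (cmod (f x))\<^sup>2 / w x) = 0" using f(2) by (metis of_real_eq_0_iff)
  then have "\<forall>x\<in>X. (cmod (f x))\<^sup>2 / w x = 0"
    using w X by (subst (asm) sum_nonneg_eq_0_iff) (auto simp: less_imp_le)
  then have "\<forall>x\<in>X. f x = 0" using w by fastforce
  then show ?thesis using f(1) by (auto simp: fun_on_def fun_eq_iff)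
qed

lemma weighted_inner_span:
  assumes "\<And>b. b \<in> B \<Longrightarrow> weighted_inner X w f b = 0" "t \<in> fn.span B"
  shows "weighted_inner X w f t = 0"
  using assms(2)
proof (induction rule: fn.span_induct_alt)
  case base
  show ?case by (rule weighted_inner_right(3))
next
  case (step c x y)
  then show ?case using assms(1) by (simp add: weighted_inner_right del: plus_fun_apply)
qed

text \<open>
  The Gram--Schmidt process, by induction on a basis of the subspace.
\<close>
lemma orthogonal_projection:
  assumes X: "finite X" and w: "\<And>x. x \<in> X \<Longrightarrow> w x > 0" and S: "fn.subspace S" "S \<subseteq> fun_on X"
  obtains s where "s \<in> S" "\<And>t. t \<in> S \<Longrightarrow> weighted_inner X w (f - s) t = 0"
proof -
  obtain B where B: "finite B" "fn.span B = S"
    using subspace_finite_basis[OF X S] .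
  have "fn.span B \<subseteq> fun_on X" using B S by simp
  with B(1) have "\<forall>f. \<exists>s\<in>fn.span B. \<forall>t\<in>fn.span B. weighted_inner X w (f - s) t = 0"
  proof (induction B rule: finite_induct)
    case empty
    show ?case
      by (intro allI bexI[of _ 0] ballI) (simp_all only: fn.span_empty singleton_iff weighted_inner_right(3))
  next
    case (insert b B)
    have sub: "fn.span B \<subseteq> fn.span (insert b B)" by (rule fn.span_mono) auto
    then have IH: "\<exists>s\<in>fn.span B. \<forall>t\<in>fn.span B. weighted_inner X w (f - s) t = 0" for f
      using insert by blast
    obtain p where p: "p \<in> fn.span B" "\<And>t. t \<in> fn.span B \<Longrightarrow> weighted_inner X w (b - p) t = 0"
      using IH[of b] by blast
    define b' where "b' = b - p"
    have b'_span: "b' \<in> fn.span (insert b B)"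
      unfolding b'_def by (rule fn.span_diff) (use p(1) sub fn.span_base in blast)+
    have b_eq: "b = b' + p" by (simp add: b'_def)
    show ?case
    proof
      fix f
      obtain q where q: "q \<in> fn.span B" "\<And>t. t \<in> fn.span B \<Longrightarrow> weighted_inner X w (f - q) t = 0"
        using IH[of f] by blast
      define c where "c = weighted_inner X w (f - q) b' / weighted_inner X w b' b'"
      define s where "s = q + fscale c b'"
      have z: "f - s = f - q - fscale c b'" by (simp add: s_def)
      have orth_B: "weighted_inner X w (f - s) t = 0" if "t \<in> fn.span B" for t
        unfolding z weighted_inner_left using q(2)[OF that] p(2)[OF that] by (simp add: b'_def weighted_inner_left)
      have orth_b': "weighted_inner X w (f - s) b' = 0"
      proof (cases "weighted_inner X w b' b' = 0")
        case True
        then have "b' = 0"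
          using weighted_inner_definite[of X w, OF X w] b'_span insert.prems by blast
        then show ?thesis by (simp add: weighted_inner_right(3))
      next
        case False
        then show ?thesis unfolding z weighted_inner_left(2)[of X w "f - q"] weighted_inner_left(3) by (simp add: c_def)
      qed
      have "weighted_inner X w (f - s) x = 0" if "x \<in> insert b B" for x
        using that orth_B[OF fn.span_base] orth_B[OF p(1)] orth_b'
        by (auto simp: b_eq weighted_inner_right(1))
      then have "\<forall>t\<in>fn.span (insert b B). weighted_inner X w (f - s) t = 0"
        using weighted_inner_span by blast
      moreover have "s \<in> fn.span (insert b B)"
        unfolding s_def using q(1) sub b'_span by (auto intro!: fn.span_add fn.span_scale)
      ultimately show "\<exists>s\<in>fn.span (insert b B). \<forall>t\<in>fn.span (insert b B). weighted_inner X w (f - s) t = 0"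
        by blast
    qed
  qed
  then show ?thesis using that B by blast
qed

lemma dim_orthogonal_complement:
  assumes X: "finite X" and w: "\<And>x. x \<in> X \<Longrightarrow> w x > 0"
    and Y: "Y \<subseteq> X" and S: "fn.subspace S" "S \<subseteq> fun_on Y"
  shows "fn.dim {f \<in> fun_on Y. \<forall>s\<in>S. weighted_inner X w f s = 0} + fn.dim S = card Y"
proof -
  let ?T = "{f \<in> fun_on Y. \<forall>s\<in>S. weighted_inner X w f s = 0}"
  have fY: "finite Y" using X Y by (rule rev_finite_subset)
  have YX: "fun_on Y \<subseteq> fun_on X" using Y by (auto simp: fun_on_def)
  have T: "fn.subspace ?T" "?T \<subseteq> fun_on Y"
    using fun_on_subspace[of Y] by (auto simp: fn.subspace_def weighted_inner_left)
  obtain B where B: "finite B" "fn.independent B" "fn.span B = S" "card B = fn.dim S"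
    using subspace_finite_basis[OF fY S] .
  obtain C where C: "finite C" "fn.independent C" "fn.span C = ?T" "card C = fn.dim ?T"
    using subspace_finite_basis[OF fY T] .
  have ST: "x = 0" if "x \<in> S" "x \<in> ?T" for x
    using that weighted_inner_definite[of X w, OF X w] YX by blast
  have "fn.independent (D \<union> C) \<and> D \<inter> C = {}" if "D \<subseteq> B" for D
    using finite_subset[OF that B(1)] that
  proof (induction D rule: finite_induct)
    case empty
    then show ?case using C by simp
  next
    case (insert b D)
    have b: "b \<notin> fn.span D"
      using fn.independent_mono[OF B(2) insert.prems] insert.hyps by (simp add: fn.independent_insert)
    have "b \<notin> fn.span (D \<union> C)"
    proof
      assume "b \<in> fn.span (D \<union> C)"
      then obtain x y where xy: "b = x + y" "x \<in> fn.span D" "y \<in> fn.span C"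
        by (auto simp: fn.span_Un)
      have "x \<in> S" using xy(2) B(3) fn.span_mono[of D B] insert.prems by auto
      moreover have "b \<in> S" using insert.prems B(3) fn.span_base by blast
      ultimately have "b - x \<in> S" using S(1) by (simp only: fn.subspace_diff)
      then have "b - x = 0" using ST[of "b - x"] xy C(3) by auto
      then show False using b xy(2) by simp
    qed
    moreover from this have "b \<notin> C" using fn.span_base by blast
    ultimately show ?case using insert by (simp add: fn.independent_insert)
  qed
  then have ind: "fn.independent (B \<union> C)" and disj: "B \<inter> C = {}" by auto
  have "fn.span (B \<union> C) = fun_on Y"
  proof
    show "fn.span (B \<union> C) \<subseteq> fun_on Y"
      using B(3) C(3) S(2) fn.span_base by (intro fn.span_minimal fun_on_subspace) blast
    show "fun_on Y \<subseteq> fn.span (B \<union> C)"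
    proof
      fix f assume f: "f \<in> fun_on Y"
      obtain s where s: "s \<in> S" "\<And>t. t \<in> S \<Longrightarrow> weighted_inner X w (f - s) t = 0"
        using orthogonal_projection[of X w S, OF X w S(1)] S(2) YX by blast
      have "f - s \<in> fun_on Y"
        using f s S(2) fn.subspace_diff[OF fun_on_subspace] by blast
      then have "f - s \<in> ?T" using s(2) by blast
      then have "f - s \<in> fn.span (B \<union> C)" "s \<in> fn.span (B \<union> C)"
        using C(3) B(3) s(1) fn.span_mono[of C "B \<union> C"] fn.span_mono[of B "B \<union> C"] by auto
      then have "(f - s) + s \<in> fn.span (B \<union> C)" by (rule fn.span_add)
      then show "f \<in> fn.span (B \<union> C)" by simp
    qed
  qed
  then have "fn.dim (fun_on Y) = card (B \<union> C)"
    using ind by (metis fn.dim_span fn.dim_eq_card_independent)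
  then show ?thesis
    using card_Un_disjoint[OF B(1) C(1) disj] B C dim_fun_on[OF fY] by simp
qed

section \<open>Creation, annihilation and quadratic operators\<close>

text \<open>
  Polynomials in the variables \<open>x\<^sub>i\<close> and \<open>y\<^sub>i\<close>, indexed by \<open>(i, False)\<close> and \<open>(i, True)\<close>, are
  represented by functions on exponents. The value at \<open>\<alpha>\<close> is the coefficient of the monomial with
  exponent \<open>\<alpha>\<close> multiplied by \<open>\<alpha>!\<close>. In this scaling differentiation is a mere shift of the argument,
  and multiplication by a variable carries the factor \<open>\<alpha> u\<close>, which vanishes exactly when the shifted
  exponent would be negative.
\<close>
type_synonym exponent = "nat \<times> bool \<Rightarrow> nat"
type_synonym fock = "exponent \<Rightarrow> complex"
type_synonym kernel = "nat \<times> bool \<Rightarrow> nat \<times> bool \<Rightarrow> complex"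

text \<open>
  Multiplication by the variable \<open>u\<close>.
\<close>
definition cre :: "nat \<times> bool \<Rightarrow> fock \<Rightarrow> fock" where
  "cre u f = (\<lambda>\<alpha>. of_nat (\<alpha> u) * f (\<alpha>(u := \<alpha> u - 1)))"

text \<open>
  Differentiation with respect to the variable \<open>u\<close>.
\<close>
definition ann :: "nat \<times> bool \<Rightarrow> fock \<Rightarrow> fock" where
  "ann u f = (\<lambda>\<alpha>. f (\<alpha>(u := Suc (\<alpha> u))))"

definition vacuum :: fock where
  "vacuum = (\<lambda>\<alpha>. if \<alpha> = (\<lambda>_. 0) then 1 else 0)"

definition vars :: "nat \<Rightarrow> (nat \<times> bool) set" where
  "vars m = {..<m} \<times> UNIV"

text \<open>
  The differential operator of order one that a matrix indexed by variables induces on polynomials.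
  The action of matrices on the variable index, the polarization operators between the two rows and
  the degree operators are all of this form, so their commutators reduce to products of kernels.
\<close>
definition quantize :: "nat \<Rightarrow> kernel \<Rightarrow> fock \<Rightarrow> fock" where
  "quantize m c f = (\<lambda>\<alpha>. \<Sum>u\<in>vars m. \<Sum>v\<in>vars m. c u v * cre u (ann v f) \<alpha>)"

definition kernel_mult :: "nat \<Rightarrow> kernel \<Rightarrow> kernel \<Rightarrow> kernel" where
  "kernel_mult m c d u t = (\<Sum>v\<in>vars m. c u v * d v t)"

lemma finite_vars [simp]: "finite (vars m)"
  by (simp add: vars_def)

lemma sum_vars: "(\<Sum>u\<in>vars m. g u) = (\<Sum>i<m. g (i, False) + g (i, True))"
  unfolding vars_def sum.cartesian_product' by (simp add: UNIV_bool)

lemma cre_cre: "cre u (cre v f) = cre v (cre u f)"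
  by (cases "u = v") (auto simp: cre_def fun_upd_twist fun_eq_iff fscale_apply)

lemma ann_ann: "ann u (ann v f) = ann v (ann u f)"
  by (cases "u = v") (auto simp: ann_def fun_upd_twist fun_eq_iff fscale_apply)

text \<open>
  The canonical commutation relation.
\<close>
lemma ann_cre: "ann u (cre v f) \<alpha> = cre v (ann u f) \<alpha> + (if u = v then f \<alpha> else 0)"
proof (cases "u = v")
  case True
  then show ?thesis by (cases "\<alpha> v") (auto simp: cre_def ann_def algebra_simps fun_upd_idem)
next
  case False
  then show ?thesis by (simp add: cre_def ann_def fun_upd_twist)
qed

lemma ann_vacuum: "ann u vacuum = 0"
proof -
  have "\<alpha>(u := Suc (\<alpha> u)) \<noteq> (\<lambda>_. 0)" for \<alpha> :: exponent
    by (metis fun_upd_same nat.distinct(1))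
  then show ?thesis by (simp add: ann_def vacuum_def fun_eq_iff fscale_apply del: fun_upd_apply)
qed

lemma cre_lin: "cre u (f + g) = cre u f + cre u g" "cre u (f - g) = cre u f - cre u g"
  "cre u (fscale a f) = fscale a (cre u f)" "cre u 0 = 0"
  by (auto simp: cre_def fun_eq_iff fscale_apply algebra_simps)

lemma ann_lin: "ann u (f + g) = ann u f + ann u g" "ann u (f - g) = ann u f - ann u g"
  "ann u (fscale a f) = fscale a (ann u f)" "ann u 0 = 0"
  by (auto simp: ann_def fun_eq_iff fscale_apply)

lemma quantize_lin: "quantize m c (f + g) = quantize m c f + quantize m c g"
  "quantize m c (f - g) = quantize m c f - quantize m c g"
  "quantize m c (fscale a f) = fscale a (quantize m c f)" "quantize m c 0 = 0"
  by (auto simp: quantize_def fun_eq_iff fscale_apply cre_lin ann_lin algebra_simps sum.distrib sum_subtractf sum_distrib_left)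

lemma quantize_cong:
  "(\<And>u v. u \<in> vars m \<Longrightarrow> v \<in> vars m \<Longrightarrow> c u v = d u v) \<Longrightarrow> quantize m c f = quantize m d f"
  by (auto simp: quantize_def fun_eq_iff fscale_apply intro!: sum.cong)

lemma quantize_kernel_lin:
  "quantize m (\<lambda>u v. c u v + d u v) f = quantize m c f + quantize m d f"
  "quantize m (\<lambda>u v. c u v - d u v) f = quantize m c f - quantize m d f"
  "quantize m (\<lambda>u v. a * c u v) f = fscale a (quantize m c f)"
  by (auto simp: quantize_def fun_eq_iff fscale_apply algebra_simps sum.distrib sum_subtractf sum_distrib_left)

text \<open>
  Moving all derivatives to the right leaves, by the canonical commutation relation, the quadratic
  operator of the product kernel and a term that is symmetric under exchange of the two kernels.
\<close>
lemma quantize_quantize: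
  "quantize m c (quantize m d f) \<alpha> =
     (\<Sum>u\<in>vars m. \<Sum>v\<in>vars m. \<Sum>s\<in>vars m. \<Sum>t\<in>vars m.
        c u v * d s t * cre u (cre s (ann v (ann t f))) \<alpha>)
     + quantize m (kernel_mult m c d) f \<alpha>"
proof -
  have hop: "cre u (ann v (quantize m d f)) \<alpha> =
      (\<Sum>s\<in>vars m. \<Sum>t\<in>vars m. d s t * (cre u (cre s (ann v (ann t f))) \<alpha>
         + (if v = s then cre u (ann t f) \<alpha> else 0)))" for u v
  proof -
    have "cre u (ann v (quantize m d f)) \<alpha> =
      (\<Sum>s\<in>vars m. \<Sum>t\<in>vars m. d s t * cre u (ann v (cre s (ann t f))) \<alpha>)"
      by (simp add: cre_def[of u] ann_def[of v] quantize_def sum_distrib_left algebra_simps)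
    also have "\<dots> = (\<Sum>s\<in>vars m. \<Sum>t\<in>vars m. d s t * (cre u (cre s (ann v (ann t f))) \<alpha>
         + (if v = s then cre u (ann t f) \<alpha> else 0)))"
      by (intro sum.cong refl) (simp add: cre_def[of u] ann_cre algebra_simps)
    finally show ?thesis .
  qed
  have "(\<Sum>u\<in>vars m. \<Sum>v\<in>vars m. \<Sum>s\<in>vars m. \<Sum>t\<in>vars m.
      c u v * d s t * (if v = s then cre u (ann t f) \<alpha> else 0)) =
    (\<Sum>u\<in>vars m. \<Sum>v\<in>vars m. \<Sum>t\<in>vars m. c u v * d v t * cre u (ann t f) \<alpha>)"
  proof (rule sum.cong[OF refl], rule sum.cong[OF refl])
    fix u v assume "v \<in> vars m"
    have "(\<Sum>s\<in>vars m. \<Sum>t\<in>vars m. c u v * d s t * (if v = s then cre u (ann t f) \<alpha> else 0)) =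
      (\<Sum>s\<in>vars m. if v = s then (\<Sum>t\<in>vars m. c u v * d s t * cre u (ann t f) \<alpha>) else 0)"
      by (intro sum.cong refl) auto
    then show "(\<Sum>s\<in>vars m. \<Sum>t\<in>vars m. c u v * d s t * (if v = s then cre u (ann t f) \<alpha> else 0)) =
      (\<Sum>t\<in>vars m. c u v * d v t * cre u (ann t f) \<alpha>)"
      using \<open>v \<in> vars m\<close> by (simp add: sum.delta)
  qed
  also have "\<dots> = (\<Sum>u\<in>vars m. \<Sum>t\<in>vars m. \<Sum>v\<in>vars m. c u v * d v t * cre u (ann t f) \<alpha>)"
    by (intro sum.cong refl sum.swap)
  also have "\<dots> = quantize m (kernel_mult m c d) f \<alpha>"
    by (simp add: quantize_def kernel_mult_def sum_distrib_right)
  finally show ?thesis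
    by (subst quantize_def) (simp add: hop sum_distrib_left distrib_left sum.distrib mult.assoc)
qed

text \<open>
  Quantization is a homomorphism of Lie algebras: the commutator of the operators is the operator of
  the commutator. It is stated without subtraction.
\<close>
theorem quantize_commutator:
  "quantize m c (quantize m d f) + quantize m (kernel_mult m d c) f
     = quantize m d (quantize m c f) + quantize m (kernel_mult m c d) f"
proof
  fix \<alpha>
  let ?I = "vars m"
  have "(\<Sum>u\<in>?I. \<Sum>v\<in>?I. \<Sum>s\<in>?I. \<Sum>t\<in>?I. c u v * d s t * cre u (cre s (ann v (ann t f))) \<alpha>) =
     (\<Sum>u\<in>?I. \<Sum>s\<in>?I. \<Sum>v\<in>?I. \<Sum>t\<in>?I. c u v * d s t * cre u (cre s (ann v (ann t f))) \<alpha>)"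
    by (intro sum.cong refl sum.swap)
  also have "\<dots> = (\<Sum>s\<in>?I. \<Sum>u\<in>?I. \<Sum>v\<in>?I. \<Sum>t\<in>?I. c u v * d s t * cre u (cre s (ann v (ann t f))) \<alpha>)"
    by (rule sum.swap)
  also have "\<dots> = (\<Sum>s\<in>?I. \<Sum>u\<in>?I. \<Sum>t\<in>?I. \<Sum>v\<in>?I. c u v * d s t * cre u (cre s (ann v (ann t f))) \<alpha>)"
    by (intro sum.cong refl sum.swap)
  also have "\<dots> = (\<Sum>s\<in>?I. \<Sum>u\<in>?I. \<Sum>t\<in>?I. \<Sum>v\<in>?I. d s t * c u v * cre s (cre u (ann t (ann v f))) \<alpha>)"
  proof (intro sum.cong refl)
    fix s u t v
    show "c u v * d s t * cre u (cre s (ann v (ann t f))) \<alpha> = d s t * c u v * cre s (cre u (ann t (ann v f))) \<alpha>"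
      unfolding cre_cre[of u s] ann_ann[of v t] by simp
  qed
  also have "\<dots> = (\<Sum>s\<in>?I. \<Sum>t\<in>?I. \<Sum>u\<in>?I. \<Sum>v\<in>?I. d s t * c u v * cre s (cre u (ann t (ann v f))) \<alpha>)"
    by (intro sum.cong refl sum.swap)
  finally show "(quantize m c (quantize m d f) + quantize m (kernel_mult m d c) f) \<alpha>
     = (quantize m d (quantize m c f) + quantize m (kernel_mult m c d) f) \<alpha>"
    by (simp add: quantize_quantize)
qed

lemma quantize_commute:
  assumes "\<And>u v. u \<in> vars m \<Longrightarrow> v \<in> vars m \<Longrightarrow> kernel_mult m c d u v = kernel_mult m d c u v"
  shows "quantize m c (quantize m d f) = quantize m d (quantize m c f)"
  using quantize_commutator[of m c d f] quantize_cong[of m "kernel_mult m c d" "kernel_mult m d c" f] assms by simp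

text \<open>
  Quadratic operators act as derivations on a product with a variable.
\<close>
lemma quantize_cre:
  assumes "s \<in> vars m"
  shows "quantize m c (cre s f) = cre s (quantize m c f) + (\<lambda>\<alpha>. \<Sum>u\<in>vars m. c u s * cre u f \<alpha>)"
proof
  fix \<alpha>
  have hop: "cre u (ann v (cre s f)) \<alpha> = cre s (cre u (ann v f)) \<alpha> + (if v = s then cre u f \<alpha> else 0)" for u v
    by (subst cre_cre) (simp add: cre_def[of u] ann_cre algebra_simps)
  have "quantize m c (cre s f) \<alpha> = (\<Sum>u\<in>vars m. \<Sum>v\<in>vars m. c u v * cre s (cre u (ann v f)) \<alpha>)
     + (\<Sum>u\<in>vars m. \<Sum>v\<in>vars m. c u v * (if v = s then cre u f \<alpha> else 0))"
    unfolding quantize_def hop distrib_left sum.distrib ..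
  also have "(\<Sum>u\<in>vars m. \<Sum>v\<in>vars m. c u v * (if v = s then cre u f \<alpha> else 0)) =
      (\<Sum>u\<in>vars m. \<Sum>v\<in>vars m. if v = s then c u v * cre u f \<alpha> else 0)"
    by (intro sum.cong refl) simp
  also have "(\<Sum>u\<in>vars m. \<Sum>v\<in>vars m. if v = s then c u v * cre u f \<alpha> else 0) = (\<Sum>u\<in>vars m. c u s * cre u f \<alpha>)"
    using assms by (simp add: sum.delta)
  also have "(\<Sum>u\<in>vars m. \<Sum>v\<in>vars m. c u v * cre s (cre u (ann v f)) \<alpha>) = cre s (quantize m c f) \<alpha>"
    by (simp add: cre_def[of s] quantize_def sum_distrib_left algebra_simps)
  finally show "quantize m c (cre s f) \<alpha> = (cre s (quantize m c f) + (\<lambda>\<alpha>. \<Sum>u\<in>vars m. c u s * cre u f \<alpha>)) \<alpha>"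
    by simp
qed

lemma quantize_vacuum: "quantize m c vacuum = 0"
  by (simp add: quantize_def ann_vacuum fun_eq_iff fscale_apply cre_lin)

definition diag_kernel :: "(nat \<times> bool \<Rightarrow> complex) \<Rightarrow> kernel" where
  "diag_kernel e u v = (if u = v then e u else 0)"

lemma cre_ann_same: "cre u (ann u f) \<alpha> = of_nat (\<alpha> u) * f \<alpha>"
  by (cases "\<alpha> u") (auto simp: cre_def ann_def fun_upd_idem)

lemma quantize_diag: "quantize m (diag_kernel e) f \<alpha> = (\<Sum>u\<in>vars m. e u * of_nat (\<alpha> u)) * f \<alpha>"
proof -
  have "(\<Sum>v\<in>vars m. diag_kernel e u v * cre u (ann v f) \<alpha>) = e u * of_nat (\<alpha> u) * f \<alpha>" if "u \<in> vars m" for u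
  proof -
    have "(\<Sum>v\<in>vars m. diag_kernel e u v * cre u (ann v f) \<alpha>) = (\<Sum>v\<in>vars m. if u = v then e u * cre u (ann v f) \<alpha> else 0)"
      by (intro sum.cong refl) (simp add: diag_kernel_def)
    then show ?thesis using that by (simp add: sum.delta cre_ann_same)
  qed
  then show ?thesis by (simp add: quantize_def sum_distrib_right)
qed

section \<open>Homogeneous polynomials\<close>

text \<open>
  The exponent at which \<open>f\<close> is evaluated by \<open>cre u (ann v f)\<close> at \<open>\<alpha>\<close>. The order of the two
  updates makes it the identity for \<open>u = v\<close> and \<open>\<alpha> u > 0\<close>.
\<close>
definition shift :: "nat \<times> bool \<Rightarrow> nat \<times> bool \<Rightarrow> exponent \<Rightarrow> exponent" where
  "shift u v \<alpha> = (\<alpha>(u := \<alpha> u - 1))(v := Suc ((\<alpha>(u := \<alpha> u - 1)) v))"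

definition exponents :: "nat \<Rightarrow> nat \<Rightarrow> exponent set" where
  "exponents m d = {\<alpha>. (\<forall>u. u \<notin> vars m \<longrightarrow> \<alpha> u = 0) \<and> (\<Sum>u\<in>vars m. \<alpha> u) = d}"

lemma cre_ann_shift: "cre u (ann v f) \<alpha> = of_nat (\<alpha> u) * f (shift u v \<alpha>)"
  by (simp add: cre_def ann_def shift_def)

lemma shift_shift: "\<alpha> u > 0 \<Longrightarrow> shift v u (shift u v \<alpha>) = \<alpha>"
  by (auto simp: shift_def fun_eq_iff)

lemma shift_positive: "shift u v \<alpha> v > 0"
  by (simp add: shift_def)

text \<open>
  With \<open>g\<close> constant this says that the degree is preserved; other choices of \<open>g\<close> give the degree in
  the second row and the depth that drops under raising operators.
\<close>
lemma sum_shift: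
  fixes g :: "nat \<times> bool \<Rightarrow> nat"
  assumes "u \<in> vars m" "v \<in> vars m" "\<alpha> u > 0"
  shows "(\<Sum>w\<in>vars m. g w * shift u v \<alpha> w) + g u = (\<Sum>w\<in>vars m. g w * \<alpha> w) + g v"
proof -
  have "shift u v \<alpha> w + (if w = u then 1 else 0) = \<alpha> w + (if w = v then 1 else 0)" for w
    using assms(3) by (auto simp: shift_def)
  then have "g w * (shift u v \<alpha> w + (if w = u then 1 else 0)) = g w * (\<alpha> w + (if w = v then 1 else 0))" for w
    by simp
  then have "g w * shift u v \<alpha> w + (if w = u then g w else 0) = g w * \<alpha> w + (if w = v then g w else 0)" for w
    unfolding distrib_left by (simp add: if_distrib cong: if_cong)
  then have "(\<Sum>w\<in>vars m. g w * shift u v \<alpha> w + (if w = u then g w else 0)) =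
      (\<Sum>w\<in>vars m. g w * \<alpha> w + (if w = v then g w else 0))"
    by (intro sum.cong) auto
  then show ?thesis using assms(1,2) by (simp add: sum.distrib sum.delta)
qed

lemma shift_exponents:
  assumes "u \<in> vars m" "v \<in> vars m" "\<alpha> u > 0"
  shows "shift u v \<alpha> \<in> exponents m d \<longleftrightarrow> \<alpha> \<in> exponents m d"
proof -
  have "(\<Sum>w\<in>vars m. shift u v \<alpha> w) = (\<Sum>w\<in>vars m. \<alpha> w)"
    using sum_shift[of u m v \<alpha> "\<lambda>_. 1"] assms by simp
  moreover have "w \<notin> vars m \<Longrightarrow> shift u v \<alpha> w = \<alpha> w" for w
    using assms by (auto simp: shift_def)
  ultimately show ?thesis by (auto simp: exponents_def)
qed

lemma finite_exponents: "finite (exponents m d)"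
proof (rule finite_subset)
  show "exponents m d \<subseteq> {\<alpha>. \<forall>u. (u \<in> vars m \<longrightarrow> \<alpha> u \<in> {..d}) \<and> (u \<notin> vars m \<longrightarrow> \<alpha> u = 0)}"
  proof
    fix \<alpha> assume "\<alpha> \<in> exponents m d"
    then have "\<alpha> u \<le> d" if "u \<in> vars m" for u
      using member_le_sum[of u "vars m" \<alpha>] that by (simp add: exponents_def)
    then show "\<alpha> \<in> {\<alpha>. \<forall>u. (u \<in> vars m \<longrightarrow> \<alpha> u \<in> {..d}) \<and> (u \<notin> vars m \<longrightarrow> \<alpha> u = 0)}"
      using \<open>\<alpha> \<in> exponents m d\<close> by (simp add: exponents_def)
  qed
  show "finite {\<alpha>. \<forall>u. (u \<in> vars m \<longrightarrow> \<alpha> u \<in> {..d}) \<and> (u \<notin> vars m \<longrightarrow> (\<alpha> u :: nat) = 0)}"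
    by (rule finite_set_of_finite_funs) auto
qed

lemma quantize_fun_on:
  assumes "f \<in> fun_on (exponents m d)"
  shows "quantize m c f \<in> fun_on (exponents m d)"
proof -
  have "cre u (ann v f) \<alpha> = 0" if "u \<in> vars m" "v \<in> vars m" "\<alpha> \<notin> exponents m d" for u v \<alpha>
    using assms that shift_exponents[OF that(1,2), of \<alpha> d]
    by (cases "\<alpha> u = 0") (auto simp: cre_ann_shift fun_on_def)
  then show ?thesis by (auto simp: fun_on_def quantize_def intro!: sum.neutral)
qed

lemma cre_fun_on:
  assumes "f \<in> fun_on (exponents m d)" "s \<in> vars m"
  shows "cre s f \<in> fun_on (exponents m (Suc d))"
proof -
  have "cre s f \<alpha> = 0" if "\<alpha> \<notin> exponents m (Suc d)" for \<alpha>
  proof (cases "\<alpha> s = 0")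
    case False
    let ?\<beta> = "\<alpha>(s := \<alpha> s - 1)"
    have "(\<Sum>w\<in>vars m. \<alpha> w) = (\<Sum>w\<in>vars m. ?\<beta> w + (if w = s then 1 else 0))"
      using False by (intro sum.cong) auto
    then have "(\<Sum>w\<in>vars m. \<alpha> w) = Suc (\<Sum>w\<in>vars m. ?\<beta> w)"
      using assms(2) by (simp add: sum.distrib sum.delta del: fun_upd_apply)
    moreover have "\<alpha> w = ?\<beta> w" if "w \<notin> vars m" for w
      using that assms(2) by auto
    ultimately have "?\<beta> \<notin> exponents m d"
      using \<open>\<alpha> \<notin> exponents m (Suc d)\<close> unfolding exponents_def by auto
    then show ?thesis using assms(1) by (simp add: cre_def fun_on_def)
  qed (simp add: cre_def)
  then show ?thesis by (simp add: fun_on_def)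
qed

lemma vacuum_fun_on: "vacuum \<in> fun_on (exponents m 0)"
  by (simp add: vacuum_def fun_on_def exponents_def)

section \<open>The Fischer inner product\<close>

definition exp_fact :: "nat \<Rightarrow> exponent \<Rightarrow> real" where
  "exp_fact m \<alpha> = (\<Prod>u\<in>vars m. fact (\<alpha> u))"

lemma exp_fact_pos: "exp_fact m \<alpha> > 0"
  by (auto simp: exp_fact_def intro!: prod_pos)

lemma exp_fact_shift:
  assumes uv: "u \<in> vars m" "v \<in> vars m" and pos: "\<alpha> u > 0"
  shows "exp_fact m \<alpha> * of_nat (shift u v \<alpha> v) = exp_fact m (shift u v \<alpha>) * of_nat (\<alpha> u)"
proof (cases "u = v")
  case True
  then have "shift u v \<alpha> = \<alpha>" using pos by (auto simp: shift_def fun_eq_iff)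
  then show ?thesis using True by simp
next
  case False
  have split: "exp_fact m \<beta> = fact (\<beta> u) * (fact (\<beta> v) * (\<Prod>w\<in>vars m - {u} - {v}. fact (\<beta> w)))" for \<beta>
    using uv False unfolding exp_fact_def
    by (subst prod.remove[of _ u], simp, simp, subst prod.remove[of _ v]) auto
  have "(\<Prod>w\<in>vars m - {u} - {v}. fact (shift u v \<alpha> w)) = (\<Prod>w\<in>vars m - {u} - {v}. fact (\<alpha> w) :: real)"
    by (intro prod.cong) (auto simp: shift_def)
  moreover have "fact (\<alpha> u) = real (\<alpha> u) * fact (\<alpha> u - 1)"
    using pos by (simp add: fact_reduce)
  moreover have "shift u v \<alpha> u = \<alpha> u - 1" "shift u v \<alpha> v = Suc (\<alpha> v)"
    using False by (auto simp: shift_def)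
  ultimately show ?thesis
    by (simp add: split algebra_simps)
qed

text \<open>
  On coefficients the Fischer inner product weights a monomial by \<open>\<alpha>!\<close>; in the present scaling of
  coefficients this weight becomes \<open>1 / \<alpha>!\<close>.
\<close>
abbreviation fock_inner :: "nat \<Rightarrow> nat \<Rightarrow> fock \<Rightarrow> fock \<Rightarrow> complex" where
  "fock_inner m d \<equiv> weighted_inner (exponents m d) (exp_fact m)"

text \<open>
  Multiplication by a variable is adjoint to differentiation with respect to it. On sums over
  exponents this is the reindexing of \<open>\<alpha>\<close> by the exponent shifted from \<open>u\<close> to \<open>v\<close>.
\<close>
lemma fock_inner_cre_ann:
  assumes uv: "u \<in> vars m" "v \<in> vars m"
  shows "fock_inner m d (cre u (ann v f)) g = fock_inner m d f (cre v (ann u g))"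
proof -
  let ?E = "exponents m d"
  have "fock_inner m d (cre u (ann v f)) g =
      (\<Sum>\<alpha>\<in>{\<alpha> \<in> ?E. \<alpha> u > 0}. of_nat (\<alpha> u) * f (shift u v \<alpha>) * cnj (g \<alpha>) / of_real (exp_fact m \<alpha>))"
    unfolding weighted_inner_def cre_ann_shift
    by (intro sum.mono_neutral_right) (auto simp: finite_exponents)
  also have "\<dots> = (\<Sum>\<beta>\<in>{\<beta> \<in> ?E. \<beta> v > 0}. f \<beta> * cnj (of_nat (\<beta> v) * g (shift v u \<beta>)) / of_real (exp_fact m \<beta>))"
  proof (rule sum.reindex_bij_witness[of _ "shift v u" "shift u v"])
    fix \<alpha> assume a: "\<alpha> \<in> {\<alpha> \<in> ?E. \<alpha> u > 0}"
    then show "shift v u (shift u v \<alpha>) = \<alpha>" by (simp add: shift_shift)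
    show "shift u v \<alpha> \<in> {\<beta> \<in> ?E. \<beta> v > 0}"
      using a uv by (simp add: shift_exponents shift_positive)
    have "complex_of_real (exp_fact m \<alpha>) * of_nat (shift u v \<alpha> v) =
        complex_of_real (exp_fact m (shift u v \<alpha>)) * of_nat (\<alpha> u)"
      using exp_fact_shift[OF uv, of \<alpha>] a by (metis (mono_tags, lifting) mem_Collect_eq of_real_mult of_real_of_nat_eq)
    then have "of_nat (shift u v \<alpha> v) / complex_of_real (exp_fact m (shift u v \<alpha>)) =
        of_nat (\<alpha> u) / complex_of_real (exp_fact m \<alpha>)"
      using exp_fact_pos[of m \<alpha>] exp_fact_pos[of m "shift u v \<alpha>"] by (simp add: frac_eq_eq mult.commute)
    then have "f (shift u v \<alpha>) * cnj (g \<alpha>) * (of_nat (shift u v \<alpha> v) / complex_of_real (exp_fact m (shift u v \<alpha>))) =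
        f (shift u v \<alpha>) * cnj (g \<alpha>) * (of_nat (\<alpha> u) / complex_of_real (exp_fact m \<alpha>))"
      by simp
    then show "f (shift u v \<alpha>) * cnj (of_nat (shift u v \<alpha> v) * g (shift v u (shift u v \<alpha>))) / of_real (exp_fact m (shift u v \<alpha>)) =
        of_nat (\<alpha> u) * f (shift u v \<alpha>) * cnj (g \<alpha>) / of_real (exp_fact m \<alpha>)"
      using a by (simp add: shift_shift mult_ac)
  next
    fix \<beta> assume b: "\<beta> \<in> {\<beta> \<in> ?E. \<beta> v > 0}"
    then show "shift u v (shift v u \<beta>) = \<beta>" by (simp add: shift_shift)
    show "shift v u \<beta> \<in> {\<alpha> \<in> ?E. \<alpha> u > 0}"
      using b uv by (simp add: shift_exponents shift_positive)
  qed
  also have "\<dots> = fock_inner m d f (cre v (ann u g))"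
    unfolding weighted_inner_def cre_ann_shift
    by (intro sum.mono_neutral_left) (auto simp: finite_exponents)
  finally show ?thesis .
qed

lemma fock_inner_quantize_left:
  "fock_inner m d (quantize m c f) g =
     (\<Sum>u\<in>vars m. \<Sum>v\<in>vars m. c u v * fock_inner m d (cre u (ann v f)) g)"
proof -
  have "fock_inner m d (quantize m c f) g =
     (\<Sum>\<alpha>\<in>exponents m d. \<Sum>u\<in>vars m. \<Sum>v\<in>vars m. c u v * (cre u (ann v f) \<alpha> * cnj (g \<alpha>) / of_real (exp_fact m \<alpha>)))"
    by (simp add: weighted_inner_def quantize_def sum_distrib_right sum_divide_distrib mult.assoc)
  also have "\<dots> = (\<Sum>u\<in>vars m. \<Sum>\<alpha>\<in>exponents m d. \<Sum>v\<in>vars m. c u v * (cre u (ann v f) \<alpha> * cnj (g \<alpha>) / of_real (exp_fact m \<alpha>)))"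
    by (rule sum.swap)
  also have "\<dots> = (\<Sum>u\<in>vars m. \<Sum>v\<in>vars m. \<Sum>\<alpha>\<in>exponents m d. c u v * (cre u (ann v f) \<alpha> * cnj (g \<alpha>) / of_real (exp_fact m \<alpha>)))"
    by (rule sum.cong[OF refl], rule sum.swap)
  finally show ?thesis by (simp add: weighted_inner_def sum_distrib_left)
qed

lemma fock_inner_quantize:
  "fock_inner m d (quantize m c f) g = fock_inner m d f (quantize m (\<lambda>u v. cnj (c v u)) g)"
proof -
  have "fock_inner m d f (quantize m (\<lambda>u v. cnj (c v u)) g) =
      (\<Sum>u\<in>vars m. \<Sum>v\<in>vars m. c v u * cnj (fock_inner m d (cre u (ann v g)) f))"
    by (subst weighted_inner_cnj) (simp add: fock_inner_quantize_left)
  also have "\<dots> = (\<Sum>u\<in>vars m. \<Sum>v\<in>vars m. c v u * fock_inner m d (cre v (ann u f)) g)"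
    by (intro sum.cong refl) (subst weighted_inner_cnj[symmetric], simp add: fock_inner_cre_ann)
  also have "\<dots> = (\<Sum>v\<in>vars m. \<Sum>u\<in>vars m. c v u * fock_inner m d (cre v (ann u f)) g)"
    by (rule sum.swap)
  finally show ?thesis by (simp add: fock_inner_quantize_left)
qed

section \<open>The two-row module\<close>

text \<open>
  Matrices act on the index \<open>i\<close> simultaneously in both rows of variables.
\<close>
definition mat_kernel :: "complex mat \<Rightarrow> kernel" where
  "mat_kernel A u v = (if snd u = snd v then A $$ (fst u, fst v) else 0)"

text \<open>
  The kernel of the polarization operator \<open>\<Sum>i. x\<^sub>i \<partial>/\<partial>y\<^sub>i\<close>.
\<close>
definition polar_kernel :: kernel where
  "polar_kernel u v = (if fst u = fst v \<and> \<not> snd u \<and> snd v then 1 else 0)"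

definition row_kernel :: "bool \<Rightarrow> kernel" where
  "row_kernel r = diag_kernel (\<lambda>u. if snd u = r then 1 else 0)"

definition gl_action :: "nat \<Rightarrow> complex mat \<Rightarrow> fock \<Rightarrow> fock" where
  "gl_action m A = quantize m (mat_kernel A)"

text \<open>
  Polynomials of degree \<open>k\<close> in the \<open>x\<^sub>i\<close> and \<open>l\<close> in the \<open>y\<^sub>i\<close> that are killed by polarization. The
  degree in each row is imposed as total degree plus an eigenvalue of the degree operator of the second
  row, so that invariance under matrices is a matter of commuting kernels.
\<close>
definition two_row_module :: "nat \<Rightarrow> nat \<Rightarrow> nat \<Rightarrow> fock set" where
  "two_row_module m k l = {f \<in> fun_on (exponents m (k + l)).
     quantize m (row_kernel True) f = fscale (of_nat l) f \<and> quantize m polar_kernel f = 0}"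

lemma in_vars [simp]: "(i, r) \<in> vars m \<longleftrightarrow> i < m"
  by (simp add: vars_def)

lemma kernel_mult_mat_mat:
  assumes "A \<in> carrier_mat m m" "B \<in> carrier_mat m m" "u \<in> vars m" "v \<in> vars m"
  shows "kernel_mult m (mat_kernel A) (mat_kernel B) u v = mat_kernel (A * B) u v"
proof -
  obtain i r j s where uv: "u = (i, r)" "v = (j, s)" by fastforce
  have "(A * B) $$ (i, j) = (\<Sum>p<m. A $$ (i, p) * B $$ (p, j))"
    using mult_mat_entry[OF assms(1,2)] assms(3,4) uv by simp
  then show ?thesis
    unfolding kernel_mult_def sum_vars mat_kernel_def uv by (cases r; cases s; simp del: index_mult_mat)
qed

lemma kernel_mult_mat_polar:
  assumes "u \<in> vars m" "v \<in> vars m"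
  shows "kernel_mult m (mat_kernel A) polar_kernel u v = kernel_mult m polar_kernel (mat_kernel A) u v"
proof -
  obtain i r j s where uv: "u = (i, r)" "v = (j, s)" by fastforce
  have ij: "i < m" "j < m" using assms uv by auto
  have "(\<Sum>p<m. A $$ (i, p) * (if p = j then 1 else 0)) = A $$ (i, j)"
    "(\<Sum>p<m. (if i = p then 1 else 0) * A $$ (p, j)) = A $$ (i, j)"
    using ij by (simp_all add: if_distrib[of "\<lambda>x. _ * x"] if_distrib[of "\<lambda>x. x * _"] sum.delta cong: if_cong)
  then show ?thesis
    unfolding kernel_mult_def sum_vars mat_kernel_def polar_kernel_def uv
    by (cases r; cases s; simp cong: if_cong)
qed

lemma kernel_mult_mat_row:
  assumes "u \<in> vars m" "v \<in> vars m"
  shows "kernel_mult m (mat_kernel A) (row_kernel r) u v = kernel_mult m (row_kernel r) (mat_kernel A) u v"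
proof -
  have "kernel_mult m (mat_kernel A) (row_kernel r) u v =
      (\<Sum>w\<in>vars m. if w = v then mat_kernel A u w * (if snd v = r then 1 else 0) else 0)"
    unfolding kernel_mult_def row_kernel_def diag_kernel_def by (intro sum.cong refl) auto
  also have "\<dots> = mat_kernel A u v * (if snd v = r then 1 else 0)"
    using assms by (simp add: sum.delta)
  also have "\<dots> = (if snd u = r then 1 else 0) * mat_kernel A u v"
    by (simp add: mat_kernel_def)
  also have "\<dots> = (\<Sum>w\<in>vars m. if u = w then (if snd u = r then 1 else 0) * mat_kernel A w v else 0)"
    using assms by (simp add: sum.delta)
  also have "\<dots> = kernel_mult m (row_kernel r) (mat_kernel A) u v"
    unfolding kernel_mult_def row_kernel_def diag_kernel_def by (intro sum.cong refl) auto
  finally show ?thesis .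
qed

lemma gl_action_two_row_module:
  assumes "f \<in> two_row_module m k l"
  shows "gl_action m A f \<in> two_row_module m k l"
proof -
  have "quantize m (row_kernel True) (gl_action m A f) = fscale (of_nat l) (gl_action m A f)"
    using quantize_commute[OF kernel_mult_mat_row, of m A True f] assms
    by (simp add: gl_action_def two_row_module_def quantize_lin)
  moreover have "quantize m polar_kernel (gl_action m A f) = 0"
    using quantize_commute[OF kernel_mult_mat_polar, of m A f] assms
    by (simp add: gl_action_def two_row_module_def quantize_lin)
  ultimately show ?thesis
    using assms quantize_fun_on by (auto simp: two_row_module_def gl_action_def)
qed

lemma two_row_module_subspace: "fn.subspace (two_row_module m k l)"
  using fun_on_subspace[of "exponents m (k + l)"]
  by (auto simp: two_row_module_def fn.subspace_def quantize_lin fn.scale_right_distrib mult.commute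
      simp del: plus_fun_apply)

lemma diff_eq_diff_if_add_eq_add:
  fixes a :: "'a :: ab_group_add"
  assumes "a + b = c + d"
  shows "d - b = a - c"
  using assms by (simp add: algebra_simps)

lemma gl_action_lie_bracket:
  assumes "A \<in> carrier_mat m m" "B \<in> carrier_mat m m"
  shows "gl_action m (lie_bracket A B) f = gl_action m A (gl_action m B f) - gl_action m B (gl_action m A f)"
proof -
  have e: "mat_kernel (lie_bracket A B) u v = mat_kernel (A * B) u v - mat_kernel (B * A) u v"
    if "u \<in> vars m" "v \<in> vars m" for u v
  proof -
    have "fst u < m" "fst v < m" using that by (auto simp: vars_def)
    then show ?thesis
      using assms by (simp add: mat_kernel_def lie_bracket_def del: index_mult_mat(1))
  qed
  have "gl_action m (lie_bracket A B) f = quantize m (mat_kernel (A * B)) f - quantize m (mat_kernel (B * A)) f"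
    unfolding gl_action_def quantize_kernel_lin[symmetric] by (rule quantize_cong) (rule e)
  also have "\<dots> = quantize m (kernel_mult m (mat_kernel A) (mat_kernel B)) f
      - quantize m (kernel_mult m (mat_kernel B) (mat_kernel A)) f"
    using assms kernel_mult_mat_mat
    by (intro arg_cong2[of _ _ _ _ "(-)"] quantize_cong) (auto simp: kernel_mult_mat_mat)
  also have "\<dots> = gl_action m A (gl_action m B f) - gl_action m B (gl_action m A f)"
    unfolding gl_action_def by (rule diff_eq_diff_if_add_eq_add) (rule quantize_commutator)
  finally show ?thesis .
qed

lemma gl_action_mat_add:
  assumes "A \<in> carrier_mat m m" "B \<in> carrier_mat m m"
  shows "gl_action m (A + B) f = gl_action m A f + gl_action m B f"
  unfolding gl_action_def quantize_kernel_lin[symmetric]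
  by (rule quantize_cong) (use assms in \<open>auto simp: mat_kernel_def vars_def\<close>)

lemma gl_action_mat_scale:
  assumes "A \<in> carrier_mat m m"
  shows "gl_action m (c \<cdot>\<^sub>m A) f = fscale c (gl_action m A f)"
  unfolding gl_action_def quantize_kernel_lin[symmetric]
  by (rule quantize_cong) (use assms in \<open>auto simp: mat_kernel_def vars_def\<close>)

lemmas gl_action_lin = quantize_lin[of m "mat_kernel A" for m A, folded gl_action_def]

lemma two_row_module_representation:
  "sl_representation fscale m (two_row_module m k l) (gl_action m)"
proof (unfold_locales)
  show "fn.subspace (two_row_module m k l)" by (rule two_row_module_subspace)
qed (auto simp: gl_action_two_row_module gl_action_lie_bracket gl_action_mat_add gl_action_mat_scale sl_carrier
      gl_action_lin simp del: plus_fun_apply)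

lemma gl_action_unit:
  assumes "i < m" "j < m"
  shows "gl_action m (unit_mat m i j) f = cre (i, False) (ann (j, False) f) + cre (i, True) (ann (j, True) f)"
proof
  fix \<alpha>
  have s: "(\<Sum>p<m. \<Sum>q<m. unit_mat m i j $$ (p, q) * h p q) = h i j" for h :: "nat \<Rightarrow> nat \<Rightarrow> complex"
  proof -
    have "(\<Sum>q<m. unit_mat m i j $$ (p, q) * h p q) = (if p = i then h i j else 0)" if "p < m" for p
    proof -
      have "(\<Sum>q<m. unit_mat m i j $$ (p, q) * h p q) = (\<Sum>q<m. if q = j then (if p = i then h i j else 0) else 0)"
        using that assms by (intro sum.cong refl) (auto simp: unit_mat_def)
      then show ?thesis using assms by (simp add: sum.delta)
    qed
    then show ?thesis using assms by (simp add: sum.delta)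
  qed
  have "gl_action m (unit_mat m i j) f \<alpha> =
     (\<Sum>p<m. \<Sum>q<m. unit_mat m i j $$ (p, q) * cre (p, False) (ann (q, False) f) \<alpha>)
     + (\<Sum>p<m. \<Sum>q<m. unit_mat m i j $$ (p, q) * cre (p, True) (ann (q, True) f) \<alpha>)"
    by (simp add: gl_action_def quantize_def sum_vars mat_kernel_def sum.distrib)
  then show "gl_action m (unit_mat m i j) f \<alpha> = (cre (i, False) (ann (j, False) f) + cre (i, True) (ann (j, True) f)) \<alpha>"
    by (simp add: s)
qed

section \<open>Singular vectors\<close>

text \<open>
  Multiplication by the determinant \<open>x\<^sub>0 y\<^sub>1 - x\<^sub>1 y\<^sub>0\<close>.
\<close>
definition det_mult :: "fock \<Rightarrow> fock" where
  "det_mult f = cre (0, False) (cre (1, True) f) - cre (1, False) (cre (0, True) f)"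

text \<open>
  A product with the determinant vanishes only if \<open>f\<close> does: the equation expresses the value at an
  exponent by the value at one with a smaller exponent of \<open>x\<^sub>1\<close>.
\<close>
lemma det_mult_inj:
  assumes "det_mult f = 0"
  shows "f = 0"
proof -
  have "f \<gamma> = 0" if "\<gamma> (1, False) = n" for \<gamma> n
    using that
  proof (induction n arbitrary: \<gamma> rule: less_induct)
    case (less n)
    \<comment> \<open>at \<open>?\<alpha>\<close> the two terms of the determinant involve \<open>f \<gamma>\<close> and \<open>f ?\<gamma>\<close>\<close>
    let ?\<alpha> = "\<gamma>((0, False) := Suc (\<gamma> (0, False)), (1, True) := Suc (\<gamma> (1, True)))"
    let ?\<gamma> = "?\<alpha>((1, False) := \<gamma> (1, False) - 1, (0, True) := \<gamma> (0, True) - 1)"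
    have "cre (0, False) (cre (1, True) f) ?\<alpha> = of_nat (Suc (\<gamma> (0, False))) * (of_nat (Suc (\<gamma> (1, True))) * f \<gamma>)"
      by (simp add: cre_def fun_upd_twist[of "(0::nat, False)"])
    moreover have "cre (1, False) (cre (0, True) f) ?\<alpha> = of_nat (\<gamma> (1, False)) * (of_nat (\<gamma> (0, True)) * f ?\<gamma>)"
      by (simp add: cre_def)
    moreover have "of_nat (\<gamma> (1, False)) * f ?\<gamma> = 0"
    proof (cases "\<gamma> (1, False) = 0")
      case False
      have "f ?\<gamma> = 0"
        by (rule less.IH[OF _ refl]) (use False less.prems in simp)
      then show ?thesis by simp
    qed simp
    ultimately have "of_nat (Suc (\<gamma> (0, False))) * (of_nat (Suc (\<gamma> (1, True))) * f \<gamma>) = 0"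
      using fun_cong[OF assms, of ?\<alpha>] by (auto simp: det_mult_def)
    then show ?case by (simp del: of_nat_Suc)
  qed
  then show ?thesis by (simp add: fun_eq_iff)
qed

lemma cre_inj:
  assumes "cre u f = 0"
  shows "f = 0"
proof
  fix \<gamma>
  have "cre u f (\<gamma>(u := Suc (\<gamma> u))) = of_nat (Suc (\<gamma> u)) * f \<gamma>"
    by (simp add: cre_def)
  then show "f \<gamma> = 0 \<gamma>" using assms by (simp del: of_nat_Suc)
qed

definition singular :: "nat \<Rightarrow> fock \<Rightarrow> bool" where
  "singular m f \<longleftrightarrow> (\<forall>i j. i < j \<and> j < m \<longrightarrow> gl_action m (unit_mat m i j) f = 0)"

text \<open>
  The partial derivatives \<open>p\<close> and \<open>q\<close> with respect to \<open>x\<^sub>j\<close> and \<open>y\<^sub>j\<close> solve the homogeneous linear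
  equations \<open>x\<^sub>i p + y\<^sub>i q = 0\<close> for \<open>i = 0, 1\<close>, whose determinant is not a zero divisor. So a singular
  vector involves only the first two variables of each row.
\<close>
lemma singular_ann_zero:
  assumes f: "singular m f" and j: "2 \<le> j" "j < m"
  shows "ann (j, r) f = 0"
proof -
  let ?p = "ann (j, False) f" and ?q = "ann (j, True) f"
  have e: "cre (0, False) ?p = - cre (0, True) ?q" "cre (1, False) ?p = - cre (1, True) ?q"
    using f j gl_action_unit[of 0 m j f] gl_action_unit[of 1 m j f]
    by (auto simp: singular_def eq_neg_iff_add_eq_0 simp del: plus_fun_apply)
  have neg: "cre u (- g) = - cre u g" for u g
    by (simp add: cre_def fun_eq_iff)
  have "det_mult ?p = cre (1, True) (cre (0, False) ?p) - cre (0, True) (cre (1, False) ?p)"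
    unfolding det_mult_def cre_cre[of "(0, False)"] cre_cre[of "(1, False)"] ..
  also have "\<dots> = 0"
    unfolding e neg cre_cre[of "(1, True)"] by simp
  finally have p: "?p = 0" by (rule det_mult_inj)
  have q: "cre (1, True) ?q = - cre (1, False) ?p" "cre (0, True) ?q = - cre (0, False) ?p"
    using e by simp_all
  have "det_mult ?q = 0"
    unfolding det_mult_def q neg p by (simp add: cre_lin)
  then have "?q = 0" by (rule det_mult_inj)
  with p show ?thesis by (cases r) auto
qed

text \<open>
  The exponent of the monomial \<open>x\<^sub>0^k y\<^sub>1^l\<close>.
\<close>
definition top_exponent :: "nat \<Rightarrow> nat \<Rightarrow> exponent" where
  "top_exponent k l = (\<lambda>_. 0)((0, False) := k, (1, True) := l)"

lemma row_sum:
  assumes "f \<in> two_row_module m k l" "f \<alpha> \<noteq> 0"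
  shows "(\<Sum>i<m. \<alpha> (i, True)) = l" "(\<Sum>i<m. \<alpha> (i, False)) = k"
proof -
  have "quantize m (row_kernel True) f \<alpha> = of_nat l * f \<alpha>"
    using assms by (simp add: two_row_module_def fscale_apply)
  then have "(\<Sum>i<m. of_nat (\<alpha> (i, True))) * f \<alpha> = of_nat l * f \<alpha>"
    by (simp add: row_kernel_def quantize_diag sum_vars)
  then have "of_nat (\<Sum>i<m. \<alpha> (i, True)) = (of_nat l :: complex)"
    using assms by simp
  then show T: "(\<Sum>i<m. \<alpha> (i, True)) = l" by (simp only: of_nat_eq_iff)
  have "\<alpha> \<in> exponents m (k + l)" using assms by (auto simp: two_row_module_def fun_on_def)
  then show "(\<Sum>i<m. \<alpha> (i, False)) = k"
    using T by (simp add: exponents_def sum_vars sum.distrib)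
qed

lemma quantize_polar: "quantize m polar_kernel f \<alpha> = (\<Sum>i<m. cre (i, False) (ann (i, True) f) \<alpha>)"
proof -
  have "(\<Sum>j<m. polar_kernel (i, False) (j, True) * h j) = h i" if "i < m" for i and h :: "nat \<Rightarrow> complex"
  proof -
    have "(\<Sum>j<m. polar_kernel (i, False) (j, True) * h j) = (\<Sum>j<m. if i = j then h j else 0)"
      by (intro sum.cong refl) (simp add: polar_kernel_def)
    then show ?thesis using that by simp
  qed
  moreover have "polar_kernel (i, False) (j, False) = 0" "polar_kernel (i, True) (j, r) = 0" for i j r
    by (auto simp: polar_kernel_def)
  ultimately show ?thesis by (simp add: quantize_def sum_vars)
qed

text \<open>
  Only \<open>x\<^sub>0\<close>, \<open>x\<^sub>1\<close>, \<open>y\<^sub>0\<close>, \<open>y\<^sub>1\<close> occur. Being killed by the raising operator ties the coefficient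
  at an exponent containing \<open>x\<^sub>1\<close> to the one with a factor \<open>x\<^sub>1 y\<^sub>0\<close> replaced by \<open>x\<^sub>0 y\<^sub>1\<close>. Once
  \<open>x\<^sub>1\<close> is gone, being killed by polarization forbids \<open>y\<^sub>0\<close>, and only the top monomial remains.
  Hence all coefficients are determined by the top one.
\<close>
lemma singular_zero_if_top_zero:
  assumes m: "2 \<le> m" and f: "f \<in> two_row_module m k l" "singular m f" and top: "f (top_exponent k l) = 0"
  shows "f = 0"
proof -
  have "f (top_exponent k l) \<noteq> 0" if "f \<gamma> \<noteq> 0" for \<gamma>
    using that
  proof (induction "\<gamma> (1, False)" arbitrary: \<gamma> rule: less_induct)
    case less
    have far: "\<gamma> (j, r) = 0" if "2 \<le> j" for j r
    proof (cases "j < m")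
      case True
      show ?thesis
      proof (rule ccontr)
        assume "\<gamma> (j, r) \<noteq> 0"
        then have "f \<gamma> = ann (j, r) f (\<gamma>((j, r) := \<gamma> (j, r) - 1))"
          by (simp add: ann_def)
        then show False using less.prems singular_ann_zero[OF f(2) that True, of r] by simp
      qed
    next
      case False
      have "\<gamma> \<in> exponents m (k + l)" using f less.prems by (auto simp: two_row_module_def fun_on_def)
      then show ?thesis using False by (simp add: exponents_def)
    qed
    show ?case
    proof (cases "\<gamma> (1, False) = 0")
      case False
      let ?\<alpha> = "shift (1, False) (0, False) \<gamma>"
      have "gl_action m (unit_mat m 0 1) f ?\<alpha> = 0"
        using f(2) m by (simp add: singular_def)
      then have "of_nat (?\<alpha> (0, False)) * f (shift (0, False) (1, False) ?\<alpha>)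
          + of_nat (?\<alpha> (0, True)) * f (shift (0, True) (1, True) ?\<alpha>) = 0"
        using m by (simp add: gl_action_unit cre_ann_shift)
      moreover have "shift (0, False) (1, False) ?\<alpha> = \<gamma>"
        using False by (intro shift_shift) simp
      moreover have "?\<alpha> (0, False) > 0" by (rule shift_positive)
      ultimately have "f (shift (0, True) (1, True) ?\<alpha>) \<noteq> 0"
        using less.prems by auto
      moreover have "shift (0, True) (1, True) ?\<alpha> (1, False) < \<gamma> (1, False)"
        using False by (simp add: shift_def)
      ultimately show ?thesis using less.hyps by blast
    next
      case True
      have T0: "\<gamma> (0, True) = 0"
      proof (rule ccontr)
        assume nz: "\<gamma> (0, True) \<noteq> 0"
        let ?\<alpha> = "shift (0, True) (0, False) \<gamma>"
        have "?\<alpha> (i, False) = 0" if "i \<noteq> 0" for i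
          using that True far[of i False] by (cases "i = 1") (auto simp: shift_def)
        then have "cre (i, False) (ann (i, True) f) ?\<alpha> = 0" if "i \<noteq> 0" for i
          using that by (simp add: cre_ann_shift)
        then have "quantize m polar_kernel f ?\<alpha> = cre (0, False) (ann (0, True) f) ?\<alpha>"
          unfolding quantize_polar using m by (subst sum.remove[of _ 0]) auto
        also have "\<dots> = of_nat (?\<alpha> (0, False)) * f \<gamma>"
          using nz by (simp add: cre_ann_shift shift_shift)
        finally show False
          using f(1) less.prems shift_positive[of "(0, True)" "(0, False)" \<gamma>]
          by (simp add: two_row_module_def)
      qed
      have two: "(\<Sum>i<m. \<gamma> (i, r)) = \<gamma> (0, r) + \<gamma> (1, r)" for r
      proof -
        have "(\<Sum>i<m. \<gamma> (i, r)) = (\<Sum>i\<in>{0, 1}. \<gamma> (i, r))"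
          using m far by (intro sum.mono_neutral_right) auto
        then show ?thesis by simp
      qed
      have "\<gamma> (j, r) = top_exponent k l (j, r)" for j r
        using two[of True] two[of False] row_sum[OF f(1) less.prems] True T0 far[of j r]
        by (cases "2 \<le> j"; cases "j = 0"; cases "j = 1"; cases r) (auto simp: top_exponent_def)
      then have "\<gamma> = top_exponent k l" by auto
      then show ?thesis using less.prems by simp
    qed
  qed
  then show ?thesis using top by (auto simp: fun_eq_iff)
qed

section \<open>The highest weight vector\<close>

text \<open>
  The polynomial \<open>(x\<^sub>0 y\<^sub>1 - x\<^sub>1 y\<^sub>0)^l x\<^sub>0^(k - l)\<close>.
\<close>
definition highest_vector :: "nat \<Rightarrow> nat \<Rightarrow> fock" where
  "highest_vector k l = (det_mult ^^ l) ((cre (0, False) ^^ (k - l)) vacuum)"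

lemma highest_vector_nonzero: "highest_vector k l \<noteq> 0"
proof -
  have v: "vacuum \<noteq> 0"
    by (auto simp: vacuum_def fun_eq_iff)
  have c: "(cre (0, False) ^^ n) vacuum \<noteq> 0" for n
    using v cre_inj by (induction n) auto
  have "(det_mult ^^ n) f \<noteq> 0" if "f \<noteq> 0" for n f
    using that det_mult_inj by (induction n) auto
  then show ?thesis using c by (simp add: highest_vector_def)
qed

lemma highest_vector_fun_on:
  assumes "2 \<le> m" "l \<le> k"
  shows "highest_vector k l \<in> fun_on (exponents m (k + l))"
proof -
  have c: "(cre (0, False) ^^ n) vacuum \<in> fun_on (exponents m n)" for n
    using assms(1) vacuum_fun_on by (induction n) (auto intro!: cre_fun_on)
  have det: "det_mult f \<in> fun_on (exponents m (Suc (Suc d)))" if "f \<in> fun_on (exponents m d)" for f d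
    unfolding det_mult_def using that assms(1)
    by (intro fn.subspace_diff[OF fun_on_subspace] cre_fun_on) auto
  have "(det_mult ^^ n) f \<in> fun_on (exponents m (d + 2 * n))" if "f \<in> fun_on (exponents m d)" for n f d
    using that by (induction n) (auto dest: det)
  from this[OF c, of l "k - l"] show ?thesis
    using assms(2) by (simp add: highest_vector_def add.commute)
qed

text \<open>
  A quadratic operator is a derivation that kills constants, so if both factors of the highest weight
  vector are eigenvectors, in the sense of its commutation with multiplication by them, then so is the
  product.
\<close>
lemma quantize_highest_vector:
  assumes det: "\<And>f. quantize m c (det_mult f) = det_mult (quantize m c f) + fscale a (det_mult f)"
    and cre: "\<And>f. quantize m c (cre (0, False) f) = cre (0, False) (quantize m c f) + fscale b (cre (0, False) f)"
  shows "quantize m c (highest_vector k l) = fscale (of_nat l * a + of_nat (k - l) * b) (highest_vector k l)"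
proof -
  have det_scale: "det_mult (fscale x f) = fscale x (det_mult f)" for x f
    by (simp add: det_mult_def cre_lin fn.scale_right_diff_distrib)
  have c: "quantize m c ((cre (0, False) ^^ n) vacuum) = fscale (of_nat n * b) ((cre (0, False) ^^ n) vacuum)" for n
  proof (induction n)
    case 0
    then show ?case by (simp add: quantize_vacuum)
  next
    case (Suc n)
    then show ?case by (simp add: cre cre_lin algebra_simps flip: fn.scale_left_distrib)
  qed
  have "quantize m c ((det_mult ^^ n) f) = fscale (of_nat n * a + x) ((det_mult ^^ n) f)"
    if "quantize m c f = fscale x f" for n f x
  proof (induction n)
    case 0
    then show ?case using that by simp
  next
    case (Suc n)
    then show ?case by (simp add: det det_scale algebra_simps flip: fn.scale_left_distrib)
  qed
  from this[OF c] show ?thesis by (simp add: highest_vector_def)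
qed

lemma quantize_det_mult:
  assumes m: "2 \<le> m"
  shows "quantize m c (det_mult f) = det_mult (quantize m c f) +
     (\<lambda>\<alpha>. (\<Sum>u\<in>vars m. c u (0, False) * cre u (cre (1, True) f) \<alpha>)
        + (\<Sum>u\<in>vars m. c u (1, True) * cre u (cre (0, False) f) \<alpha>)
        - (\<Sum>u\<in>vars m. c u (1, False) * cre u (cre (0, True) f) \<alpha>)
        - (\<Sum>u\<in>vars m. c u (0, True) * cre u (cre (1, False) f) \<alpha>))"
proof -
  have two: "quantize m c (cre s (cre t f)) = cre s (cre t (quantize m c f))
      + (\<lambda>\<alpha>. (\<Sum>u\<in>vars m. c u s * cre u (cre t f) \<alpha>) + (\<Sum>u\<in>vars m. c u t * cre u (cre s f) \<alpha>))"
    if "s \<in> vars m" "t \<in> vars m" for s t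
  proof -
    have "cre s (\<lambda>\<alpha>. \<Sum>u\<in>vars m. c u t * cre u f \<alpha>) = (\<lambda>\<alpha>. \<Sum>u\<in>vars m. c u t * cre s (cre u f) \<alpha>)"
      by (auto simp: cre_def[of s] sum_distrib_left algebra_simps)
    also have "\<dots> = (\<lambda>\<alpha>. \<Sum>u\<in>vars m. c u t * cre u (cre s f) \<alpha>)"
      by (rule ext, rule sum.cong[OF refl], subst cre_cre, rule refl)
    finally show ?thesis
      unfolding quantize_cre[OF that(1)] quantize_cre[OF that(2)] cre_lin(1) by (simp add: fun_eq_iff)
  qed
  show ?thesis
    using m by (simp add: det_mult_def quantize_lin two fun_eq_iff)
qed

lemma highest_vector_diag:
  assumes m: "2 \<le> m" and e: "e (0, False) + e (1, True) = e (1, False) + e (0, True)" and kl: "l \<le> k"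
  shows "quantize m (diag_kernel e) (highest_vector k l) =
    fscale (of_nat k * e (0, False) + of_nat l * e (1, True)) (highest_vector k l)"
proof -
  have d: "(\<Sum>u\<in>vars m. diag_kernel e u s * h u) = e s * h s" if "s \<in> vars m" for s and h :: "nat \<times> bool \<Rightarrow> complex"
  proof -
    have "(\<Sum>u\<in>vars m. diag_kernel e u s * h u) = (\<Sum>u\<in>vars m. if u = s then e s * h s else 0)"
      by (intro sum.cong refl) (simp add: diag_kernel_def)
    then show ?thesis using that by (simp add: sum.delta)
  qed
  have det: "quantize m (diag_kernel e) (det_mult f) = det_mult (quantize m (diag_kernel e) f)
      + fscale (e (0, False) + e (1, True)) (det_mult f)" for f
  proof
    fix \<alpha>
    let ?y = "cre (1, False) (cre (0, True) f) \<alpha>"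
    have "e (0, False) * ?y + e (1, True) * ?y = e (1, False) * ?y + e (0, True) * ?y"
      by (simp only: e distrib_right[symmetric])
    then show "quantize m (diag_kernel e) (det_mult f) \<alpha> = (det_mult (quantize m (diag_kernel e) f)
      + fscale (e (0, False) + e (1, True)) (det_mult f)) \<alpha>"
      using m unfolding quantize_det_mult[OF m]
        cre_cre[of "(1, True)" "(0, False)" f] cre_cre[of "(0, True)" "(1, False)" f]
      by (simp add: d fscale_apply det_mult_def cre_cre[of "(1, True)" "(0, False)" f]
          cre_cre[of "(0, True)" "(1, False)" f] algebra_simps del: One_nat_def)
  qed
  have c: "quantize m (diag_kernel e) (cre (0, False) f) = cre (0, False) (quantize m (diag_kernel e) f)
      + fscale (e (0, False)) (cre (0, False) f)" for f
    using m by (subst quantize_cre) (auto simp: d fscale_def)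
  show ?thesis
    unfolding quantize_highest_vector[OF det c] using kl
    by (simp add: of_nat_diff algebra_simps)
qed

lemma highest_vector_strictly_upper:
  assumes m: "2 \<le> m" and A: "\<And>i j. i < m \<Longrightarrow> j < m \<Longrightarrow> j \<le> i \<Longrightarrow> A $$ (i, j) = 0"
  shows "gl_action m A (highest_vector k l) = 0"
proof -
  have z: "(\<Sum>u\<in>vars m. mat_kernel A u (0, r) * h u) = 0" for r and h :: "nat \<times> bool \<Rightarrow> complex"
    using A m by (intro sum.neutral) (auto simp: mat_kernel_def vars_def)
  have upper: "a = 0" if "a < m" "A $$ (a, Suc 0) \<noteq> 0" for a
    using A[of a 1] that m by (cases "a = 0") auto
  have o: "(\<Sum>u\<in>vars m. mat_kernel A u (1, r) * h u) = A $$ (0, 1) * h (0, r)" for r and h :: "nat \<times> bool \<Rightarrow> complex"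
  proof -
    have "(\<Sum>u\<in>vars m. mat_kernel A u (1, r) * h u) = (\<Sum>u\<in>{(0, r)}. mat_kernel A u (1, r) * h u)"
      using m by (intro sum.mono_neutral_right) (auto simp: mat_kernel_def vars_def dest: upper)
    then show ?thesis by (simp add: mat_kernel_def)
  qed
  have det: "quantize m (mat_kernel A) (det_mult f) = det_mult (quantize m (mat_kernel A) f) + fscale 0 (det_mult f)" for f
    unfolding quantize_det_mult[OF m] z o cre_cre[of "(0, True)" "(0, False)"] by (simp add: fun_eq_iff fscale_apply)
  have c: "quantize m (mat_kernel A) (cre (0, False) f) = cre (0, False) (quantize m (mat_kernel A) f)
      + fscale 0 (cre (0, False) f)" for f
    using m by (subst quantize_cre) (auto simp: z fun_eq_iff fscale_apply)
  show ?thesis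
    unfolding gl_action_def quantize_highest_vector[OF det c] by simp
qed

lemma highest_vector_polar:
  assumes m: "2 \<le> m"
  shows "quantize m polar_kernel (highest_vector k l) = 0"
proof -
  have z: "(\<Sum>u\<in>vars m. polar_kernel u (i, False) * h u) = 0" for i and h :: "nat \<times> bool \<Rightarrow> complex"
    by (intro sum.neutral) (auto simp: polar_kernel_def)
  have o: "(\<Sum>u\<in>vars m. polar_kernel u (i, True) * h u) = h (i, False)" if "i < m" for i and h :: "nat \<times> bool \<Rightarrow> complex"
  proof -
    have "(\<Sum>u\<in>vars m. polar_kernel u (i, True) * h u) = (\<Sum>u\<in>{(i, False)}. polar_kernel u (i, True) * h u)"
      using that by (intro sum.mono_neutral_right) (auto simp: polar_kernel_def vars_def)
    then show ?thesis by (simp add: polar_kernel_def)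
  qed
  have lt: "0 < m" "1 < m" using m by auto
  have det: "quantize m polar_kernel (det_mult f) = det_mult (quantize m polar_kernel f) + fscale 0 (det_mult f)" for f
    unfolding quantize_det_mult[OF m] z o[OF lt(1)] o[OF lt(2)] cre_cre[of "(1, False)" "(0, False)"]
    by (simp add: fun_eq_iff fscale_apply)
  have c: "quantize m polar_kernel (cre (0, False) f) = cre (0, False) (quantize m polar_kernel f)
      + fscale 0 (cre (0, False) f)" for f
    using m by (subst quantize_cre) (auto simp: z fun_eq_iff fscale_apply)
  show ?thesis
    unfolding quantize_highest_vector[OF det c] by simp
qed

lemma highest_vector_in_module:
  assumes "2 \<le> m" "l \<le> k"
  shows "highest_vector k l \<in> two_row_module m k l"
  using highest_vector_fun_on[OF assms] highest_vector_polar[OF assms(1)]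
    highest_vector_diag[OF assms(1) _ assms(2), of "\<lambda>u. if snd u = True then 1 else 0"]
  by (simp add: two_row_module_def row_kernel_def)

lemma gl_action_cartan:
  assumes "H \<in> cartan m"
  shows "gl_action m H f = quantize m (diag_kernel (\<lambda>u. H $$ (fst u, fst u))) f"
  unfolding gl_action_def using assms
  by (intro quantize_cong)
     (auto simp: mat_kernel_def diag_kernel_def vars_def cartan_def sl_def diagonal_mat_def prod_eq_iff)

lemma two_row_module_highest_weight:
  assumes m: "2 \<le> m" and kl: "l \<le> k"
  shows "has_highest_weight fscale m (two_row_module m k l) (gl_action m)
    (\<lambda>H. of_nat k * epsilon 1 H + of_nat l * epsilon 2 H)"
  unfolding has_highest_weight_def
proof (intro bexI conjI allI impI ballI)
  show "highest_vector k l \<noteq> 0" by (rule highest_vector_nonzero)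
  show "highest_vector k l \<in> weight_space fscale m (two_row_module m k l) (gl_action m)
      (\<lambda>H. of_nat k * epsilon 1 H + of_nat l * epsilon 2 H)"
    using highest_vector_in_module[OF m kl] highest_vector_diag[OF m _ kl]
    by (simp add: weight_space_def gl_action_cartan epsilon_def)
  fix i j X
  assume ij: "1 \<le> i \<and> i < j \<and> j \<le> m" and X: "X \<in> root_space m (\<lambda>H. epsilon i H - epsilon j H)"
  show "gl_action m X (highest_vector k l) = 0"
    using root_space_strictly_upper[OF X] ij by (intro highest_vector_strictly_upper[OF m]) auto
qed

section \<open>Irreducibility\<close>

text \<open>
  Raising operators strictly lower the depth \<open>\<Sum>(i, r). i * \<alpha> (i, r)\<close>, so they kill any nonzero
  element of the submodule whose depth is minimal.
\<close>
lemma singular_vector_exists: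
  assumes S: "S \<subseteq> two_row_module m k l" "S \<noteq> {0}" "S \<noteq> {}"
    and inv: "\<And>A f. A \<in> sl m \<Longrightarrow> f \<in> S \<Longrightarrow> gl_action m A f \<in> S"
  obtains f where "f \<in> S" "f \<noteq> 0" "singular m f"
proof -
  define depth where "depth \<alpha> = (\<Sum>u\<in>vars m. fst u * \<alpha> u)" for \<alpha> :: exponent
  \<comment> \<open>a strict bound, so that it can be lowered even when all depths are zero\<close>
  define P where "P n \<longleftrightarrow> (\<exists>f\<in>S. f \<noteq> 0 \<and> (\<forall>\<alpha>. f \<alpha> \<noteq> 0 \<longrightarrow> depth \<alpha> < n))" for n
  obtain N where N: "\<forall>n\<in>depth ` exponents m (k + l). n < N"
    using finite_imageI[OF finite_exponents] finite_nat_set_iff_bounded by blast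
  obtain g where g: "g \<in> S" "g \<noteq> 0" using S by blast
  have "\<alpha> \<in> exponents m (k + l)" if "g \<alpha> \<noteq> 0" for \<alpha>
    using g S that by (auto simp: two_row_module_def fun_on_def)
  then have "P N" unfolding P_def using N g by blast
  define n where "n = (LEAST n. P n)"
  have "P n" unfolding n_def using \<open>P N\<close> by (rule LeastI)
  then obtain f where f: "f \<in> S" "f \<noteq> 0" "\<And>\<alpha>. f \<alpha> \<noteq> 0 \<Longrightarrow> depth \<alpha> < n"
    unfolding P_def by blast
  have n0: "n > 0" using f by (metis gr0I not_less_zero zero_fun_def ext)
  have "gl_action m (unit_mat m i j) f = 0" if ij: "i < j" "j < m" for i j
  proof (rule ccontr)
    assume nz: "gl_action m (unit_mat m i j) f \<noteq> 0"
    have "depth \<alpha> < n - 1" if a: "gl_action m (unit_mat m i j) f \<alpha> \<noteq> 0" for \<alpha>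
    proof -
      have "gl_action m (unit_mat m i j) f \<alpha> =
          of_nat (\<alpha> (i, False)) * f (shift (i, False) (j, False) \<alpha>)
          + of_nat (\<alpha> (i, True)) * f (shift (i, True) (j, True) \<alpha>)"
        using ij by (simp add: gl_action_unit cre_ann_shift)
      then obtain r where r: "\<alpha> (i, r) > 0" "f (shift (i, r) (j, r) \<alpha>) \<noteq> 0"
        using a by (metis add.right_neutral mult_eq_0_iff of_nat_0 neq0_conv)
      have "depth (shift (i, r) (j, r) \<alpha>) + i = depth \<alpha> + j"
        using sum_shift[of "(i, r)" m "(j, r)" \<alpha> fst] r ij by (simp add: depth_def)
      then show ?thesis using f(3)[OF r(2)] ij by simp
    qed
    then have "P (n - 1)"
      unfolding P_def using nz inv[OF unit_mat_in_sl f(1), of i j] ij by blast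
    then show False using not_less_Least[of "n - 1" P] n0 by (simp add: n_def)
  qed
  then show ?thesis using that f by (auto simp: singular_def)
qed

lemma submodule_contains_highest_vector:
  assumes m: "2 \<le> m" and kl: "l \<le> k"
    and S: "fn.subspace S" "S \<subseteq> two_row_module m k l" "S \<noteq> {0}"
    and inv: "\<And>A f. A \<in> sl m \<Longrightarrow> f \<in> S \<Longrightarrow> gl_action m A f \<in> S"
  shows "highest_vector k l \<in> S"
proof -
  let ?t = "top_exponent k l" and ?w = "highest_vector k l"
  have ne: "S \<noteq> {}" using fn.subspace_0[OF S(1)] by blast
  obtain f where f: "f \<in> S" "f \<noteq> 0" "singular m f"
    using singular_vector_exists[OF S(2,3) ne inv] by blast
  have top: "f ?t \<noteq> 0"
    using singular_zero_if_top_zero[OF m _ f(3)] f S by blast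
  define c where "c = ?w ?t / f ?t"
  have sing: "singular m ?w"
    unfolding singular_def by (auto intro!: highest_vector_strictly_upper[OF m] simp: unit_mat_def)
  have "?w - fscale c f = 0"
  proof (rule singular_zero_if_top_zero[OF m])
    show "?w - fscale c f \<in> two_row_module m k l"
      using highest_vector_in_module[OF m kl] f S two_row_module_subspace
      by (intro fn.subspace_diff fn.subspace_scale) auto
    show "singular m (?w - fscale c f)"
      using sing f(3) by (simp add: singular_def gl_action_lin)
    show "(?w - fscale c f) ?t = 0"
      using top by (simp add: c_def fscale_apply)
  qed
  then have "?w = fscale c f" by simp
  then show ?thesis using f S(1) by (simp add: fn.subspace_scale)
qed

text \<open>
  The adjoint of a matrix is its conjugate transpose.
\<close>
lemma gl_action_adjoint:
  assumes "A \<in> sl m"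
  obtains B where "B \<in> sl m" "\<And>d f g. fock_inner m d (gl_action m A f) g = fock_inner m d f (gl_action m B g)"
proof
  let ?B = "mat m m (\<lambda>(i, j). cnj (A $$ (j, i)))"
  show "?B \<in> sl m"
    using assms by (simp add: sl_def flip: cnj_sum)
  fix d f g
  have "quantize m (\<lambda>u v. cnj (mat_kernel A v u)) g = quantize m (mat_kernel ?B) g"
    by (rule quantize_cong) (auto simp: mat_kernel_def vars_def)
  then show "fock_inner m d (gl_action m A f) g = fock_inner m d f (gl_action m ?B g)"
    by (simp add: gl_action_def fock_inner_quantize)
qed

text \<open>
  A proper nonzero submodule would have a nonzero orthogonal complement in the module, which is a
  submodule as well. Both would contain the highest weight vector, which would be orthogonal to itself.
\<close>
theorem two_row_module_irreducible:
  assumes m: "2 \<le> m" and kl: "l \<le> k"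
  shows "irreducible_sl_representation fscale m (two_row_module m k l) (gl_action m)"
proof -
  interpret sl_representation fscale m "two_row_module m k l" "gl_action m"
    by (rule two_row_module_representation)
  let ?W = "two_row_module m k l" and ?w = "highest_vector k l"
  let ?inner = "fock_inner m (k + l)"
  show ?thesis
  proof unfold_locales
    show "?W \<noteq> {0}" using highest_vector_in_module[OF m kl] highest_vector_nonzero by blast
    fix S
    assume S: "fn.subspace S" "S \<subseteq> ?W" and inv: "\<And>A f. A \<in> sl m \<Longrightarrow> f \<in> S \<Longrightarrow> gl_action m A f \<in> S"
    show "S = {0} \<or> S = ?W"
    proof (rule ccontr)
      assume contra: "\<not> (S = {0} \<or> S = ?W)"
      then obtain f where f: "f \<in> ?W" "f \<notin> S" using S by blast
      have wS: "?w \<in> S"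
        using submodule_contains_highest_vector[OF m kl S _ inv] contra by blast
      have W: "?W \<subseteq> fun_on (exponents m (k + l))" by (auto simp: two_row_module_def)
      obtain s where s: "s \<in> S" "\<And>t. t \<in> S \<Longrightarrow> ?inner (f - s) t = 0"
        using orthogonal_projection[of "exponents m (k + l)" "exp_fact m" S, OF finite_exponents exp_fact_pos S(1)] S(2) W
        by blast
      define T where "T = {g \<in> ?W. \<forall>t\<in>S. ?inner g t = 0}"
      have "f - s \<in> T" using f s S two_row_module_subspace by (auto simp: T_def fn.subspace_diff)
      moreover have "f - s \<noteq> 0" using f s by auto
      ultimately have T0: "T \<noteq> {0}" by blast
      have "fn.subspace T"
        using two_row_module_subspace[of m k l]
        by (auto simp: T_def fn.subspace_def weighted_inner_left simp del: plus_fun_apply)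
      moreover have "T \<subseteq> ?W" by (auto simp: T_def)
      moreover have "gl_action m A g \<in> T" if A: "A \<in> sl m" and g: "g \<in> T" for A g
      proof -
        obtain B where "B \<in> sl m" "\<And>d f g. fock_inner m d (gl_action m A f) g = fock_inner m d f (gl_action m B g)"
          using gl_action_adjoint[OF A] by blast
        then show ?thesis using g inv gl_action_two_row_module by (auto simp: T_def)
      qed
      ultimately have "?w \<in> T"
        using submodule_contains_highest_vector[OF m kl _ _ T0] by blast
      then have "?inner ?w ?w = 0" using wS by (auto simp: T_def)
      then have "?w = 0"
        using weighted_inner_definite[of "exponents m (k + l)" "exp_fact m" ?w]
          finite_exponents exp_fact_pos highest_vector_in_module[OF m kl] W by blast
      then show False using highest_vector_nonzero by blast
    qed
  qed
qed

section \<open>Weight multiplicities of the two-row module\<close>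

definition weight_exponents :: "nat \<Rightarrow> (nat \<Rightarrow> nat) \<Rightarrow> exponent set" where
  "weight_exponents m a = {\<alpha>. (\<forall>u. u \<notin> vars m \<longrightarrow> \<alpha> u = 0) \<and>
     (\<forall>i<m. \<alpha> (i, False) + \<alpha> (i, True) = a (Suc i))}"

definition second_row :: "nat \<Rightarrow> exponent \<Rightarrow> nat" where
  "second_row m \<alpha> = (\<Sum>i<m. \<alpha> (i, True))"

lemma weight_exponents_subset:
  assumes "(\<Sum>i=1..m. a i) = d"
  shows "weight_exponents m a \<subseteq> exponents m d"
proof
  fix \<alpha> assume a: "\<alpha> \<in> weight_exponents m a"
  have "(\<Sum>u\<in>vars m. \<alpha> u) = (\<Sum>i<m. a (Suc i))"
    unfolding sum_vars using a by (intro sum.cong) (auto simp: weight_exponents_def)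
  also have "\<dots> = d"
    using assms by (simp add: sum.atLeast1_atMost_eq)
  finally show "\<alpha> \<in> exponents m d" using a by (simp add: exponents_def weight_exponents_def)
qed

text \<open>
  On a monomial the Cartan subalgebra acts by the total exponents of the columns. As these are known to
  have the same sum as the \<open>a i\<close>, testing against trace-zero diagonal matrices determines them.
\<close>
lemma two_row_weight_space:
  assumes sum: "(\<Sum>i=1..m. a i) = k + l"
  shows "weight_space fscale m (two_row_module m k l) (gl_action m) (\<lambda>H. \<Sum>i=1..m. of_nat (a i) * epsilon i H)
    = {f \<in> fun_on {\<alpha> \<in> weight_exponents m a. second_row m \<alpha> = l}. quantize m polar_kernel f = 0}"
    (is "?L = ?R")
proof
  have mu: "(\<Sum>i=1..m. of_nat (a i) * epsilon i H) = (\<Sum>i<m. of_nat (a (Suc i)) * H $$ (i, i))" for H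
    by (simp add: sum.atLeast1_atMost_eq epsilon_def)
  have gl: "gl_action m H f \<alpha> = (\<Sum>i<m. of_nat (\<alpha> (i, False) + \<alpha> (i, True)) * H $$ (i, i)) * f \<alpha>"
    if "H \<in> cartan m" for H f \<alpha>
    unfolding gl_action_cartan[OF that] quantize_diag sum_vars by (simp add: algebra_simps)
  show "?R \<subseteq> ?L"
  proof
    fix f assume f: "f \<in> ?R"
    then have nz: "\<alpha> \<in> weight_exponents m a \<and> second_row m \<alpha> = l" if "f \<alpha> \<noteq> 0" for \<alpha>
      using that by (auto simp: fun_on_def)
    then have "\<alpha> \<in> exponents m (k + l)" if "f \<alpha> \<noteq> 0" for \<alpha>
      using weight_exponents_subset[OF sum] that by blast
    moreover have "quantize m (row_kernel True) f \<alpha> = fscale (of_nat l) f \<alpha>" for \<alpha>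
    proof (cases "f \<alpha> = 0")
      case True
      then show ?thesis by (simp add: row_kernel_def quantize_diag fscale_apply)
    next
      case False
      have "(\<Sum>i<m. complex_of_nat (\<alpha> (i, True))) = of_nat l"
        using nz[OF False] by (simp add: second_row_def flip: of_nat_sum)
      then show ?thesis by (simp add: row_kernel_def quantize_diag fscale_apply sum_vars)
    qed
    ultimately have "f \<in> two_row_module m k l"
      using f by (auto simp: two_row_module_def fun_on_def fun_eq_iff)
    moreover have "gl_action m H f \<alpha> = fscale (\<Sum>i=1..m. of_nat (a i) * epsilon i H) f \<alpha>" if "H \<in> cartan m" for H \<alpha>
    proof (cases "f \<alpha> = 0")
      case True
      then show ?thesis by (simp add: gl[OF that] fscale_apply)
    next
      case False
      then have "(\<Sum>i<m. of_nat (\<alpha> (i, False) + \<alpha> (i, True)) * H $$ (i, i)) = (\<Sum>i<m. of_nat (a (Suc i)) * H $$ (i, i))"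
        using nz[OF False] by (intro sum.cong) (auto simp: weight_exponents_def)
      then show ?thesis by (simp only: gl[OF that] fscale_apply mu)
    qed
    ultimately show "f \<in> ?L" by (simp add: weight_space_def fun_eq_iff)
  qed
  show "?L \<subseteq> ?R"
  proof
    fix f assume f: "f \<in> ?L"
    then have W: "f \<in> two_row_module m k l" by (simp add: weight_space_def)
    have "\<alpha> \<in> weight_exponents m a \<and> second_row m \<alpha> = l" if nz: "f \<alpha> \<noteq> 0" for \<alpha>
    proof
      show "second_row m \<alpha> = l" using row_sum(1)[OF W nz] by (simp add: second_row_def)
      have ex: "\<alpha> \<in> exponents m (k + l)" using W nz by (auto simp: two_row_module_def fun_on_def)
      define b where "b i = \<alpha> (i, False) + \<alpha> (i, True)" for i
      have b_sum: "(\<Sum>i<m. b i) = (\<Sum>i<m. a (Suc i))"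
        using ex sum by (simp add: exponents_def sum_vars b_def sum.atLeast1_atMost_eq)
      have "b j = a (Suc j)" if j: "j < m" for j
      proof -
        \<comment> \<open>\<open>m\<close> times the \<open>j\<close>-th diagonal unit minus the identity isolates the entry at \<open>j\<close>, given equal sums\<close>
        define H where "H = mat m m (\<lambda>(p, q). if p = q then (if p = j then of_nat m else 0) - 1 else (0::complex))"
        have H: "H \<in> cartan m"
          using j by (auto simp: cartan_def sl_def diagonal_mat_def H_def sum_subtractf sum.delta)
        have ev: "(\<Sum>i<m. of_nat (c i) * H $$ (i, i)) = of_nat m * of_nat (c j) - of_nat (\<Sum>i<m. c i)" for c :: "nat \<Rightarrow> nat"
        proof -
          have "(\<Sum>i<m. of_nat (c i) * H $$ (i, i)) = (\<Sum>i<m. (if i = j then of_nat m * of_nat (c j) else 0) - of_nat (c i) :: complex)"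
            by (intro sum.cong) (auto simp: H_def algebra_simps)
          then show ?thesis using j by (simp add: sum_subtractf sum.delta)
        qed
        have "gl_action m H f \<alpha> = fscale (\<Sum>i=1..m. of_nat (a i) * epsilon i H) f \<alpha>"
          using f H by (simp add: weight_space_def)
        then have "(\<Sum>i<m. of_nat (b i) * H $$ (i, i)) = (\<Sum>i<m. of_nat (a (Suc i)) * H $$ (i, i))"
          using nz unfolding gl[OF H] mu fscale_apply b_def by simp
        then have "of_nat m * of_nat (b j) = (of_nat m * of_nat (a (Suc j)) :: complex)"
          unfolding ev b_sum by simp
        then show ?thesis using j by simp
      qed
      then show "\<alpha> \<in> weight_exponents m a"
        using ex by (simp add: weight_exponents_def exponents_def b_def)
    qed
    then show "f \<in> ?R" using W by (auto simp: fun_on_def two_row_module_def)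
  qed
qed

lemma shift_same_column:
  assumes "i < m" "r \<noteq> s" "\<alpha> (i, r) > 0"
  shows "shift (i, r) (i, s) \<alpha> \<in> weight_exponents m a \<longleftrightarrow> \<alpha> \<in> weight_exponents m a"
proof -
  have "shift (i, r) (i, s) \<alpha> (p, False) + shift (i, r) (i, s) \<alpha> (p, True) = \<alpha> (p, False) + \<alpha> (p, True)" for p
    using assms(2,3) by (cases r; cases s) (auto simp: shift_def)
  moreover have "shift (i, r) (i, s) \<alpha> u = \<alpha> u" if "u \<notin> vars m" for u
    using that assms(1) by (auto simp: shift_def)
  ultimately show ?thesis by (simp add: weight_exponents_def)
qed

lemma second_row_shift:
  assumes "i < m" "\<alpha> (i, r) > 0"
  shows "second_row m (shift (i, r) (i, s) \<alpha>) + (if r then 1 else 0) = second_row m \<alpha> + (if s then 1 else 0)"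
  using sum_shift[of "(i, r)" m "(i, s)" \<alpha> "\<lambda>u. if snd u then 1 else 0"] assms
  by (simp add: second_row_def sum_vars)

lemma quantize_polar_adjoint:
  "quantize m (\<lambda>u v. polar_kernel v u) f \<alpha> = (\<Sum>i<m. cre (i, True) (ann (i, False) f) \<alpha>)"
proof -
  have "(\<Sum>j<m. polar_kernel (j, False) (i, True) * h j) = h i" if "i < m" for i and h :: "nat \<Rightarrow> complex"
  proof -
    have "(\<Sum>j<m. polar_kernel (j, False) (i, True) * h j) = (\<Sum>j<m. if i = j then h j else 0)"
      by (intro sum.cong refl) (simp add: polar_kernel_def)
    then show ?thesis using that by simp
  qed
  moreover have "polar_kernel (j, False) (i, False) = 0" "polar_kernel (j, True) (i, r) = 0" for i j r
    by (auto simp: polar_kernel_def)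
  ultimately show ?thesis by (simp add: quantize_def sum_vars)
qed

lemma polar_fun_on:
  assumes "f \<in> fun_on {\<alpha> \<in> weight_exponents m a. second_row m \<alpha> = l}"
  shows "quantize m polar_kernel f \<in> fun_on {\<alpha> \<in> weight_exponents m a. Suc (second_row m \<alpha>) = l}"
proof -
  have "cre (i, False) (ann (i, True) f) \<alpha> = 0"
    if "i < m" "\<alpha> \<notin> {\<alpha> \<in> weight_exponents m a. Suc (second_row m \<alpha>) = l}" for i \<alpha>
  proof (cases "\<alpha> (i, False) = 0")
    case False
    then have "shift (i, False) (i, True) \<alpha> \<notin> {\<alpha> \<in> weight_exponents m a. second_row m \<alpha> = l}"
      using that shift_same_column[of i m False True \<alpha> a] second_row_shift[of i m \<alpha> False True] by auto
    then show ?thesis using assms by (simp add: cre_ann_shift fun_on_def)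
  qed (simp add: cre_ann_shift)
  then show ?thesis by (auto simp: fun_on_def quantize_polar intro!: sum.neutral)
qed

lemma polar_adjoint_fun_on:
  assumes "f \<in> fun_on {\<alpha> \<in> weight_exponents m a. Suc (second_row m \<alpha>) = l}"
  shows "quantize m (\<lambda>u v. polar_kernel v u) f \<in> fun_on {\<alpha> \<in> weight_exponents m a. second_row m \<alpha> = l}"
proof -
  have "cre (i, True) (ann (i, False) f) \<alpha> = 0"
    if "i < m" "\<alpha> \<notin> {\<alpha> \<in> weight_exponents m a. second_row m \<alpha> = l}" for i \<alpha>
  proof (cases "\<alpha> (i, True) = 0")
    case False
    then have "shift (i, True) (i, False) \<alpha> \<notin> {\<alpha> \<in> weight_exponents m a. Suc (second_row m \<alpha>) = l}"
      using that shift_same_column[of i m True False \<alpha> a] second_row_shift[of i m \<alpha> True False] by auto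
    then show ?thesis using assms by (simp add: cre_ann_shift fun_on_def)
  qed (simp add: cre_ann_shift)
  then show ?thesis by (auto simp: fun_on_def quantize_polar_adjoint intro!: sum.neutral)
qed

lemma polar_kernel_products:
  assumes "u \<in> vars m" "v \<in> vars m"
  shows "kernel_mult m polar_kernel (\<lambda>u v. polar_kernel v u) u v = row_kernel False u v"
    and "kernel_mult m (\<lambda>u v. polar_kernel v u) polar_kernel u v = row_kernel True u v"
proof -
  have u: "(fst u, r) \<in> vars m" for r using assms(1) by (cases u) simp
  have "kernel_mult m polar_kernel (\<lambda>u v. polar_kernel v u) u v =
      (\<Sum>w\<in>vars m. if w = (fst u, True) then row_kernel False u v else 0)"
    unfolding kernel_mult_def
    by (intro sum.cong refl) (auto simp: polar_kernel_def row_kernel_def diag_kernel_def prod_eq_iff)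
  then show "kernel_mult m polar_kernel (\<lambda>u v. polar_kernel v u) u v = row_kernel False u v"
    using u by (simp add: sum.delta)
  have "kernel_mult m (\<lambda>u v. polar_kernel v u) polar_kernel u v =
      (\<Sum>w\<in>vars m. if w = (fst u, False) then row_kernel True u v else 0)"
    unfolding kernel_mult_def
    by (intro sum.cong refl) (auto simp: polar_kernel_def row_kernel_def diag_kernel_def prod_eq_iff)
  then show "kernel_mult m (\<lambda>u v. polar_kernel v u) polar_kernel u v = row_kernel True u v"
    using u by (simp add: sum.delta)
qed

lemma cnj_polar_kernel: "cnj (polar_kernel u v) = polar_kernel u v"
  by (simp add: polar_kernel_def)

text \<open>
  The commutator of polarization \<open>D\<close> with its adjoint \<open>D'\<close> is the difference of the degrees of the
  two rows, which is \<open>(k + 1) - (l - 1)\<close> on \<open>g\<close>. If \<open>D' g = 0\<close>, then the inner product of \<open>D D' g\<close> with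
  \<open>g\<close> yields \<open>|D g|^2 + (k - l + 2) |g|^2 = 0\<close>; this is where \<open>l \<le> k\<close> is used.
\<close>
lemma polar_adjoint_inj:
  assumes sum: "(\<Sum>i=1..m. a i) = k + l" and kl: "l \<le> k"
    and g: "g \<in> fun_on {\<alpha> \<in> weight_exponents m a. Suc (second_row m \<alpha>) = l}"
    and zero: "quantize m (\<lambda>u v. polar_kernel v u) g = 0"
  shows "g = 0"
proof -
  let ?D = "quantize m polar_kernel" and ?D' = "quantize m (\<lambda>u v. polar_kernel v u)"
  let ?inner = "fock_inner m (k + l)"
  have row: "quantize m (row_kernel False) g = quantize m (row_kernel True) g + fscale (of_nat (k - l + 2)) g"
  proof
    fix \<alpha>
    show "quantize m (row_kernel False) g \<alpha> = (quantize m (row_kernel True) g + fscale (of_nat (k - l + 2)) g) \<alpha>"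
    proof (cases "g \<alpha> = 0")
      case True
      then show ?thesis by (simp add: row_kernel_def quantize_diag fscale_apply)
    next
      case False
      then have a: "\<alpha> \<in> weight_exponents m a" and l: "Suc (second_row m \<alpha>) = l"
        using g by (auto simp: fun_on_def)
      have "\<alpha> \<in> exponents m (k + l)" using a weight_exponents_subset[OF sum] by blast
      then have "(\<Sum>i<m. \<alpha> (i, False)) + second_row m \<alpha> = k + l"
        by (simp add: exponents_def sum_vars sum.distrib second_row_def)
      then have "(\<Sum>i<m. \<alpha> (i, False)) = second_row m \<alpha> + (k - l + 2)"
        using l kl by arith
      then have "(\<Sum>i<m. complex_of_nat (\<alpha> (i, False))) = (\<Sum>i<m. of_nat (\<alpha> (i, True))) + of_nat (k - l + 2)"
        unfolding second_row_def by (metis of_nat_add of_nat_sum)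
      then show ?thesis
        by (simp add: row_kernel_def quantize_diag fscale_apply sum_vars distrib_right del: of_nat_add)
    qed
  qed
  have "quantize m (kernel_mult m polar_kernel (\<lambda>u v. polar_kernel v u)) g = quantize m (row_kernel False) g"
    and "quantize m (kernel_mult m (\<lambda>u v. polar_kernel v u) polar_kernel) g = quantize m (row_kernel True) g"
    by (rule quantize_cong, erule polar_kernel_products, assumption)+
  then have "?D (?D' g) + quantize m (row_kernel True) g = ?D' (?D g) + quantize m (row_kernel False) g"
    using quantize_commutator[of m polar_kernel "\<lambda>u v. polar_kernel v u" g] by simp
  then have "?D' (?D g) + fscale (of_nat (k - l + 2)) g = 0"
    using zero row by (simp add: quantize_lin)
  then have "?inner (?D' (?D g)) g + of_nat (k - l + 2) * ?inner g g = 0"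
    by (metis weighted_inner_left(1,3,4))
  moreover have "?inner (?D' (?D g)) g = ?inner (?D g) (?D g)"
    using fock_inner_quantize[of m "k + l" "\<lambda>u v. polar_kernel v u" "?D g" g]
    by (simp add: cnj_polar_kernel)
  moreover obtain x where x: "x \<ge> 0" "?inner (?D g) (?D g) = of_real x"
    using weighted_inner_self[of "exponents m (k + l)" "exp_fact m" "?D g"] exp_fact_pos by auto
  moreover obtain y where y: "y \<ge> 0" "?inner g g = of_real y"
    using weighted_inner_self[of "exponents m (k + l)" "exp_fact m" g] exp_fact_pos by auto
  ultimately have "complex_of_real (x + real (k - l + 2) * y) = 0" by simp
  then have "x + real (k - l + 2) * y = 0" by (simp only: of_real_eq_0_iff)
  moreover have "real (k - l + 2) * y \<ge> y" using y(1) by (simp add: algebra_simps)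
  ultimately have "?inner g g = 0" using x(1) y by simp
  moreover have "g \<in> fun_on (exponents m (k + l))"
    using g weight_exponents_subset[OF sum] by (auto simp: fun_on_def)
  ultimately show ?thesis
    using weighted_inner_definite[of "exponents m (k + l)" "exp_fact m" g] finite_exponents exp_fact_pos by blast
qed

text \<open>
  The kernel of polarization is the orthogonal complement of the image of its adjoint, and the adjoint is
  injective. Writing \<open>Suc (second_row m \<alpha>) = l\<close> makes the second set empty for \<open>l = 0\<close>.
\<close>
theorem two_row_multiplicity:
  assumes sum: "(\<Sum>i=1..m. a i) = k + l" and kl: "l \<le> k"
  shows "weight_multiplicity fscale m (two_row_module m k l) (gl_action m) (\<lambda>H. \<Sum>i=1..m. of_nat (a i) * epsilon i H)
      + card {\<alpha> \<in> weight_exponents m a. Suc (second_row m \<alpha>) = l}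
    = card {\<alpha> \<in> weight_exponents m a. second_row m \<alpha> = l}"
proof -
  let ?X = "{\<alpha> \<in> weight_exponents m a. second_row m \<alpha> = l}"
  let ?Y = "{\<alpha> \<in> weight_exponents m a. Suc (second_row m \<alpha>) = l}"
  let ?D = "quantize m polar_kernel" and ?D' = "quantize m (\<lambda>u v. polar_kernel v u)"
  let ?inner = "fock_inner m (k + l)"
  let ?S = "?D' ` fun_on ?Y"
  have X: "?X \<subseteq> exponents m (k + l)" and Y: "?Y \<subseteq> exponents m (k + l)"
    using weight_exponents_subset[OF sum] by auto
  have fY: "finite ?Y" using Y finite_exponents by (rule finite_subset)
  have lin: "Vector_Spaces.linear fscale fscale ?D'"
    by (simp add: Vector_Spaces.linear_iff fn.vector_space_axioms quantize_lin del: plus_fun_apply)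
  have S: "fn.subspace ?S"
    using vector_space_pair.linear_subspace_image[OF _ lin fun_on_subspace] fn.vector_space_axioms
    by (simp add: vector_space_pair_def)
  have SX: "?S \<subseteq> fun_on ?X" using polar_adjoint_fun_on by blast
  have "inj_on ?D' (fun_on ?Y)"
  proof (rule inj_onI)
    fix g h assume gh: "g \<in> fun_on ?Y" "h \<in> fun_on ?Y" "?D' g = ?D' h"
    then have "g - h \<in> fun_on ?Y" using fn.subspace_diff[OF fun_on_subspace] by blast
    moreover have "?D' (g - h) = 0" using gh(3) by (simp add: quantize_lin)
    ultimately have "g - h = 0" using polar_adjoint_inj[OF sum kl] by blast
    then show "g = h" by simp
  qed
  then have dim_S: "fn.dim ?S = card ?Y"
    using dim_image_inj_on[OF fn.vector_space_axioms fn.vector_space_axioms lin fun_on_subspace] dim_fun_on[OF fY] by simp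
  have adj: "?inner f (?D' g) = ?inner (?D f) g" for f g
    using fock_inner_quantize[of m "k + l" polar_kernel f g] by (simp add: cnj_polar_kernel)
  have "{f \<in> fun_on ?X. ?D f = 0} = {f \<in> fun_on ?X. \<forall>s\<in>?S. ?inner f s = 0}"
  proof (rule Collect_cong, rule conj_cong[OF refl])
    fix f assume f: "f \<in> fun_on ?X"
    show "?D f = 0 \<longleftrightarrow> (\<forall>s\<in>?S. ?inner f s = 0)"
    proof
      assume "?D f = 0"
      then show "\<forall>s\<in>?S. ?inner f s = 0" by (simp add: adj weighted_inner_left)
    next
      assume "\<forall>s\<in>?S. ?inner f s = 0"
      then have "?inner (?D f) (?D f) = 0" using polar_fun_on[OF f] by (simp add: adj)
      moreover have "?D f \<in> fun_on (exponents m (k + l))"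
        using polar_fun_on[OF f] Y unfolding fun_on_def by blast
      ultimately show "?D f = 0"
        using weighted_inner_definite[of "exponents m (k + l)" "exp_fact m" "?D f"] finite_exponents exp_fact_pos by blast
    qed
  qed
  then show ?thesis
    using dim_orthogonal_complement[of "exponents m (k + l)" "exp_fact m", OF finite_exponents exp_fact_pos X S SX] dim_S
    unfolding weight_multiplicity_def two_row_weight_space[OF sum] by simp
qed

section \<open>Filling in the entries from the largest to the smallest\<close>

text \<open>
  A monomial of weight \<open>a\<close> is determined by the exponents of the second row; these vectors are the
  possible second rows.
\<close>
definition subvectors :: "nat \<Rightarrow> (nat \<Rightarrow> nat) \<Rightarrow> nat \<Rightarrow> (nat \<Rightarrow> nat) set" where
  "subvectors m a L = {c. (\<forall>i. i \<notin> {1..m} \<longrightarrow> c i = 0) \<and> (\<forall>i\<in>{1..m}. c i \<le> a i) \<and> (\<Sum>i=1..m. c i) = L}"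

text \<open>
  The stage of the counting at which the values from \<open>L\<close> down to \<open>j\<close> have been placed, each \<open>t\<close> as
  often as \<open>s\<close> prescribes, and the remaining entries are still zero.
\<close>
definition fillings :: "nat \<Rightarrow> (nat \<Rightarrow> nat) \<Rightarrow> nat \<Rightarrow> (nat \<Rightarrow> nat) \<Rightarrow> nat \<Rightarrow> (nat \<Rightarrow> nat) set" where
  "fillings m a L s j = {c. (\<forall>i. i \<notin> {1..m} \<longrightarrow> c i = 0) \<and>
     (\<forall>i\<in>{1..m}. c i \<le> a i \<and> (c i = 0 \<or> j \<le> c i \<and> c i \<le> L)) \<and>
     (\<forall>t\<in>{j..L}. card {i \<in> {1..m}. c i = t} = s t)}"

lemma int_binomial_of_nat: "int_binomial (int b) (int a) = int (b choose a)"
  by (simp add: int_binomial_def binomial_eq_0)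

lemma fillings_entry:
  assumes "c \<in> fillings m a L s j"
  shows "c i = 0 \<or> j \<le> c i \<and> c i \<le> L"
  using assms by (cases "i \<in> {1..m}") (simp_all only: fillings_def mem_Collect_eq, blast+)

text \<open>
  The value \<open>j\<close> may be placed wherever \<open>a i \<ge> j\<close> and nothing larger has been placed. All places
  already taken satisfy \<open>a i \<ge> j\<close> themselves, so the number of admissible places does not depend on the
  earlier choices. If there are no earlier choices, the factor may involve a negative number of places,
  but the product is zero anyway.
\<close>
lemma card_fillings_step:
  assumes j: "1 \<le> j" "j \<le> L"
  shows "finite (fillings m a L s (Suc j)) \<Longrightarrow> finite (fillings m a L s j)"
    and "finite (fillings m a L s (Suc j)) \<Longrightarrow> int (card (fillings m a L s j)) =
      int (card (fillings m a L s (Suc j))) *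
      int_binomial (int (card {i \<in> {1..m}. j \<le> a i}) - (\<Sum>t=Suc j..L. int (s t))) (int (s j))"
proof -
  let ?I = "{1..m}" and ?F = "fillings m a L s"
  define avail where "avail c = {i \<in> ?I. j \<le> a i \<and> c i = 0}" for c :: "nat \<Rightarrow> nat"
  define P where "P = Sigma (?F (Suc j)) (\<lambda>c. {B. B \<subseteq> avail c \<and> card B = s j})"
  have fin_avail: "finite (avail c)" for c by (simp add: avail_def)
  have card_avail: "int (card (avail c)) = int (card {i \<in> ?I. j \<le> a i}) - (\<Sum>t=Suc j..L. int (s t))"
    if c: "c \<in> ?F (Suc j)" for c
  proof -
    have c': "c i \<le> a i" "c i = 0 \<or> Suc j \<le> c i \<and> c i \<le> L" if "i \<in> ?I" for i
      using c that by (auto simp: fillings_def)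
    have "{i \<in> ?I. j \<le> a i} = avail c \<union> (\<Union>t\<in>{Suc j..L}. {i \<in> ?I. c i = t})"
    proof (intro Set.set_eqI iffI)
      fix i assume "i \<in> {i \<in> ?I. j \<le> a i}"
      then show "i \<in> avail c \<union> (\<Union>t\<in>{Suc j..L}. {i \<in> ?I. c i = t})"
        using c'(2)[of i] by (auto simp: avail_def)
    next
      fix i assume "i \<in> avail c \<union> (\<Union>t\<in>{Suc j..L}. {i \<in> ?I. c i = t})"
      then show "i \<in> {i \<in> ?I. j \<le> a i}"
        using c'(1)[of i] by (auto simp: avail_def)
    qed
    then have "card {i \<in> ?I. j \<le> a i} = card (avail c) + card (\<Union>t\<in>{Suc j..L}. {i \<in> ?I. c i = t})"
      using fin_avail by (simp only:) (intro card_Un_disjoint; auto simp: avail_def)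
    also have "card (\<Union>t\<in>{Suc j..L}. {i \<in> ?I. c i = t}) = (\<Sum>t=Suc j..L. card {i \<in> ?I. c i = t})"
      by (intro card_UN_disjoint) auto
    also have "\<dots> = (\<Sum>t=Suc j..L. s t)"
      using c by (intro sum.cong) (auto simp: fillings_def)
    finally show ?thesis by simp
  qed
  have bij: "bij_betw (\<lambda>(c, B) i. if i \<in> B then j else c i) P (?F j)"
  proof (rule bij_betw_byWitness[where f' = "\<lambda>c. (\<lambda>i. if c i = j then 0 else c i, {i \<in> ?I. c i = j})"])
    show "\<forall>p\<in>P. (\<lambda>c. (\<lambda>i. if c i = j then 0 else c i, {i \<in> ?I. c i = j})) ((\<lambda>(c, B) i. if i \<in> B then j else c i) p) = p"
    proof
      fix p assume "p \<in> P"
      then obtain c B where p: "p = (c, B)" "c \<in> ?F (Suc j)" "B \<subseteq> avail c" by (auto simp: P_def)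
      have "c i \<noteq> j" for i
        using fillings_entry[OF p(2), of i] j by auto
      then show "(\<lambda>c. (\<lambda>i. if c i = j then 0 else c i, {i \<in> ?I. c i = j})) ((\<lambda>(c, B) i. if i \<in> B then j else c i) p) = p"
        using p by (auto simp: avail_def fun_eq_iff)
    qed
    show "\<forall>c\<in>?F j. (\<lambda>(c, B) i. if i \<in> B then j else c i) (\<lambda>i. if c i = j then 0 else c i, {i \<in> ?I. c i = j}) = c"
      using j by (auto simp: fillings_def fun_eq_iff)
    show "(\<lambda>(c, B) i. if i \<in> B then j else c i) ` P \<subseteq> ?F j"
    proof clarify
      fix c B assume "(c, B) \<in> P"
      then have c: "c \<in> ?F (Suc j)" and B: "B \<subseteq> avail c" "card B = s j" by (auto simp: P_def)
      let ?c = "\<lambda>i. if i \<in> B then j else c i"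
      have "c i \<noteq> j" for i
        using fillings_entry[OF c, of i] j by auto
      then have eqB: "{i \<in> ?I. ?c i = j} = B" using B by (auto simp: avail_def)
      have eqc: "{i \<in> ?I. ?c i = t} = {i \<in> ?I. c i = t}" if "t \<in> {Suc j..L}" for t
        using B that by (auto simp: avail_def)
      have "card {i \<in> ?I. ?c i = t} = s t" if t: "t \<in> {j..L}" for t
      proof (cases "t = j")
        case True
        then show ?thesis using eqB B(2) by simp
      next
        case False
        with t have t': "t \<in> {Suc j..L}" by auto
        then have "card {i \<in> ?I. c i = t} = s t" using c unfolding fillings_def by blast
        then show ?thesis by (simp only: eqc[OF t'])
      qed
      moreover have "?c i = 0" if "i \<notin> ?I" for i
        using c B that by (auto simp: fillings_def avail_def)
      moreover have "?c i \<le> a i \<and> (?c i = 0 \<or> j \<le> ?c i \<and> ?c i \<le> L)" if "i \<in> ?I" for i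
      proof -
        have "c i \<le> a i" using c that unfolding fillings_def by blast
        then show ?thesis
          using B(1) j fillings_entry[OF c, of i] by (cases "i \<in> B") (auto simp: avail_def)
      qed
      ultimately show "?c \<in> ?F j" unfolding fillings_def by blast
    qed
    show "(\<lambda>c. (\<lambda>i. if c i = j then 0 else c i, {i \<in> ?I. c i = j})) ` ?F j \<subseteq> P"
    proof clarify
      fix c assume c: "c \<in> ?F j"
      let ?c = "\<lambda>i. if c i = j then 0 else c i"
      have eqc: "{i \<in> ?I. ?c i = t} = {i \<in> ?I. c i = t}" if "t \<in> {Suc j..L}" for t
        using that by auto
      have "card {i \<in> ?I. ?c i = t} = s t" if t: "t \<in> {Suc j..L}" for t
      proof -
        have "t \<in> {j..L}" using t by auto
        then have "card {i \<in> ?I. c i = t} = s t" using c unfolding fillings_def by blast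
        then show ?thesis by (simp only: eqc[OF t])
      qed
      moreover have "?c i = 0" if "i \<notin> ?I" for i
        using c that unfolding fillings_def by auto
      moreover have "?c i \<le> a i \<and> (?c i = 0 \<or> Suc j \<le> ?c i \<and> ?c i \<le> L)" if "i \<in> ?I" for i
      proof -
        have "c i \<le> a i" using c that unfolding fillings_def by blast
        then show ?thesis using fillings_entry[OF c, of i] by auto
      qed
      ultimately have "?c \<in> ?F (Suc j)" unfolding fillings_def by blast
      moreover have "{i \<in> ?I. c i = j} \<subseteq> avail ?c"
        using c by (auto simp: fillings_def avail_def)
      moreover have "card {i \<in> ?I. c i = j} = s j"
        using c j by (auto simp: fillings_def)
      ultimately show "(?c, {i \<in> ?I. c i = j}) \<in> P" by (simp add: P_def)
    qed
  qed
  have sub: "finite {B. B \<subseteq> avail c \<and> card B = s j}" for c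
    using fin_avail by (auto intro: rev_finite_subset[OF finite_Pow_iff[THEN iffD2]])
  {
    assume fin: "finite (?F (Suc j))"
    have "finite P" unfolding P_def using fin sub by (intro finite_SigmaI) auto
    then show "finite (?F j)" using bij_betw_finite[OF bij] by simp
    have "card (?F j) = card P" using bij_betw_same_card[OF bij] by simp
    also have "\<dots> = (\<Sum>c\<in>?F (Suc j). card (avail c) choose s j)"
      unfolding P_def using fin sub by (subst card_SigmaI) (auto simp: n_subsets fin_avail)
    finally have "int (card (?F j)) = (\<Sum>c\<in>?F (Suc j). int_binomial (int (card (avail c))) (int (s j)))"
      by (simp add: int_binomial_of_nat)
    also have "\<dots> = (\<Sum>c\<in>?F (Suc j). int_binomial (int (card {i \<in> ?I. j \<le> a i}) - (\<Sum>t=Suc j..L. int (s t))) (int (s j)))"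
      by (intro sum.cong) (auto simp: card_avail)
    finally show "int (card (?F j)) = int (card (?F (Suc j))) *
      int_binomial (int (card {i \<in> ?I. j \<le> a i}) - (\<Sum>t=Suc j..L. int (s t))) (int (s j))"
      by simp
  }
qed

lemma card_fillings:
  "finite (fillings m a L s 1) \<and> int (card (fillings m a L s 1)) =
    (\<Prod>j=1..L. int_binomial (int (card {i \<in> {1..m}. j \<le> a i}) - (\<Sum>t=Suc j..L. int (s t))) (int (s j)))"
proof -
  define b where "b j = int_binomial (int (card {i \<in> {1..m}. j \<le> a i}) - (\<Sum>t=Suc j..L. int (s t))) (int (s j))" for j
  have "(1::nat) \<le> Suc L" by simp
  then have "finite (fillings m a L s 1) \<and> int (card (fillings m a L s 1)) = (\<Prod>j\<in>{1..L}. b j)"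
  proof (induction rule: inc_induct)
    case base
    have "c i = 0" if "c \<in> fillings m a L s (Suc L)" for c i
      using that by (cases "i \<in> {1..m}") (auto simp: fillings_def)
    then have "fillings m a L s (Suc L) \<subseteq> {\<lambda>_. 0}" by auto
    moreover have "(\<lambda>_. 0) \<in> fillings m a L s (Suc L)" by (simp add: fillings_def)
    ultimately have "fillings m a L s (Suc L) = {\<lambda>_. 0}" by blast
    then show ?case by simp
  next
    case (step j)
    have "{j..L} = insert j {Suc j..L}" using step by auto
    then have "(\<Prod>t\<in>{j..L}. b t) = b j * (\<Prod>t\<in>{Suc j..L}. b t)" by simp
    then show ?case
      using card_fillings_step[of j L m a s] step by (simp add: b_def mult.commute)
  qed
  then show ?thesis by (simp add: b_def)
qed

lemma sum_eq_sum_card: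
  fixes f :: "nat \<Rightarrow> nat"
  assumes "finite I" "\<And>i. i \<in> I \<Longrightarrow> f i \<le> L"
  shows "(\<Sum>i\<in>I. f i) = (\<Sum>j=1..L. j * card {i \<in> I. f i = j})"
proof -
  have "(\<Sum>i\<in>I. f i) = (\<Sum>i\<in>I. \<Sum>j=1..L. if f i = j then j else 0)"
    using assms(2) by (intro sum.cong refl) (auto simp: sum.delta Suc_le_eq)
  also have "\<dots> = (\<Sum>j=1..L. \<Sum>i\<in>I. if f i = j then j else 0)"
    by (rule sum.swap)
  also have "\<dots> = (\<Sum>j=1..L. j * card {i \<in> I. f i = j})"
    using assms(1) by (intro sum.cong refl) (simp flip: sum.inter_filter)
  finally show ?thesis .
qed

section \<open>Partitions as contents of vectors\<close>

lemma down_closed_iff_le_card: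
  assumes D: "D \<subseteq> {1..m}" "\<And>i j. i \<in> D \<Longrightarrow> 1 \<le> j \<Longrightarrow> j \<le> i \<Longrightarrow> j \<in> D" and i: "i \<in> {1..(m::nat)}"
  shows "i \<in> D \<longleftrightarrow> i \<le> card D"
proof
  have fin: "finite D" using D(1) finite_subset by blast
  show "i \<le> card D" if "i \<in> D"
  proof -
    have "{1..i} \<subseteq> D" using D(2)[OF that] by auto
    then have "card {1..i} \<le> card D" by (rule card_mono[OF fin])
    then show ?thesis by simp
  qed
  show "i \<in> D" if "i \<le> card D"
  proof (rule ccontr)
    assume "i \<notin> D"
    then have "D \<subseteq> {1..<i}" using D(1) D(2)[of _ i] i by fastforce
    then have "card D \<le> card {1..<i}" by (intro card_mono) auto
    then show False using that i by auto
  qed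
qed

lemma partition_part_le:
  assumes "q \<in> partitions m (int L)" "i \<in> {1..m}"
  shows "q i \<le> int L"
  using assms member_le_sum[of i "{1..m}" q] by (auto simp: partitions_def)

text \<open>
  For a weakly decreasing tuple the positions of the parts that are at least \<open>t\<close> form an initial
  segment, so their number, a sum of part counts, determines them.
\<close>
lemma partition_eqI:
  assumes q: "q \<in> partitions m (int L)" "r \<in> partitions m (int L)"
    and eq: "\<And>j. j \<in> {1..L} \<Longrightarrow> card {i \<in> {1..m}. q i = int j} = card {i \<in> {1..m}. r i = int j}"
  shows "q = r"
proof -
  let ?I = "{1..m}"
  have big: "card {i \<in> ?I. t \<le> p i} = (\<Sum>j\<in>{nat t..L}. card {i \<in> ?I. p i = int j})"
    if p: "p \<in> partitions m (int L)" and t: "t \<ge> 1" for p t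
  proof -
    have "{i \<in> ?I. t \<le> p i} = (\<Union>j\<in>{nat t..L}. {i \<in> ?I. p i = int j})"
    proof (intro Set.set_eqI iffI)
      fix i assume i: "i \<in> {i \<in> ?I. t \<le> p i}"
      then have "nat (p i) \<in> {nat t..L}" "p i = int (nat (p i))"
        using partition_part_le[OF p, of i] t by auto
      then show "i \<in> (\<Union>j\<in>{nat t..L}. {i \<in> ?I. p i = int j})" using i by blast
    qed (use t in auto)
    then show ?thesis by (simp only:) (intro card_UN_disjoint; auto)
  qed
  have iff: "t \<le> p i \<longleftrightarrow> i \<le> card {i \<in> ?I. t \<le> p i}"
    if p: "p \<in> partitions m (int L)" and i: "i \<in> ?I" for p t i
  proof -
    have "i \<in> {i \<in> ?I. t \<le> p i} \<longleftrightarrow> i \<le> card {i \<in> ?I. t \<le> p i}"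
    proof (rule down_closed_iff_le_card[OF _ _ i])
      fix x y assume x: "x \<in> {i \<in> ?I. t \<le> p i}" and y: "1 \<le> y" "y \<le> x"
      then have "p y \<ge> p x" using p by (auto simp: partitions_def)
      then show "y \<in> {i \<in> ?I. t \<le> p i}" using x y by auto
    qed auto
    then show ?thesis using i by simp
  qed
  have same: "card {i \<in> ?I. t \<le> q i} = card {i \<in> ?I. t \<le> r i}" if "t \<ge> 1" for t
    unfolding big[OF q(1) that] big[OF q(2) that] using that by (intro sum.cong refl eq) auto
  show ?thesis
  proof (rule ext)
    fix i
    show "q i = r i"
    proof (cases "i \<in> ?I")
      case True
      have "t \<le> q i \<longleftrightarrow> t \<le> r i" if "t \<ge> 1" for t
        using iff[OF q(1) True] iff[OF q(2) True] same[OF that] by metis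
      moreover have "q i \<ge> 0" "r i \<ge> 0" using q True by (auto simp: partitions_def)
      ultimately show ?thesis
        by (metis dual_order.antisym int_one_le_iff_zero_less order.refl order_le_less)
    next
      case False
      then show ?thesis using q by (simp add: partitions_def extensional_def)
    qed
  qed
qed

lemma card_nth_eq_count:
  assumes "length xs = m"
  shows "card {i \<in> {1..m}. xs ! (i - 1) = x} = count (mset xs) x"
proof -
  have "{i \<in> {1..m}. xs ! (i - 1) = x} = Suc ` {i. i < length xs \<and> x = xs ! i}"
  proof (intro Set.set_eqI iffI)
    fix i assume "i \<in> {i \<in> {1..m}. xs ! (i - 1) = x}"
    then show "i \<in> Suc ` {i. i < length xs \<and> x = xs ! i}"
      using assms by (intro image_eqI[of _ _ "i - 1"]) auto
  qed (use assms in auto)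
  then have "card {i \<in> {1..m}. xs ! (i - 1) = x} = card {i. i < length xs \<and> x = xs ! i}"
    by (simp add: card_image)
  then show ?thesis by (simp only: count_mset count_list_eq_length_filter length_filter_conv_card)
qed

text \<open>
  Sorting the entries.
\<close>
lemma partition_of_content:
  assumes c: "(\<Sum>i=1..m. c i) = L"
  obtains q where "q \<in> partitions m (int L)"
    "\<And>j. card {i \<in> {1..m}. q i = int j} = card {i \<in> {1..m}. c i = j}"
proof
  define ys where "ys = map c [1..<Suc m]"
  define xs where "xs = rev (sort ys)"
  define q where "q = restrict (\<lambda>i. int (xs ! (i - 1))) {1..m}"
  have len: "length xs = m" "length ys = m" by (auto simp: xs_def ys_def)
  have ms: "mset xs = mset ys" by (simp add: xs_def)
  have sum_nth: "(\<Sum>i=1..m. zs ! (i - 1)) = sum_list zs" if "length zs = m" for zs :: "nat list"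
    using that by (simp add: sum_list_sum_nth sum.atLeast1_atMost_eq atLeast0LessThan)
  have ys_nth: "ys ! (i - 1) = c i" if "i \<in> {1..m}" for i
  proof -
    have "i - 1 < Suc m - 1" "1 + (i - 1) = i" using that by auto
    then show ?thesis by (simp only: ys_def nth_map_upt)
  qed
  show "card {i \<in> {1..m}. q i = int j} = card {i \<in> {1..m}. c i = j}" for j
  proof -
    have "{i \<in> {1..m}. q i = int j} = {i \<in> {1..m}. xs ! (i - 1) = j}" by (auto simp: q_def)
    moreover have "{i \<in> {1..m}. c i = j} = {i \<in> {1..m}. ys ! (i - 1) = j}" using ys_nth by auto
    ultimately show ?thesis using card_nth_eq_count[OF len(1)] card_nth_eq_count[OF len(2)] ms by simp
  qed
  have "(\<Sum>i=1..m. q i) = int (\<Sum>i=1..m. xs ! (i - 1))"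
    by (simp add: q_def)
  also have "\<dots> = int (sum_list ys)"
    using sum_nth[OF len(1)] ms by (metis sum_mset_sum_list)
  also have "sum_list ys = (\<Sum>i=1..m. ys ! (i - 1))" using sum_nth[OF len(2)] by simp
  also have "\<dots> = L" using ys_nth c by (metis (no_types, lifting) sum.cong)
  finally have "(\<Sum>i=1..m. q i) = int L" .
  moreover have "q i \<ge> q j" if "i \<in> {1..m}" "j \<in> {1..m}" "i \<le> j" for i j
  proof -
    have "sorted (rev xs)" by (simp add: xs_def)
    then have "xs ! (j - 1) \<le> xs ! (i - 1)"
      using that len by (intro sorted_rev_nth_mono) auto
    then show ?thesis using that by (simp add: q_def)
  qed
  ultimately show "q \<in> partitions m (int L)"
    by (auto simp: partitions_def q_def)
qed

lemma finite_partitions: "finite (partitions m N)"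
proof (rule finite_subset)
  show "partitions m N \<subseteq> PiE {1..m} (\<lambda>_. {0..N})"
  proof
    fix q assume q: "q \<in> partitions m N"
    have "q i \<le> N" if "i \<in> {1..m}" for i
      using q that member_le_sum[of i "{1..m}" q] by (auto simp: partitions_def)
    then show "q \<in> PiE {1..m} (\<lambda>_. {0..N})"
      using q by (auto simp: partitions_def PiE_def)
  qed
  show "finite (PiE {1..m} (\<lambda>_. {0..N}))" by (intro finite_PiE) auto
qed

text \<open>
  Each vector below \<open>a\<close> with sum \<open>L\<close> has the same content as exactly one partition of \<open>L\<close>, and
  sorting by this partition splits the vectors into fillings.
\<close>
lemma card_subvectors:
  "int (card (subvectors m a L)) = (\<Sum>q\<in>partitions m (int L). \<Prod>j=1..L.
     int_binomial (int (card {i \<in> {1..m}. j \<le> a i}) - (\<Sum>t=Suc j..L. part_count m q (int t))) (part_count m q (int j)))"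
proof -
  define s where "s q j = card {i \<in> {1..m}. q i = int j}" for q :: "nat \<Rightarrow> int" and j
  let ?P = "partitions m (int L)"
  let ?F = "\<lambda>q. fillings m a L (s q) 1"
  have F_iff: "c \<in> ?F q \<longleftrightarrow> c \<in> subvectors m a L \<and> (\<forall>t\<in>{1..L}. card {i \<in> {1..m}. c i = t} = s q t)"
    if q: "q \<in> ?P" for q c
  proof
    assume c: "c \<in> ?F q"
    have "(\<Sum>i=1..m. c i) = (\<Sum>j=1..L. j * card {i \<in> {1..m}. c i = j})"
    proof (rule sum_eq_sum_card)
      show "c i \<le> L" for i using fillings_entry[OF c, of i] by auto
    qed simp
    also have "\<dots> = (\<Sum>j=1..L. j * card {i \<in> {1..m}. nat (q i) = j})"
    proof (intro sum.cong refl)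
      fix j assume "j \<in> {1..L}"
      moreover from this have "{i \<in> {1..m}. nat (q i) = j} = {i \<in> {1..m}. q i = int j}" by auto
      ultimately show "j * card {i \<in> {1..m}. c i = j} = j * card {i \<in> {1..m}. nat (q i) = j}"
        using c by (auto simp: fillings_def s_def)
    qed
    also have "\<dots> = (\<Sum>i=1..m. nat (q i))"
      using partition_part_le[OF q] by (intro sum_eq_sum_card[symmetric]) (auto simp: nat_le_iff)
    also have "int \<dots> = (\<Sum>i=1..m. q i)"
      using q by (auto simp: partitions_def intro!: sum.cong)
    also have "\<dots> = int L" using q by (simp add: partitions_def)
    finally have "(\<Sum>i=1..m. c i) = L" by (simp only: of_nat_eq_iff)
    then show "c \<in> subvectors m a L \<and> (\<forall>t\<in>{1..L}. card {i \<in> {1..m}. c i = t} = s q t)"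
      using c by (auto simp: fillings_def subvectors_def)
  next
    assume c: "c \<in> subvectors m a L \<and> (\<forall>t\<in>{1..L}. card {i \<in> {1..m}. c i = t} = s q t)"
    have "c i \<le> L" if "i \<in> {1..m}" for i
      using c that member_le_sum[of i "{1..m}" c] by (auto simp: subvectors_def)
    then show "c \<in> ?F q" using c by (auto simp: fillings_def subvectors_def)
  qed
  have "subvectors m a L = (\<Union>q\<in>?P. ?F q)"
  proof (intro Set.set_eqI iffI)
    fix c assume c: "c \<in> subvectors m a L"
    then have cL: "(\<Sum>i=1..m. c i) = L" by (simp add: subvectors_def)
    obtain q where "q \<in> ?P" "\<And>j. card {i \<in> {1..m}. q i = int j} = card {i \<in> {1..m}. c i = j}"
      using partition_of_content[OF cL] by blast
    then show "c \<in> (\<Union>q\<in>?P. ?F q)" using c F_iff[of q c] by (auto simp: s_def)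
  qed (use F_iff in blast)
  moreover have "?F q \<inter> ?F r = {}" if "q \<in> ?P" "r \<in> ?P" "q \<noteq> r" for q r
  proof (rule ccontr)
    assume "?F q \<inter> ?F r \<noteq> {}"
    then obtain c where "c \<in> ?F q" "c \<in> ?F r" by blast
    then have "\<forall>t\<in>{1..L}. s q t = s r t" using F_iff[OF that(1)] F_iff[OF that(2)] by metis
    then show False using partition_eqI[OF that(1,2)] that(3) by (auto simp: s_def)
  qed
  moreover have "card (\<Union>q\<in>?P. ?F q) = (\<Sum>q\<in>?P. card (?F q))"
    if "\<And>q r. q \<in> ?P \<Longrightarrow> r \<in> ?P \<Longrightarrow> q \<noteq> r \<Longrightarrow> ?F q \<inter> ?F r = {}"
    using finite_partitions
  proof (rule card_UN_disjoint)
    show "\<forall>q\<in>?P. finite (?F q)" using card_fillings by blast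
    show "\<forall>q\<in>?P. \<forall>r\<in>?P. q \<noteq> r \<longrightarrow> ?F q \<inter> ?F r = {}" using that by blast
  qed
  ultimately have "card (subvectors m a L) = (\<Sum>q\<in>?P. card (?F q))"
    by presburger
  then have "int (card (subvectors m a L)) = (\<Sum>q\<in>?P. int (card (?F q)))" by simp
  then show ?thesis using card_fillings by (simp add: part_count_def s_def)
qed

lemma card_subvectors_formula:
  "int (card (subvectors m a L)) = (\<Sum>q\<in>partitions m (int L). \<Prod>j\<in>{1..int L}.
     int_binomial (int m - (\<Sum>t\<in>{0..j-1}. level_count m a t) - (\<Sum>i\<in>{j+1..int L}. part_count m q i))
       (part_count m q j))"
proof -
  have int_image: "{int x..int y} = int ` {x..y}" for x y by (simp add: image_int_atLeastAtMost)
  have lev: "int m - (\<Sum>t\<in>{0..int j - 1}. level_count m a t) = int (card {i \<in> {1..m}. j \<le> a i})" if "1 \<le> j" for j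
  proof -
    have "{0..int j - 1} = int ` {0..j - 1}"
      using that int_image[of 0 "j - 1"] by (simp add: of_nat_diff)
    then have "(\<Sum>t\<in>{0..int j - 1}. level_count m a t) = (\<Sum>t\<in>{0..j - 1}. int (card {i \<in> {1..m}. a i = t}))"
      by (simp add: sum.reindex level_count_def)
    also have "\<dots> = int (card (\<Union>t\<in>{0..j - 1}. {i \<in> {1..m}. a i = t}))"
      by (subst card_UN_disjoint) auto
    also have "(\<Union>t\<in>{0..j - 1}. {i \<in> {1..m}. a i = t}) = {1..m} - {i \<in> {1..m}. j \<le> a i}"
      using that by auto
    also have "int (card \<dots>) = int m - int (card {i \<in> {1..m}. j \<le> a i})"
    proof -
      have sub: "{i \<in> {1..m}. j \<le> a i} \<subseteq> {1..m}" by auto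
      then have "card ({1..m} - {i \<in> {1..m}. j \<le> a i}) = card {1..m} - card {i \<in> {1..m}. j \<le> a i}"
        by (intro card_Diff_subset) (auto intro: finite_subset)
      moreover have "card {i \<in> {1..m}. j \<le> a i} \<le> card {1..m}"
        using sub by (rule card_mono[rotated]) simp
      ultimately show ?thesis by (simp only: of_nat_diff card_atLeastAtMost diff_Suc_1)
    qed
    finally show ?thesis by simp
  qed
  have "(\<Prod>j\<in>{1..int L}. int_binomial (int m - (\<Sum>t\<in>{0..j-1}. level_count m a t)
       - (\<Sum>i\<in>{j+1..int L}. part_count m q i)) (part_count m q j)) =
     (\<Prod>j=1..L. int_binomial (int (card {i \<in> {1..m}. j \<le> a i}) - (\<Sum>t=Suc j..L. part_count m q (int t)))
       (part_count m q (int j)))" for q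
  proof -
    have "(\<Sum>i\<in>{int j + 1..int L}. part_count m q i) = (\<Sum>t=Suc j..L. part_count m q (int t))" for j
      using int_image[of "Suc j" L] by (simp add: sum.reindex add.commute)
    then show ?thesis
      using int_image[of 1 L] by (simp add: prod.reindex lev)
  qed
  then show ?thesis by (simp add: card_subvectors)
qed

lemma partitions_negative: "N < 0 \<Longrightarrow> partitions m N = {}"
proof (rule ccontr)
  assume "N < 0" "partitions m N \<noteq> {}"
  then obtain q where "q \<in> partitions m N" by blast
  then have "\<forall>i\<in>{1..m}. q i \<ge> 0" "(\<Sum>i=1..m. q i) = N"
    by (simp_all add: partitions_def)
  then show False using sum_nonneg[of "{1..m}" q] \<open>N < 0\<close> by simp
qed

text \<open>
  The entries of \<open>a\<close> other than \<open>a i\<close> have sum at most \<open>L\<close>. So a vector with sum \<open>L + 1\<close> has a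
  positive entry at \<open>i\<close>, which can be lowered, while the entry at \<open>i\<close> of a vector with sum \<open>L\<close> is at
  most \<open>L < a i\<close> and can be raised.
\<close>
lemma card_subvectors_large_entry:
  assumes sum: "(\<Sum>i=1..m. a i) = k + Suc L" and i: "i \<in> {1..m}" "a i > k" and kl: "Suc L \<le> k"
  shows "card (subvectors m a (Suc L)) = card (subvectors m a L)"
proof -
  have rest: "(\<Sum>j\<in>{1..m} - {i}. a j) \<le> L"
    using sum i sum.remove[of "{1..m}" i a] by simp
  have dec: "(\<Sum>j=1..m. c j) = c i + (\<Sum>j\<in>{1..m} - {i}. c j)" for c :: "nat \<Rightarrow> nat"
    using i sum.remove[of "{1..m}" i c] by simp
  have same: "(\<Sum>j\<in>{1..m} - {i}. (c(i := x)) j) = (\<Sum>j\<in>{1..m} - {i}. c j)" for c :: "nat \<Rightarrow> nat" and x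
    by (intro sum.cong) auto
  have "bij_betw (\<lambda>c. c(i := Suc (c i))) (subvectors m a L) (subvectors m a (Suc L))"
  proof (rule bij_betw_byWitness[where f' = "\<lambda>c. c(i := c i - 1)"])
    have pos: "c i > 0" if "c \<in> subvectors m a (Suc L)" for c
    proof -
      have "(\<Sum>j\<in>{1..m} - {i}. c j) \<le> (\<Sum>j\<in>{1..m} - {i}. a j)"
        using that by (intro sum_mono) (auto simp: subvectors_def)
      then show ?thesis using that rest dec[of c] by (auto simp: subvectors_def)
    qed
    show "\<forall>c\<in>subvectors m a (Suc L). (c(i := c i - 1))(i := Suc ((c(i := c i - 1)) i)) = c"
      using pos by auto
    show "(\<lambda>c. c(i := Suc (c i))) ` subvectors m a L \<subseteq> subvectors m a (Suc L)"
    proof clarify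
      fix c assume c: "c \<in> subvectors m a L"
      then have "c i \<le> L" using dec[of c] by (simp add: subvectors_def)
      then show "c(i := Suc (c i)) \<in> subvectors m a (Suc L)"
        using c i kl dec[of c] dec[of "c(i := Suc (c i))"] same[of c "Suc (c i)"] by (simp add: subvectors_def)
    qed
    show "(\<lambda>c. c(i := c i - 1)) ` subvectors m a (Suc L) \<subseteq> subvectors m a L"
    proof clarify
      fix c assume c: "c \<in> subvectors m a (Suc L)"
      then have "c i \<le> a i" using i unfolding subvectors_def by blast
      then have "c i - Suc 0 \<le> a i" by simp
      then show "c(i := c i - 1) \<in> subvectors m a L"
        using c i pos[OF c] dec[of c] dec[of "c(i := c i - 1)"] same[of c "c i - 1"] by (auto simp: subvectors_def)
    qed
  qed auto
  then show ?thesis by (simp add: bij_betw_same_card)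
qed

section \<open>The multiplicity formula\<close>

lemma card_weight_exponents:
  "card {\<alpha> \<in> weight_exponents m a. second_row m \<alpha> = L} = card (subvectors m a L)"
proof -
  let ?X = "{\<alpha> \<in> weight_exponents m a. second_row m \<alpha> = L}"
  let ?to = "\<lambda>\<alpha> i. if i \<in> {1..m} then \<alpha> (i - 1, True) else (0::nat)"
  let ?from = "\<lambda>c (i, r). if i < m then (if r then c (Suc i) else a (Suc i) - c (Suc i)) else (0::nat)"
  have "bij_betw ?to ?X (subvectors m a L)"
  proof (rule bij_betw_byWitness[where f' = ?from])
    show "\<forall>\<alpha>\<in>?X. ?from (?to \<alpha>) = \<alpha>"
    proof
      fix \<alpha> assume "\<alpha> \<in> ?X"
      then have z: "\<And>u. u \<notin> vars m \<Longrightarrow> \<alpha> u = 0" and s: "\<And>i. i < m \<Longrightarrow> \<alpha> (i, False) + \<alpha> (i, True) = a (Suc i)"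
        by (auto simp: weight_exponents_def)
      have at: "?from (?to \<alpha>) (i, r) = \<alpha> (i, r)" for i r
        using z[of "(i, r)"] s[of i] by (cases r) auto
      show "?from (?to \<alpha>) = \<alpha>"
      proof
        fix u show "?from (?to \<alpha>) u = \<alpha> u" using at by (cases u) (simp only:)
      qed
    qed
    show "\<forall>c\<in>subvectors m a L. ?to (?from c) = c"
      by (auto simp: subvectors_def fun_eq_iff)
    show "?to ` ?X \<subseteq> subvectors m a L"
    proof clarify
      fix \<alpha> assume a: "\<alpha> \<in> weight_exponents m a" and L: "L = second_row m \<alpha>"
      have "?to \<alpha> i \<le> a i" if "i \<in> {1..m}" for i
      proof -
        have "i - 1 < m" "Suc (i - 1) = i" using that by auto
        then have "\<alpha> (i - 1, False) + \<alpha> (i - 1, True) = a i" using a unfolding weight_exponents_def by fastforce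
        then show ?thesis using that by simp
      qed
      moreover have "(\<Sum>i=1..m. ?to \<alpha> i) = second_row m \<alpha>"
        by (simp add: second_row_def sum.atLeast1_atMost_eq)
      ultimately show "?to \<alpha> \<in> subvectors m a (second_row m \<alpha>)"
        unfolding subvectors_def by auto
    qed
    show "?from ` subvectors m a L \<subseteq> ?X"
    proof clarify
      fix c assume c: "c \<in> subvectors m a L"
      have "(\<Sum>i<m. c (Suc i)) = L"
        using c by (simp add: subvectors_def sum.atLeast1_atMost_eq)
      then have "second_row m (?from c) = L" by (simp add: second_row_def)
      moreover have "?from c \<in> weight_exponents m a"
        using c by (auto simp: weight_exponents_def vars_def subvectors_def)
      ultimately show "?from c \<in> weight_exponents m a \<and> second_row m (?from c) = L" by blast
    qed
  qed
  then show ?thesis by (rule bij_betw_same_card)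
qed

lemma two_row_multiplicity_subvectors:
  assumes "(\<Sum>i=1..m. a i) = k + l" "l \<le> k"
  shows "int (weight_multiplicity fscale m (two_row_module m k l) (gl_action m) (\<lambda>H. \<Sum>i=1..m. of_nat (a i) * epsilon i H))
    = int (card (subvectors m a l)) - (if l = 0 then 0 else int (card (subvectors m a (l - 1))))"
proof -
  have "card {\<alpha> \<in> weight_exponents m a. Suc (second_row m \<alpha>) = l} = (if l = 0 then 0 else card (subvectors m a (l - 1)))"
  proof (cases l)
    case (Suc L)
    then have "{\<alpha> \<in> weight_exponents m a. Suc (second_row m \<alpha>) = l} = {\<alpha> \<in> weight_exponents m a. second_row m \<alpha> = L}"
      by auto
    then show ?thesis using Suc by (simp add: card_weight_exponents)
  qed simp
  then show ?thesis
    using two_row_multiplicity[OF assms] card_weight_exponents[of m a l] by (cases "l = 0") auto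
qed

theorem theorem4p2:
  fixes n k l :: nat and a :: "nat \<Rightarrow> nat"
    and scale :: "complex \<Rightarrow> 'v::ab_group_add \<Rightarrow> 'v"
    and V :: "'v set" and \<rho> :: "complex mat \<Rightarrow> 'v \<Rightarrow> 'v"
    and \<mu> :: "complex mat \<Rightarrow> complex"
  assumes "n \<ge> 2" and "k \<ge> l"
    and "irreducible_sl_representation scale (n + 1) V \<rho>"
    and "has_highest_weight scale (n + 1) V \<rho>
           (\<lambda>H. of_nat k * epsilon 1 H + of_nat l * epsilon 2 H)"
    and "\<mu> = (\<lambda>H. \<Sum>i=1..n+1. of_nat (a i) * epsilon i H)"
    and "(\<Sum>i=1..n+1. a i) = k + l"
  shows "int (weight_multiplicity scale (n + 1) V \<rho> \<mu>) =
    (if \<forall>i\<in>{1..n+1}. a i \<le> k then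
       (\<Sum>q\<in>partitions (n + 1) (int l).
          \<Prod>j\<in>{1..int l}.
            int_binomial
              (int (n + 1) - (\<Sum>t\<in>{0..j-1}. level_count (n + 1) a t)
                 - (\<Sum>i\<in>{j+1..int l}. part_count (n + 1) q i))
              (part_count (n + 1) q j))
       - (\<Sum>q\<in>partitions (n + 1) (int l - 1).
          \<Prod>j\<in>{1..int l - 1}.
            int_binomial
              (int (n + 1) - (\<Sum>t\<in>{0..j-1}. level_count (n + 1) a t)
                 - (\<Sum>i\<in>{j+1..int l - 1}. part_count (n + 1) q i))
              (part_count (n + 1) q j))
     else 0)"
proof -
  define m where "m = n + 1"
  have m: "2 \<le> m" using assms(1) by (simp add: m_def)
  have sum: "(\<Sum>i=1..m. a i) = k + l" using assms(6) by (simp only: m_def)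
  define N where "N b = (\<Sum>q\<in>partitions m b. \<Prod>j\<in>{1..b}. int_binomial
      (int m - (\<Sum>t\<in>{0..j-1}. level_count m a t) - (\<Sum>i\<in>{j+1..b}. part_count m q i)) (part_count m q j))" for b
  have N: "N (int b) = int (card (subvectors m a b))" for b
    unfolding N_def card_subvectors_formula ..
  have N_neg: "N b = 0" if "b < 0" for b
    using partitions_negative[OF that, of m] by (simp add: N_def)
  have "weight_multiplicity scale m V \<rho> \<mu> =
      weight_multiplicity fscale m (two_row_module m k l) (gl_action m) \<mu>"
    using assms(3,4)[folded m_def] two_row_module_irreducible[OF m assms(2)] two_row_module_highest_weight[OF m assms(2)]
    by (intro weight_multiplicity_unique)
  then have mult: "int (weight_multiplicity scale m V \<rho> \<mu>) = N (int l) - N (int l - 1)"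
    using two_row_multiplicity_subvectors[OF sum assms(2)] N_neg[of "-1"]
    unfolding assms(5) m_def[symmetric] by (cases l) (simp_all add: N flip: N)
  have "N (int l) - N (int l - 1) = 0" if "\<not> (\<forall>i\<in>{1..m}. a i \<le> k)"
  proof -
    obtain i where i: "i \<in> {1..m}" "a i > k" using \<open>\<not> _\<close> by auto
    then have "l \<noteq> 0" using sum member_le_sum[of i "{1..m}" a] by auto
    then obtain L where "l = Suc L" by (cases l) auto
    then show ?thesis
      using card_subvectors_large_entry[of a m k L i] sum i assms(2) N[of l] N[of L] by simp
  qed
  then show ?thesis
    using mult unfolding N_def m_def by (simp del: of_nat_add)
qed

end
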